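(* Let $E\subset\mathbb C$ be a compact set whose boundary $\partial E$ is a rectifiable Jordan curve, and let $A$ be a bounded linear operator on a complex Hilbert space whose spectrum $\sigma(A)$ is contained in the interior of $E$. Let $L$ be the length of $\partial E$, let $\sigma=\sigma(s)$, $s\in[0,L]$, be a counterclockwise parametrization of $\partial E$ by arc length, and let $\nu=\nu(s)$ be the unit outer normal of $\partial E$ at $\sigma(s)$ (defined for almost every $s$). For almost every $s\in[0,L]$ define the self-adjoint operator $$\mu(s,A)=\frac1{2\pi}\Big(\nu(s)\,(\sigma(s)-A)^{-1}+\overline{\nu(s)}\,(\overline{\sigma(s)}-A^* )^{-1}\Big),$$ let $\alpha(s)$ be the minimum of the spectrum of $\mu(s,A)$, and let $\alpha_-(s)=\max\{0,-\alpha(s)\}$. Let $F_n$ be the $n$th Faber polynomial of $E$. Then for every integer $n\ge1$, $$\|F_n(A)\|\le 2\Big(1+\int_0^L\alpha_-(s)\,ds\Big).$$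
   Context: $\|\cdot\|$ is the operator norm. $E$ is the closed region bounded by the Jordan curve $\partial E$. The unit outer normal is viewed as a complex number, $\nu(s)=\frac1i\frac{d\sigma}{ds}(s)$, which exists for almost every $s$. Faber polynomials: let $\Phi$ be the Riemann map sending the exterior of $E$ conformally onto the exterior of the closed unit disk, with $\Phi(\infty)=\infty$ and $\Phi'(\infty)>0$. The $n$th Faber polynomial $F_n=F_n^E$ is the polynomial part of the Laurent expansion of $\Phi^n$ at infinity, i.e. the polynomial satisfying $F_n(z)=\Phi(z)^n+O(1/z)$ as $z\to\infty$. *)

theory Defs
  imports "HOL-Complex_Analysis.Complex_Analysis" "HOL-Library.Landau_Symbols"
begin

text \<open>
  A complex inner product space is a real one (with real inner product \<open>Re \<langle>x, y\<rangle>\<close>) carrying a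
  compatible complex scalar multiplication and a sesquilinear form, linear in the first argument.
  In particular \<open>norm x ^ 2 = Re \<langle>x, x\<rangle>\<close>, and the norm and topology are those of the library.
\<close>

class complex_inner = real_inner +
  fixes scaleC :: "complex \<Rightarrow> 'a \<Rightarrow> 'a"  (infixr "*\<^sub>C" 75)
    and cinner :: "'a \<Rightarrow> 'a \<Rightarrow> complex"
  assumes scaleC_add_right: "c *\<^sub>C (x + y) = c *\<^sub>C x + c *\<^sub>C y"
    and scaleC_add_left: "(c + d) *\<^sub>C x = c *\<^sub>C x + d *\<^sub>C x"
    and scaleC_scaleC: "c *\<^sub>C (d *\<^sub>C x) = (c * d) *\<^sub>C x"
    and scaleC_complex_of_real: "complex_of_real r *\<^sub>C x = r *\<^sub>R x"
    and cinner_commute: "cinner x y = cnj (cinner y x)"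
    and cinner_add_left: "cinner (x + y) z = cinner x z + cinner y z"
    and cinner_scaleC_left: "cinner (c *\<^sub>C x) y = c * cinner x y"
    and Re_cinner: "Re (cinner x y) = inner x y"

class complex_hilbert = complex_inner + complete_space

definition bounded_clinear :: "('a::complex_inner \<Rightarrow> 'a) \<Rightarrow> bool"
  where "bounded_clinear T \<longleftrightarrow> bounded_linear T \<and> (\<forall>c x. T (c *\<^sub>C x) = c *\<^sub>C T x)"

definition cspectrum :: "('a::complex_inner \<Rightarrow> 'a) \<Rightarrow> complex set"
  where "cspectrum T =
    {z. \<not> (\<exists>R. bounded_clinear R \<and>
             (\<forall>x. R (z *\<^sub>C x - T x) = x) \<and> (\<forall>x. z *\<^sub>C R x - T (R x) = x))}"

text \<open>\<open>resolvent T z\<close> is \<open>(z - T)\<^sup>-\<^sup>1\<close>; it is meaningful only for \<open>z \<notin> cspectrum T\<close>.\<close>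

definition resolvent :: "('a::complex_inner \<Rightarrow> 'a) \<Rightarrow> complex \<Rightarrow> 'a \<Rightarrow> 'a"
  where "resolvent T z = inv (\<lambda>x. z *\<^sub>C x - T x)"

definition cadjoint :: "('a::complex_inner \<Rightarrow> 'a) \<Rightarrow> 'a \<Rightarrow> 'a"
  where "cadjoint T = (THE S. \<forall>x y. cinner (T x) y = cinner x (S y))"

definition min_spectrum :: "('a::complex_inner \<Rightarrow> 'a) \<Rightarrow> real"
  where "min_spectrum T = (LEAST t. complex_of_real t \<in> cspectrum T)"

definition poly_op :: "complex poly \<Rightarrow> ('a::complex_inner \<Rightarrow> 'a) \<Rightarrow> 'a \<Rightarrow> 'a"
  where "poly_op p T x = (\<Sum>k\<le>degree p. coeff p k *\<^sub>C (T ^^ k) x)"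

definition arc_length :: "(real \<Rightarrow> complex) \<Rightarrow> real \<Rightarrow> real \<Rightarrow> ennreal"
  where "arc_length g a b =
    (SUP ts\<in>{ts. sorted ts \<and> set ts \<subseteq> {a..b}}.
       \<Sum>i<length ts - 1. ennreal (dist (g (ts ! i)) (g (ts ! Suc i))))"

definition rectifiable_Jordan_curve :: "complex set \<Rightarrow> bool"
  where "rectifiable_Jordan_curve C \<longleftrightarrow>
    (\<exists>g. simple_path g \<and> pathfinish g = pathstart g \<and> path_image g = C \<and> arc_length g 0 1 < \<infinity>)"

text \<open>
  Paths of the library live on \<open>{0..1}\<close>, hence the rescaling by \<open>L\<close>. The condition on
  \<open>arc_length\<close> at \<open>s = L\<close> says that \<open>L\<close> is the length of \<open>C\<close>.
\<close>

definition ccw_arc_length_param :: "complex set \<Rightarrow> real \<Rightarrow> (real \<Rightarrow> complex) \<Rightarrow> bool"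
  where "ccw_arc_length_param C L \<sigma> \<longleftrightarrow>
    0 < L \<and>
    simple_path (\<lambda>t. \<sigma> (L * t)) \<and> \<sigma> L = \<sigma> 0 \<and> \<sigma> ` {0..L} = C \<and>
    (\<forall>s\<in>{0..L}. arc_length \<sigma> 0 s = ennreal s) \<and>
    (\<forall>z\<in>inside C. winding_number (\<lambda>t. \<sigma> (L * t)) z = 1)"

text \<open>This is meaningful at the points where \<open>\<sigma>\<close> is differentiable, that is, almost everywhere.\<close>

definition outer_normal :: "real \<Rightarrow> (real \<Rightarrow> complex) \<Rightarrow> real \<Rightarrow> complex"
  where "outer_normal L \<sigma> s = (1 / \<i>) * vector_derivative \<sigma> (at s within {0..L})"

text \<open>
  \<open>\<Phi>'(\<infinity>)\<close> is the limit of \<open>\<Phi>(z) / z\<close> at infinity.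
\<close>

definition is_exterior_map :: "complex set \<Rightarrow> (complex \<Rightarrow> complex) \<Rightarrow> bool"
  where "is_exterior_map E \<Phi> \<longleftrightarrow>
    \<Phi> holomorphic_on (- E) \<and> bij_betw \<Phi> (- E) (- cball 0 1) \<and>
    filterlim \<Phi> at_infinity at_infinity \<and>
    (\<exists>c>0. ((\<lambda>z. \<Phi> z / z) \<longlongrightarrow> complex_of_real c) at_infinity)"

text \<open>
  The exterior map is unique as a function on \<open>- E\<close>; as a total function its values on \<open>E\<close> are
  arbitrary, so it is chosen by \<open>SOME\<close>. These values do not affect the Faber polynomials.
\<close>

definition exterior_map :: "complex set \<Rightarrow> complex \<Rightarrow> complex"
  where "exterior_map E = (SOME \<Phi>. is_exterior_map E \<Phi>)"

definition faber_poly :: "complex set \<Rightarrow> nat \<Rightarrow> complex poly"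
  where "faber_poly E n =
    (THE p. (\<lambda>z. exterior_map E z ^ n - poly p z) \<in> O[at_infinity](\<lambda>z. 1 / z))"

definition mu_op ::
    "real \<Rightarrow> (real \<Rightarrow> complex) \<Rightarrow> ('a::complex_inner \<Rightarrow> 'a) \<Rightarrow> real \<Rightarrow> 'a \<Rightarrow> 'a"
  where "mu_op L \<sigma> A s x = (1 / (2 * pi)) *\<^sub>R
    (outer_normal L \<sigma> s *\<^sub>C resolvent A (\<sigma> s) x +
     cnj (outer_normal L \<sigma> s) *\<^sub>C resolvent (cadjoint A) (cnj (\<sigma> s)) x)"

definition alpha_minus ::
    "real \<Rightarrow> (real \<Rightarrow> complex) \<Rightarrow> ('a::complex_inner \<Rightarrow> 'a) \<Rightarrow> real \<Rightarrow> real"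
  where "alpha_minus L \<sigma> A s = max 0 (- min_spectrum (mu_op L \<sigma> A s))"

end

theory Submission
  imports Defs
begin

text \<open>
  Let \<open>\<Phi>\<close> be the exterior map. If \<open>\<Phi>\<close> had boundary values, then \<open>\<bar>\<Phi>\<bar> = 1\<close> on the curve, so the
  integral of \<open>cnj (\<Phi>\<^sup>n) = 1 / \<Phi>\<^sup>n\<close> against the resolvent would vanish, and \<open>F\<^sub>n(A)\<close> would be the integral
  of \<open>\<Phi>\<^sup>n \<mu>(s, A) ds\<close>. Since \<open>\<mu> + \<alpha>\<^sub>-\<close> is positive, the Cauchy-Schwarz inequality bounds that integral by
  \<open>2 + 2 \<integral> \<alpha>\<^sub>-\<close>.

  To avoid boundary values, \<open>\<Phi>\<close> is replaced by the exterior maps \<open>\<Phi>\<^sub>k\<close> of compact sets exhausting the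
  inside of the curve. These are holomorphic across the curve and converge to \<open>\<Phi>\<close> locally uniformly
  (Caratheodory kernel theorem); normal families also give \<open>\<bar>\<Phi>\<^sub>k\<bar> \<rightarrow> 1\<close> uniformly on the curve. For functions
  holomorphic across a rectifiable loop, Cauchy's theorem follows by smoothing the loop and using that
  Lipschitz functions are differentiable almost everywhere.
\<close>

section \<open>Operators on complex Hilbert spaces\<close>

text \<open>The 2 in the bound is the integral of the form of \<mu> at a unit vector: the resolvent
  and its adjoint contribute 1 each. Positivity of \<mu> + \<alpha>_- is used at one vector of the
  form \<theta>x - y, whose norm is at most 2. This gives a pointwise bound for the form at (x, y)
  that is already linear in \<mu> and \<alpha>_-, so it can be integrated as it stands.

  With P the reciprocal of an approximating exterior map, the modulus of P on the curve is slightly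
  below 1, and the conjugate of P^n differs from 1/P^n by exactly 1/|P|^n - |P|^n. Only the uniform
  convergence |P| -> 1 on the curve is needed to remove this error, not convergence of P itself
  there. The assumption n >= 1 enters in the vanishing integral: P^n times the resolvent form must
  decay like 1/|z|^2.

  Exterior domains are treated in the coordinate u = 1/(z - a) with a inside the curve. They become
  bounded simply connected domains containing 0, where the Riemann mapping theorem and the Schwarz
  lemma apply, and the reciprocals of exterior maps become ordinary disk maps.\<close>

lemma scaleC_zero_left [simp]: "0 *\<^sub>C (x::'a::complex_inner) = 0"
  using scaleC_complex_of_real[of 0 x] by simp

lemma scaleC_one [simp]: "1 *\<^sub>C (x::'a::complex_inner) = x"
  using scaleC_complex_of_real[of 1 x] by simp

lemma scaleC_zero_right [simp]: "c *\<^sub>C (0::'a::complex_inner) = 0"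
  using scaleC_add_right[of c 0 "0::'a"] by simp

lemma scaleC_minus_right: "c *\<^sub>C (- x::'a::complex_inner) = - (c *\<^sub>C x)"
  using scaleC_add_right[of c x "-x"] by (simp add: eq_neg_iff_add_eq_0 add.commute)

lemma scaleC_minus_left: "(- c) *\<^sub>C (x::'a::complex_inner) = - (c *\<^sub>C x)"
  using scaleC_add_left[of c "-c" x] by (simp add: eq_neg_iff_add_eq_0 add.commute)

lemma scaleC_diff_right: "c *\<^sub>C (x - y::'a::complex_inner) = c *\<^sub>C x - c *\<^sub>C y"
  using scaleC_add_right[of c x "-y"] by (simp add: scaleC_minus_right)

lemma scaleC_diff_left: "(c - d) *\<^sub>C (x::'a::complex_inner) = c *\<^sub>C x - d *\<^sub>C x"
  using scaleC_add_left[of c "-d" x] by (simp add: scaleC_minus_left)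

lemma scaleC_scaleR: "c *\<^sub>C (r *\<^sub>R x::'a::complex_inner) = r *\<^sub>R (c *\<^sub>C x)"
  by (simp add: scaleC_complex_of_real[symmetric] scaleC_scaleC mult.commute)

lemma cinner_zero_left [simp]: "cinner 0 (y::'a::complex_inner) = 0"
  using cinner_add_left[of 0 0 y] by simp

lemma cinner_minus_left: "cinner (- x) (y::'a::complex_inner) = - cinner x y"
  using cinner_add_left[of x "-x" y] by (simp add: eq_neg_iff_add_eq_0 add.commute)

lemma cinner_diff_left: "cinner (x - z) (y::'a::complex_inner) = cinner x y - cinner z y"
  using cinner_add_left[of x "-z" y] by (simp add: cinner_minus_left)

lemma cinner_scaleR_left: "cinner (r *\<^sub>R x) (y::'a::complex_inner) = of_real r * cinner x y"
  by (metis cinner_scaleC_left scaleC_complex_of_real)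

lemma cinner_diff_right: "cinner x (y - z::'a::complex_inner) = cinner x y - cinner x z"
  by (metis cinner_diff_left cinner_commute complex_cnj_diff)

lemma cinner_scaleC_right: "cinner x (c *\<^sub>C y::'a::complex_inner) = cnj c * cinner x y"
  by (metis cinner_scaleC_left cinner_commute complex_cnj_mult)

lemma cinner_self: "cinner x (x::'a::complex_inner) = of_real ((norm x)\<^sup>2)"
proof (rule complex_eqI)
  show "Re (cinner x x) = Re (of_real ((norm x)\<^sup>2))"
    by (simp add: Re_cinner power2_norm_eq_inner)
  have "Im (cinner x x) = - Im (cinner x x)"
    by (subst cinner_commute) simp
  then show "Im (cinner x x) = Im (of_real ((norm x)\<^sup>2))"
    by simp
qed

lemma norm_scaleC: "norm (c *\<^sub>C (x::'a::complex_inner)) = cmod c * norm x"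
proof -
  have "of_real ((norm (c *\<^sub>C x))\<^sup>2) = c * cnj c * cinner x x"
    unfolding cinner_self[symmetric] by (simp add: cinner_scaleC_left cinner_scaleC_right)
  also have "\<dots> = of_real ((cmod c)\<^sup>2 * (norm x)\<^sup>2)"
    by (simp add: cinner_self) (metis complex_norm_square of_real_power)
  finally have "(norm (c *\<^sub>C x))\<^sup>2 = (cmod c * norm x)\<^sup>2"
    unfolding of_real_eq_iff by (simp add: power_mult_distrib)
  then show ?thesis
    by (simp add: power2_eq_iff_nonneg)
qed

text \<open>Rotating a value onto the nonnegative axis reduces estimates of a modulus to estimates
  of a real part. The same rotation later makes the derivative of a Riemann map at 0
  positive.\<close>

lemma unit_multiple_norm:
  fixes z :: complex
  obtains c where "cmod c = 1" "c * z = of_real (cmod z)"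
proof (cases "z = 0")
  case True
  then show ?thesis using that[of 1] by simp
next
  case False
  show ?thesis
  proof (rule that[of "cnj z / cmod z"])
    show "cmod (cnj z / cmod z) = 1" using False by (simp add: norm_divide)
    have "cnj z * z = of_real (cmod z) * of_real (cmod z)"
      by (metis complex_norm_square mult.commute power2_eq_square of_real_mult)
    then show "cnj z / cmod z * z = of_real (cmod z)" using False by simp
  qed
qed

lemma norm_cinner_le: "cmod (cinner x y) \<le> norm x * norm (y::'a::complex_inner)"
proof -
  obtain c where c: "cmod c = 1" "c * cinner x y = of_real (cmod (cinner x y))"
    using unit_multiple_norm by blast
  have "cmod (cinner x y) = Re (c * cinner x y)" using c by simp
  also have "\<dots> = inner (c *\<^sub>C x) y" by (metis Re_cinner cinner_scaleC_left)
  also have "\<dots> \<le> norm (c *\<^sub>C x) * norm y" by (rule norm_cauchy_schwarz)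
  finally show ?thesis using c by (simp add: norm_scaleC)
qed

lemma cinner_ext: 
  assumes "\<And>y. cinner x y = cinner z (y::'a::complex_inner)" shows "x = z"
proof -
  have "cinner (x - z) (x - z) = 0"
    by (subst cinner_diff_left) (simp add: assms)
  then show ?thesis unfolding cinner_self of_real_eq_0_iff by simp
qed

section \<open>Bounded complex-linear operators\<close>

lemma bounded_clinear_linear: "bounded_clinear T \<Longrightarrow> bounded_linear T"
  by (simp add: bounded_clinear_def)

lemma bounded_clinear_scaleC: "bounded_clinear T \<Longrightarrow> T (c *\<^sub>C x) = c *\<^sub>C T x"
  by (simp add: bounded_clinear_def)

lemma bounded_clinear_add: "bounded_clinear T \<Longrightarrow> T (x + y) = T x + T y"
  by (simp add: bounded_clinear_def bounded_linear.linear linear_add)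

lemma bounded_clinear_diff: "bounded_clinear T \<Longrightarrow> T (x - y) = T x - T y"
  by (simp add: bounded_clinear_def bounded_linear.linear linear_diff)

lemma bounded_clinearI:
  assumes "\<And>x y. T (x + y) = T x + T y" "\<And>c x. T (c *\<^sub>C x) = c *\<^sub>C T x"
    and "\<And>x. norm (T x) \<le> norm x * K"
  shows "bounded_clinear T"
  unfolding bounded_clinear_def
proof
  show "bounded_linear T"
    by (rule bounded_linear_intro[where K=K])
      (use assms in \<open>auto simp: scaleC_complex_of_real[symmetric]\<close>)
qed (use assms in blast)

lemma bounded_clinear_bound:
  assumes "bounded_clinear T" obtains K where "K > 0" "\<And>x. norm (T x) \<le> K * norm x"
  using bounded_linear.pos_bounded[OF bounded_clinear_linear[OF assms]]
  by (metis mult.commute)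

lemma bounded_clinear_ident: "bounded_clinear (\<lambda>x. x)"
  by (rule bounded_clinearI[where K=1]) auto

lemma bounded_clinear_sum:
  assumes "bounded_clinear S" "bounded_clinear T" shows "bounded_clinear (\<lambda>x. S x + T x)"
  using assms unfolding bounded_clinear_def
  by (auto intro: bounded_linear_add simp: scaleC_add_right)

lemma bounded_clinear_minus:
  assumes "bounded_clinear S" "bounded_clinear T" shows "bounded_clinear (\<lambda>x. S x - T x)"
  using assms unfolding bounded_clinear_def
  by (auto intro: bounded_linear_sub simp: scaleC_diff_right)

lemma bounded_clinear_scale:
  assumes "bounded_clinear T" shows "bounded_clinear (\<lambda>x. c *\<^sub>C T x)"
proof -
  obtain K where K: "\<And>x. norm (T x) \<le> K * norm x"
    using bounded_clinear_bound[OF assms] by blast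
  show ?thesis
  proof (rule bounded_clinearI[where K="cmod c * K"])
    fix x show "norm (c *\<^sub>C T x) \<le> norm x * (cmod c * K)"
      using mult_left_mono[OF K[of x], of "cmod c"] by (simp add: norm_scaleC mult_ac)
  qed (simp_all add: bounded_clinear_add[OF assms] bounded_clinear_scaleC[OF assms]
      scaleC_add_right scaleC_scaleC mult.commute)
qed

lemma bounded_clinear_compose:
  assumes "bounded_clinear S" "bounded_clinear T" shows "bounded_clinear (\<lambda>x. S (T x))"
  using assms unfolding bounded_clinear_def
  by (auto intro: bounded_linear_compose)

text \<open>A Lax-Milgram argument. It serves twice: for perturbing a resolvent, and for showing
  that reals below the numerical range of a selfadjoint operator lie outside its spectrum.\<close>

lemma coercive_imp_invertible:
  fixes T :: "'a::complex_hilbert \<Rightarrow> 'a"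
  assumes T: "bounded_clinear T" and "c > 0" and co: "\<And>x. c * (norm x)\<^sup>2 \<le> inner (T x) x"
  obtains R where "bounded_clinear R" "\<And>x. R (T x) = x" "\<And>x. T (R x) = x"
proof -
  obtain K where K: "K > 0" "\<And>x. norm (T x) \<le> K * norm x"
    using bounded_clinear_bound[OF T] by blast
  \<comment> \<open>This \<open>e\<close> minimises \<open>1 - 2 * e * c + e^2 * K^2\<close>,
    leaving \<open>1 - c^2 / K^2\<close>. The \<open>max 0\<close> covers the zero space, where
    \<open>c > K\<close> is possible.\<close>
  define e q where "e = c / K\<^sup>2" and "q = sqrt (max 0 (1 - c\<^sup>2 / K\<^sup>2))"
  have q: "0 \<le> q" "q < 1" using \<open>c > 0\<close> \<open>K > 0\<close> by (auto simp: q_def)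
  have e: "e > 0" using \<open>c > 0\<close> \<open>K > 0\<close> by (simp add: e_def)
  \<comment> \<open>For small \<open>e\<close> the map \<open>x \<mapsto> x - e (T x - b)\<close> is a contraction; its fixed point solves \<open>T x = b\<close>.\<close>
  have contr: "norm (d - e *\<^sub>R T d) \<le> q * norm d" for d
  proof -
    have "(norm (d - e *\<^sub>R T d))\<^sup>2 = (norm d)\<^sup>2 - 2 * (e * inner (T d) d) + e\<^sup>2 * (norm (T d))\<^sup>2"
      unfolding power2_norm_eq_inner power2_eq_square[of e]
      by (simp add: inner_diff_left inner_diff_right inner_commute[of d "T d"] right_diff_distrib)
    also have "\<dots> \<le> (norm d)\<^sup>2 - 2 * (e * (c * (norm d)\<^sup>2)) + e\<^sup>2 * (K * norm d)\<^sup>2"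
    proof -
      have "e * (c * (norm d)\<^sup>2) \<le> e * inner (T d) d"
        by (rule mult_left_mono[OF co]) (use e in simp)
      moreover have "e\<^sup>2 * (norm (T d))\<^sup>2 \<le> e\<^sup>2 * (K * norm d)\<^sup>2"
        by (rule mult_left_mono[OF power_mono[OF K(2)]]) simp_all
      ultimately show ?thesis by linarith
    qed
    also have "\<dots> = (1 - 2 * (e * c) + e\<^sup>2 * K\<^sup>2) * (norm d)\<^sup>2"
      by (simp add: power_mult_distrib left_diff_distrib distrib_right mult.assoc)
    also have "1 - 2 * (e * c) + e\<^sup>2 * K\<^sup>2 = 1 - c\<^sup>2 / K\<^sup>2"
    proof -
      have "e * c = c\<^sup>2 / K\<^sup>2" "e\<^sup>2 * K\<^sup>2 = c\<^sup>2 / K\<^sup>2"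
        using K(1) by (simp_all add: e_def power2_eq_square)
      then show ?thesis by linarith
    qed
    also have "(1 - c\<^sup>2 / K\<^sup>2) * (norm d)\<^sup>2 \<le> (q * norm d)\<^sup>2"
      unfolding power_mult_distrib by (rule mult_right_mono) (simp_all add: q_def)
    finally show ?thesis
      by (rule power2_le_imp_le) (simp add: q(1))
  qed
  have ex1: "\<exists>!x. T x = b" for b
  proof -
    have "\<exists>!x. x - e *\<^sub>R (T x - b) = x"
    proof (rule banach_fix_type[OF q])
      show "\<forall>x y. dist (x - e *\<^sub>R (T x - b)) (y - e *\<^sub>R (T y - b)) \<le> q * dist x y"
      proof (intro allI)
        fix x y
        have eq: "(x - e *\<^sub>R (T x - b)) - (y - e *\<^sub>R (T y - b)) = (x - y) - e *\<^sub>R T (x - y)"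
          by (simp add: bounded_clinear_diff[OF T] algebra_simps)
        show "dist (x - e *\<^sub>R (T x - b)) (y - e *\<^sub>R (T y - b)) \<le> q * dist x y"
          using contr[of "x - y"] unfolding dist_norm eq .
      qed
    qed
    then show ?thesis using e by simp
  qed
  define R where "R b = (THE x. T x = b)" for b
  have TR: "T (R b) = b" for b unfolding R_def using theI'[OF ex1[of b]] .
  have RT: "R (T x) = x" for x using ex1[of "T x"] TR[of "T x"] by blast
  have "bounded_clinear R"
  proof (rule bounded_clinearI[where K="1/c"])
    show "R (x + y) = R x + R y" for x y by (metis RT TR bounded_clinear_add[OF T])
    show "R (d *\<^sub>C x) = d *\<^sub>C R x" for d x by (metis RT TR bounded_clinear_scaleC[OF T])
    fix x
    have "c * (norm (R x))\<^sup>2 \<le> norm x * norm (R x)"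
      using co[of "R x"] norm_cauchy_schwarz[of x "R x"] by (simp add: TR)
    then have "c * norm (R x) \<le> norm x"
      by (cases "norm (R x) = 0") (auto simp: power2_eq_square)
    then show "norm (R x) \<le> norm x * (1 / c)"
      using \<open>c > 0\<close> by (simp add: field_simps)
  qed
  then show ?thesis using that RT TR by blast
qed

section \<open>Resolvents and the spectrum\<close>

lemma resolvent_eqI:
  assumes "\<And>x. R (z *\<^sub>C x - T x) = x" "\<And>x. z *\<^sub>C R x - T (R x) = x"
  shows "resolvent T z = R"
  unfolding resolvent_def using inv_equality[of R, OF assms] .

lemma
  assumes "z \<notin> cspectrum T"
  shows bounded_clinear_resolvent: "bounded_clinear (resolvent T z)"
    and resolvent_left: "resolvent T z (z *\<^sub>C x - T x) = x"
    and resolvent_right: "z *\<^sub>C resolvent T z x - T (resolvent T z x) = x"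
proof -
  obtain R where R: "bounded_clinear R" "\<And>x. R (z *\<^sub>C x - T x) = x" "\<And>x. z *\<^sub>C R x - T (R x) = x"
    using assms unfolding cspectrum_def by blast
  with resolvent_eqI[of R z T] have "resolvent T z = R" by blast
  with R show "bounded_clinear (resolvent T z)" "resolvent T z (z *\<^sub>C x - T x) = x"
    "z *\<^sub>C resolvent T z x - T (resolvent T z x) = x" by auto
qed

lemma resolvent_identity:
  assumes "z \<notin> cspectrum A" "w \<notin> cspectrum A"
  shows "resolvent A w x - resolvent A z x = (z - w) *\<^sub>C resolvent A w (resolvent A z x)"
proof -
  define v where "v = resolvent A z x"
  have "x = (w *\<^sub>C v - A v) + (z - w) *\<^sub>C v"
    using resolvent_right[OF assms(1), of x] by (simp add: v_def scaleC_diff_left)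
  then have "resolvent A w x = resolvent A w (w *\<^sub>C v - A v) + resolvent A w ((z - w) *\<^sub>C v)"
    using bounded_clinear_add[OF bounded_clinear_resolvent[OF assms(2)]] by metis
  then show ?thesis
    using resolvent_left[OF assms(2), of v] bounded_clinear_scaleC[OF bounded_clinear_resolvent[OF assms(2)]]
    by (simp add: v_def)
qed

text \<open>With R the resolvent at z and S = 1 - (z - w) R one has w - A = S (z - A), and S
  commutes with R. For w this close to z the operator S is coercive with constant 1/2, so R composed
  with the inverse of S is the resolvent at w.\<close>

lemma resolvent_nearby:
  fixes A :: "'a::complex_hilbert \<Rightarrow> 'a"
  assumes A: "bounded_clinear A" and z: "z \<notin> cspectrum A"
    and K: "K > 0" "\<And>x. norm (resolvent A z x) \<le> K * norm x" and w: "2 * K * cmod (w - z) \<le> 1"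
  shows "w \<notin> cspectrum A" "norm (resolvent A w x) \<le> 2 * K * norm x"
proof -
  let ?R = "resolvent A z"
  note R = bounded_clinear_resolvent[OF z]
  note RA = bounded_clinear_add[OF R] bounded_clinear_scaleC[OF R] bounded_clinear_diff[OF R]
  define S where "S x = x - (z - w) *\<^sub>C ?R x" for x
  have S: "bounded_clinear S"
    unfolding S_def by (intro bounded_clinear_minus bounded_clinear_ident bounded_clinear_scale R)
  have "(1/2) * (norm x)\<^sup>2 \<le> inner (S x) x" for x
  proof -
    have "norm ((z - w) *\<^sub>C ?R x) \<le> cmod (w - z) * (K * norm x)"
      by (simp add: norm_scaleC norm_minus_commute K mult_left_mono)
    also have "\<dots> \<le> (1/2) * norm x"
      using mult_right_mono[OF w, of "norm x"] by (simp add: algebra_simps)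
    finally have "norm ((z - w) *\<^sub>C ?R x) * norm x \<le> (1/2) * norm x * norm x"
      by (intro mult_right_mono) auto
    then have "inner ((z - w) *\<^sub>C ?R x) x \<le> (1/2) * norm x * norm x"
      using norm_cauchy_schwarz[of "(z - w) *\<^sub>C ?R x" x] by linarith
    then show ?thesis
      by (simp add: S_def inner_diff_left power2_norm_eq_inner[symmetric] power2_eq_square)
  qed
  then obtain S' where S': "bounded_clinear S'" "\<And>x. S' (S x) = x" "\<And>x. S (S' x) = x"
    using coercive_imp_invertible[OF S, of "1/2"] by auto
  have SR: "S (?R x) = ?R (S x)" for x by (simp add: S_def RA)
  have S'R: "S' (?R x) = ?R (S' x)" for x by (metis S'(2,3) SR)
  have 1: "w *\<^sub>C ?R x - A (?R x) = S x" for x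
    using resolvent_right[OF z, of x] by (simp add: S_def scaleC_diff_left algebra_simps)
  have 2: "?R (w *\<^sub>C x - A x) = S x" for x
  proof -
    have "?R (w *\<^sub>C x - A x) = ?R ((z *\<^sub>C x - A x) - (z - w) *\<^sub>C x)"
      by (simp add: scaleC_diff_left)
    also have "\<dots> = S x" by (subst RA(3)) (simp add: S_def RA(2) resolvent_left[OF z])
    finally show ?thesis .
  qed
  have "bounded_clinear (\<lambda>x. ?R (S' x))" "\<And>x. ?R (S' (w *\<^sub>C x - A x)) = x"
    "\<And>x. w *\<^sub>C ?R (S' x) - A (?R (S' x)) = x"
    using bounded_clinear_compose[OF R S'(1)] by (simp_all add: 1 S' S'R[symmetric]) (simp_all add: 1 2 S' S'R)
  then show wn: "w \<notin> cspectrum A" unfolding cspectrum_def by blast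
  have "norm (resolvent A w x) \<le> norm (?R x) + norm ((z - w) *\<^sub>C ?R (resolvent A w x))" 
  proof -
    have "resolvent A w x = ?R x - (w - z) *\<^sub>C ?R (resolvent A w x)"
      using resolvent_identity[OF wn z, of x] by (simp add: algebra_simps)
    then show ?thesis 
      by (metis norm_minus_commute norm_scaleC norm_triangle_ineq4)
  qed
  also have "\<dots> \<le> K * norm x + cmod (w - z) * (K * norm (resolvent A w x))"
    by (intro add_mono K) (simp add: norm_scaleC norm_minus_commute K mult_left_mono)
  also have "\<dots> \<le> K * norm x + (1/2) * norm (resolvent A w x)"
    using mult_right_mono[OF w, of "norm (resolvent A w x)"] by (simp add: algebra_simps)
  finally show "norm (resolvent A w x) \<le> 2 * K * norm x" by simp
qed

lemma closed_cspectrum: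
  fixes A :: "'a::complex_hilbert \<Rightarrow> 'a"
  assumes A: "bounded_clinear A" shows "closed (cspectrum A)"
proof -
  have "\<exists>e>0. \<forall>w. dist w z < e \<longrightarrow> w \<in> - cspectrum A" if z: "z \<in> - cspectrum A" for z
  proof -
    have z: "z \<notin> cspectrum A" using z by simp
    obtain K where K: "K > 0" "\<And>x. norm (resolvent A z x) \<le> K * norm x"
      using bounded_clinear_bound[OF bounded_clinear_resolvent[OF z]] by blast
    have "w \<notin> cspectrum A" if "dist w z < 1 / (2*K)" for w
    proof (rule resolvent_nearby[OF A z K])
      show "2 * K * cmod (w - z) \<le> 1" using that K(1) by (simp add: dist_norm field_simps)
    qed
    then show ?thesis using K(1) by (intro exI[of _ "1/(2*K)"]) auto
  qed
  then show ?thesis unfolding closed_def open_dist by blast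
qed

lemma resolvent_bounded_on_compact:
  fixes A :: "'a::complex_hilbert \<Rightarrow> 'a"
  assumes A: "bounded_clinear A" and S: "compact S" "S \<inter> cspectrum A = {}"
  obtains B where "B > 0" "\<And>z x. z \<in> S \<Longrightarrow> norm (resolvent A z x) \<le> B * norm x"
proof -
  have "\<exists>K>0. \<forall>x. norm (resolvent A z x) \<le> K * norm x" if "z \<in> S" for z
    using that S bounded_clinear_bound[OF bounded_clinear_resolvent[of z A]] by blast
  then obtain K where K: "\<And>z. z \<in> S \<Longrightarrow> K z > 0" "\<And>z x. z \<in> S \<Longrightarrow> norm (resolvent A z x) \<le> K z * norm x"
    by metis
  have "S \<subseteq> (\<Union>z\<in>S. ball z (1 / (2 * K z)))" using K(1) by force
  then obtain C where C: "C \<subseteq> S" "finite C" "S \<subseteq> (\<Union>z\<in>C. ball z (1 / (2 * K z)))"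
    using compactE_image[OF S(1), of S "\<lambda>z. ball z (1 / (2 * K z))"] by auto
  \<comment> \<open>The sum of the local bounds dominates each of them and, unlike a maximum, makes
    sense for an empty cover; the 1 makes it positive.\<close>
  define B where "B = 1 + (\<Sum>z\<in>C. 2 * K z)"
  have pos: "0 \<le> (\<Sum>z\<in>C. 2 * K z)" using C K(1) by (intro sum_nonneg) (auto simp: less_imp_le subset_iff)
  show ?thesis
  proof (rule that[of B])
    show "B > 0" using pos by (simp add: B_def)
    fix w x assume "w \<in> S"
    then obtain z where z: "z \<in> C" "dist z w < 1 / (2 * K z)" using C by auto
    then have zS: "z \<in> S" using C by auto
    have "norm (resolvent A w x) \<le> 2 * K z * norm x"
    proof (rule resolvent_nearby(2)[OF A _ K(1)[OF zS] K(2)[OF zS]])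
      show "z \<notin> cspectrum A" using zS S by blast
      show "2 * K z * cmod (w - z) \<le> 1" 
        using z(2) K(1)[OF zS] by (simp add: dist_norm field_simps norm_minus_commute)
    qed
    also have "\<dots> \<le> B * norm x"
      using member_le_sum[of z C "\<lambda>z. 2 * K z"] z(1) C K(1) 
      by (intro mult_right_mono) (auto simp: B_def less_imp_le subset_iff)
    finally show "norm (resolvent A w x) \<le> B * norm x" .
  qed
qed

lemma resolvent_lipschitz:
  assumes "z \<notin> cspectrum A" "w \<notin> cspectrum A" "B \<ge> 0"
    and "\<And>x. norm (resolvent A z x) \<le> B * norm x" "\<And>x. norm (resolvent A w x) \<le> B * norm x"
  shows "norm (resolvent A w x - resolvent A z x) \<le> B\<^sup>2 * cmod (w - z) * norm x"
proof -
  have "norm (resolvent A w (resolvent A z x)) \<le> B * (B * norm x)"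
    using assms by (meson mult_left_mono order_trans)
  then have "cmod (w - z) * norm (resolvent A w (resolvent A z x)) \<le> cmod (w - z) * (B * (B * norm x))"
    by (rule mult_left_mono) simp
  then show ?thesis
    unfolding resolvent_identity[OF assms(1,2)] norm_scaleC
    by (simp add: norm_minus_commute power2_eq_square mult_ac)
qed

text \<open>By the resolvent identity the difference quotient equals the negated form of the
  resolvent at w applied to the resolvent at z, so only continuity of the resolvent in w remains to
  be used.\<close>

lemma has_field_derivative_cinner_resolvent:
  fixes A :: "'a::complex_hilbert \<Rightarrow> 'a"
  assumes A: "bounded_clinear A" and z: "z \<notin> cspectrum A"
  shows "((\<lambda>w. cinner (resolvent A w x) y) has_field_derivative
           - cinner (resolvent A z (resolvent A z x)) y) (at z)"
proof -
  obtain K where K: "K > 0" "\<And>x. norm (resolvent A z x) \<le> K * norm x"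
    using bounded_clinear_bound[OF bounded_clinear_resolvent[OF z]] by blast
  let ?v = "resolvent A z x"
  have near: "w \<notin> cspectrum A" "\<And>u. norm (resolvent A w u) \<le> 2 * K * norm u" 
    if "dist w z < 1/(2*K)" for w
  proof -
    have "2 * K * cmod (w - z) \<le> 1" using that K(1) by (simp add: dist_norm field_simps)
    from resolvent_nearby[OF A z K this] show "w \<notin> cspectrum A" "\<And>u. norm (resolvent A w u) \<le> 2 * K * norm u" 
      by auto
  qed
  have ev: "eventually (\<lambda>w. dist w z < 1/(2*K)) (at z)"
    unfolding eventually_at using K(1) by (intro exI[of _ "1/(2*K)"]) auto
  have lim: "((\<lambda>w. cinner (resolvent A w ?v) y) \<longlongrightarrow> cinner (resolvent A z ?v) y) (at z)"
  proof (rule LIM_zero_cancel, rule Lim_null_comparison)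
    show "((\<lambda>w. (2*K)\<^sup>2 * cmod (w - z) * norm ?v * norm y) \<longlongrightarrow> 0) (at z)"
      by (auto intro!: tendsto_eq_intros)
    show "\<forall>\<^sub>F w in at z. cmod (cinner (resolvent A w ?v) y - cinner (resolvent A z ?v) y)
            \<le> (2*K)\<^sup>2 * cmod (w - z) * norm ?v * norm y"
      using ev
    proof eventually_elim
      case (elim w)
      have "cmod (cinner (resolvent A w ?v - resolvent A z ?v) y) \<le> norm (resolvent A w ?v - resolvent A z ?v) * norm y"
        by (rule norm_cinner_le)
      also have "\<dots> \<le> (2*K)\<^sup>2 * cmod (w - z) * norm ?v * norm y"
      proof (intro mult_right_mono resolvent_lipschitz[OF z near(1)[OF elim]])
        fix u show "norm (resolvent A z u) \<le> 2 * K * norm u"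
          using K(2)[of u] K(1) by (smt (verit) mult_right_mono norm_ge_zero)
      qed (use near[OF elim] K(1) in auto)
      finally show ?case by (simp add: cinner_diff_left)
    qed
  qed
  show ?thesis
    unfolding has_field_derivative_iff
  proof (rule Lim_transform_eventually)
    show "((\<lambda>w. - cinner (resolvent A w ?v) y) \<longlongrightarrow> - cinner (resolvent A z ?v) y) (at z)"
      using lim by (rule tendsto_minus)
    have "eventually (\<lambda>w. w \<noteq> z) (at z)" by (simp add: eventually_at_filter)
    with ev show "\<forall>\<^sub>F w in at z. - cinner (resolvent A w ?v) y =
            (cinner (resolvent A w x) y - cinner (resolvent A z x) y) / (w - z)"
    proof eventually_elim
      case (elim w)
      have "cinner (resolvent A w x) y - cinner (resolvent A z x) y = (z - w) * cinner (resolvent A w ?v) y"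
        by (metis cinner_diff_left cinner_scaleC_left resolvent_identity[OF z near(1)[OF elim(1)]])
      then show ?case using elim(2) by (simp add: field_simps)
    qed
  qed
qed

lemma holomorphic_on_cinner_resolvent:
  fixes A :: "'a::complex_hilbert \<Rightarrow> 'a"
  assumes "bounded_clinear A"
  shows "(\<lambda>w. cinner (resolvent A w x) y) holomorphic_on (- cspectrum A)"
  using has_field_derivative_cinner_resolvent[OF assms]
  by (meson ComplD field_differentiable_at_within field_differentiable_def holomorphic_onI)

lemma norm_resolvent_le:
  assumes "z \<notin> cspectrum A" "\<And>x. norm (A x) \<le> K * norm x" "cmod z > K"
  shows "norm (resolvent A z x) \<le> norm x / (cmod z - K)"
proof -
  have "cmod z * norm (resolvent A z x) - K * norm (resolvent A z x) \<le> norm x"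
    using norm_triangle_ineq2[of "z *\<^sub>C resolvent A z x" "A (resolvent A z x)"] 
      assms(2)[of "resolvent A z x"]
    unfolding resolvent_right[OF assms(1)] norm_scaleC by linarith
  then show ?thesis using assms(3) by (simp add: field_simps)
qed

text \<open>The representing vector is a multiple of the point of least norm on the hyperplane where
  \<phi> is 1; completeness provides that point.\<close>

lemma riesz_representation_real:
  fixes \<phi> :: "'a::{real_inner,complete_space} \<Rightarrow> real"
  assumes \<phi>: "bounded_linear \<phi>"
  obtains y where "\<And>x. \<phi> x = inner x y"
proof (cases "\<exists>u. \<phi> u \<noteq> 0")
  case False
  then show ?thesis using that[of 0] by simp
next
  case True
  interpret \<phi>: bounded_linear \<phi> by (rule \<phi>)
  obtain u where "\<phi> u \<noteq> 0" using True by blast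
  define d where "d = Inf (norm ` {x. \<phi> x = 1})"
  have ne: "{x. \<phi> x = 1} \<noteq> {}" using \<open>\<phi> u \<noteq> 0\<close> by (auto intro!: exI[of _ "u /\<^sub>R \<phi> u"] simp: \<phi>.scaleR)
  have bd: "bdd_below (norm ` {x. \<phi> x = 1})" by (auto intro: bdd_belowI[of _ 0])
  have d_le: "d \<le> norm x" if "\<phi> x = 1" for x
    unfolding d_def using that bd by (intro cINF_lower) auto
  have d0: "d \<ge> 0" unfolding d_def using ne by (intro cINF_greatest) auto
  have "\<exists>x. \<phi> x = 1 \<and> norm x < d + 1 / real (Suc k)" for k
    using cINF_less_iff[OF ne bd, of "d + 1 / real (Suc k)"] by (auto simp: d_def)
  then obtain x where x: "\<And>k. \<phi> (x k) = 1" "\<And>k. norm (x k) < d + 1 / real (Suc k)" by metis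
  \<comment> \<open>Parallelogram law: the midpoint stays on the hyperplane, so its norm is at least
    \<open>d\<close>.\<close>
  have par: "(norm (x m - x n))\<^sup>2 \<le> 2 * (norm (x m))\<^sup>2 + 2 * (norm (x n))\<^sup>2 - 4 * d\<^sup>2" for m n
  proof -
    have "\<phi> ((x m + x n) /\<^sub>R 2) = 1" by (simp add: \<phi>.scaleR \<phi>.add x)
    then have "d\<^sup>2 \<le> (norm ((x m + x n) /\<^sub>R 2))\<^sup>2" by (rule power_mono[OF d_le d0])
    moreover have "(norm ((x m + x n) /\<^sub>R 2))\<^sup>2 = (norm (x m + x n))\<^sup>2 / 4"
      unfolding norm_scaleR power_mult_distrib by (simp add: power2_eq_square)
    moreover have "(norm (x m + x n))\<^sup>2 + (norm (x m - x n))\<^sup>2 = 2 * (norm (x m))\<^sup>2 + 2 * (norm (x n))\<^sup>2"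
      unfolding power2_norm_eq_inner
      by (simp add: inner_add_left inner_add_right inner_diff_left inner_diff_right)
    ultimately show ?thesis by linarith
  qed
  have "Cauchy x"
    unfolding Cauchy_def
  proof (intro allI impI)
    fix e :: real assume "e > 0"
    have "(\<lambda>k. 4 * ((d + 1 / real (Suc k))\<^sup>2 - d\<^sup>2)) \<longlonglongrightarrow> 4 * ((d + 0)\<^sup>2 - d\<^sup>2)"
      by (intro tendsto_intros LIMSEQ_Suc[OF lim_1_over_n])
    then have "\<forall>\<^sub>F k in sequentially. 4 * ((d + 1 / real (Suc k))\<^sup>2 - d\<^sup>2) < e\<^sup>2"
      by (rule order_tendstoD) (use \<open>e > 0\<close> in simp)
    then obtain M where M: "4 * ((d + 1 / real (Suc M))\<^sup>2 - d\<^sup>2) < e\<^sup>2"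
      by (auto simp: eventually_sequentially)
    have *: "(norm (x m))\<^sup>2 \<le> (d + 1 / real (Suc M))\<^sup>2" if "m \<ge> M" for m
    proof (rule power_mono)
      have "1 / real (Suc m) \<le> 1 / real (Suc M)" using that by (simp add: field_simps)
      then show "norm (x m) \<le> d + 1 / real (Suc M)" using x(2)[of m] by linarith
    qed simp
    have "dist (x m) (x n) < e" if "m \<ge> M" "n \<ge> M" for m n
    proof -
      have "(norm (x m - x n))\<^sup>2 < e\<^sup>2"
        using par[of m n] *[OF that(1)] *[OF that(2)] M by simp
      then show ?thesis using \<open>e > 0\<close> unfolding dist_norm by (metis less_imp_le power2_less_imp_less)
    qed
    then show "\<exists>M. \<forall>m\<ge>M. \<forall>n\<ge>M. dist (x m) (x n) < e" by blast
  qed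
  then obtain p where p: "x \<longlonglongrightarrow> p" using Cauchy_convergent convergent_def by blast
  have "(\<lambda>k. \<phi> (x k)) \<longlonglongrightarrow> \<phi> p" using p by (rule \<phi>.tendsto)
  then have p1: "\<phi> p = 1" by (simp add: x(1) LIMSEQ_const_iff)
  have "norm p \<le> d"
  proof (rule LIMSEQ_le[OF tendsto_norm[OF p]])
    show "(\<lambda>k. d + 1 / real (Suc k)) \<longlonglongrightarrow> d"
      using tendsto_add[OF tendsto_const[of d] LIMSEQ_Suc[OF lim_1_over_n]] by simp
  qed (use x(2) less_imp_le in blast)
  have orth: "inner u p = 0" if "\<phi> u = 0" for u
  proof (cases "u = 0")
    case False
    \<comment> \<open>This \<open>t\<close> minimises the norm of \<open>p - t *\<^sub>R u\<close>.
      That vector stays on the hyperplane, so a nonzero \<open>inner u p\<close> would contradict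
      the minimality of \<open>p\<close>.\<close>
    define t where "t = inner u p / inner u u"
    have "\<phi> (p - t *\<^sub>R u) = 1" using that p1 by (simp add: \<phi>.diff \<phi>.scaleR)
    then have "(norm p)\<^sup>2 \<le> (norm (p - t *\<^sub>R u))\<^sup>2"
      using \<open>norm p \<le> d\<close> d_le[of "p - t *\<^sub>R u"] by (intro power_mono) auto
    also have "\<dots> = (norm p)\<^sup>2 - (inner u p)\<^sup>2 / inner u u"
    proof -
      have "(norm (p - t *\<^sub>R u))\<^sup>2 = (norm p)\<^sup>2 - 2 * (t * inner u p) + t * t * inner u u"
        unfolding power2_norm_eq_inner
        by (simp add: inner_diff_left inner_diff_right inner_commute[of p u] right_diff_distrib)
      also have "t * t * inner u u = t * inner u p" using False by (simp add: t_def)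
      finally show ?thesis by (simp add: t_def power2_eq_square)
    qed
    finally have "(inner u p)\<^sup>2 / inner u u \<le> 0" by simp
    moreover have "0 < inner u u" using False by simp
    ultimately have "(inner u p)\<^sup>2 \<le> 0" by (simp add: divide_le_0_iff)
    then show ?thesis by simp
  qed simp
  have "p \<noteq> 0" using p1 by auto
  show ?thesis
  proof (rule that[of "p /\<^sub>R inner p p"])
    fix v
    have "inner (v - \<phi> v *\<^sub>R p) p = 0" by (rule orth) (simp add: \<phi>.diff \<phi>.scaleR p1)
    then show "\<phi> v = inner v (p /\<^sub>R inner p p)"
      using \<open>p \<noteq> 0\<close> by (simp add: inner_diff_left field_simps)
  qed
qed

lemma cinner_eqI_inner:
  fixes u v x y :: "'a::complex_inner"
  assumes "\<And>c. inner (c *\<^sub>C u) v = inner (c *\<^sub>C x) y"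
  shows "cinner u v = cinner x y"
proof (rule complex_eqI)
  show "Re (cinner u v) = Re (cinner x y)" using assms[of 1] by (simp add: Re_cinner)
  have im: "Im (cinner u v) = - inner (\<i> *\<^sub>C u) v" for u v :: 'a
    by (simp add: Re_cinner[symmetric] cinner_scaleC_left)
  from im[of u v] im[of x y] show "Im (cinner u v) = Im (cinner x y)" using assms[of \<i>] by simp
qed

text \<open>Since \<open>cadjoint\<close> is a \<open>THE\<close>, existence and uniqueness are both
  due. Existence is Riesz applied to the real form, upgraded to the complex form by testing with
  multiples by the imaginary unit; uniqueness is nondegeneracy.\<close>

lemma cinner_cadjoint:
  fixes A :: "'a::complex_hilbert \<Rightarrow> 'a"
  assumes A: "bounded_clinear A"
  shows "cinner (A x) y = cinner x (cadjoint A y)"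
proof -
  have "\<exists>w. \<forall>x. inner (A x) y = inner x w" for y
    using riesz_representation_real[OF bounded_linear_compose[OF bounded_linear_inner_left[of y] bounded_clinear_linear[OF A]]]
    by metis
  then obtain S where S: "\<And>x y. inner (A x) y = inner x (S y)" by metis
  have S': "cinner (A x) y = cinner x (S y)" for x y
    by (rule cinner_eqI_inner) (metis S bounded_clinear_scaleC[OF A])
  have "cadjoint A = S"
    unfolding cadjoint_def
  proof (rule the_equality)
    fix T assume "\<forall>x y. cinner (A x) y = cinner x (T y)"
    then have "cinner x (T y) = cinner x (S y)" for x y using S' by metis
    then have "cinner (T y) x = cinner (S y) x" for x y by (metis cinner_commute)
    then show "T = S" using cinner_ext by blast
  qed (use S' in blast)
  then show ?thesis using S' by simp
qed

lemma cinner_cadjoint_left: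
  fixes A :: "'a::complex_hilbert \<Rightarrow> 'a"
  assumes A: "bounded_clinear A"
  shows "cinner (cadjoint A x) y = cinner x (A y)"
  by (metis cinner_cadjoint[OF A] cinner_commute)

lemma bounded_clinear_cadjoint:
  fixes A :: "'a::complex_hilbert \<Rightarrow> 'a"
  assumes A: "bounded_clinear A"
  shows "bounded_clinear (cadjoint A)"
proof -
  obtain K where K: "K > 0" "\<And>x. norm (A x) \<le> K * norm x"
    using bounded_clinear_bound[OF A] by blast
  show ?thesis
  proof (rule bounded_clinearI[where K=K])
    show "cadjoint A (x + y) = cadjoint A x + cadjoint A y" for x y
      by (rule cinner_ext) (simp add: cinner_add_left cinner_cadjoint_left[OF A])
    show "cadjoint A (c *\<^sub>C x) = c *\<^sub>C cadjoint A x" for c x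
      by (rule cinner_ext) (simp add: cinner_scaleC_left cinner_cadjoint_left[OF A])
    fix x
    let ?y = "cadjoint A x"
    have "(norm ?y)\<^sup>2 = cmod (cinner (A ?y) x)"
      by (simp add: cinner_cadjoint[OF A] cinner_self norm_power)
    also have "\<dots> \<le> (K * norm ?y) * norm x"
      using norm_cinner_le[of "A ?y" x] K(2)[of ?y] by (smt (verit) mult_right_mono norm_ge_zero)
    finally show "norm ?y \<le> norm x * K"
      by (cases "norm ?y = 0") (auto simp: power2_eq_square mult_ac K(1) less_imp_le)
  qed
qed

text \<open>This exhibits the second summand of \<open>mu_op\<close> as the adjoint of the first,
  which is what makes \<open>mu_op\<close> selfadjoint.\<close>

lemma resolvent_cadjoint:
  fixes A :: "'a::complex_hilbert \<Rightarrow> 'a"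
  assumes A: "bounded_clinear A" and z: "z \<notin> cspectrum A"
  shows "resolvent (cadjoint A) (cnj z) = cadjoint (resolvent A z)"
proof (rule resolvent_eqI)
  note R = bounded_clinear_resolvent[OF z]
  have diff: "cinner (cnj z *\<^sub>C x - cadjoint A x) y = cinner x (z *\<^sub>C y - A y)" for x y
    by (simp add: cinner_diff_left cinner_diff_right cinner_scaleC_left cinner_scaleC_right cinner_cadjoint_left[OF A])
  fix x
  show "cadjoint (resolvent A z) (cnj z *\<^sub>C x - cadjoint A x) = x"
    by (rule cinner_ext) (simp add: cinner_cadjoint_left[OF R] diff resolvent_right[OF z])
  show "cnj z *\<^sub>C cadjoint (resolvent A z) x - cadjoint A (cadjoint (resolvent A z) x) = x"
    by (rule cinner_ext) (simp add: cinner_cadjoint_left[OF R] diff resolvent_left[OF z])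
qed

section \<open>Numerical range and bottom of the spectrum of a selfadjoint operator\<close>

lemma
  fixes T :: "'a::complex_inner \<Rightarrow> 'a"
  assumes T: "bounded_clinear T"
  shows bdd_below_numerical_range: "bdd_below ((\<lambda>x. inner (T x) x) ` {x. norm x = 1})"
    and INF_numerical_range_le: "(INF x\<in>{x. norm x = 1}. inner (T x) x) * (norm v)\<^sup>2 \<le> inner (T v) v"
proof -
  obtain K where K: "K > 0" "\<And>x. norm (T x) \<le> K * norm x"
    using bounded_clinear_bound[OF T] by blast
  show bd: "bdd_below ((\<lambda>x. inner (T x) x) ` {x. norm x = 1})"
  proof (rule bdd_belowI2)
    fix x :: 'a assume "x \<in> {x. norm x = 1}"
    then show "- K \<le> inner (T x) x" using Cauchy_Schwarz_ineq2[of "T x" x] K(2)[of x] by simp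
  qed
  show "(INF x\<in>{x. norm x = 1}. inner (T x) x) * (norm v)\<^sup>2 \<le> inner (T v) v"
  proof (cases "v = 0")
    case False
    have "(INF x\<in>{x. norm x = 1}. inner (T x) x) \<le> inner (T (v /\<^sub>R norm v)) (v /\<^sub>R norm v)"
      using False by (intro cINF_lower[OF bd]) simp
    also have "\<dots> = inner (T v) v / (norm v)\<^sup>2"
      by (subst linear_cmul[OF bounded_linear.linear[OF bounded_clinear_linear[OF T]]])
        (simp add: power2_eq_square divide_inverse)
    finally show ?thesis using False by (simp add: field_simps)
  qed simp
qed

text \<open>The \<open>LEAST\<close> in \<open>min_spectrum\<close> has a value only if the minimum
  is attained, so the infimum m of the form has to lie in the spectrum. Below m the shifted operator
  is coercive. At m, P = T - m is positive, so the square of the norm of P x is at most a multiple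
  of the form of P at x; near-minimisers of the form are then approximate eigenvectors, which a
  bounded inverse forbids. On the zero space the spectrum is empty.\<close>

lemma min_spectrum_selfadjoint:
  fixes T :: "'a::complex_hilbert \<Rightarrow> 'a"
  assumes T: "bounded_clinear T" and sa: "\<And>x y. cinner (T x) y = cinner x (T y)"
    and nt: "\<exists>x::'a. x \<noteq> 0"
  shows "min_spectrum T = (INF x\<in>{x. norm x = 1}. inner (T x) x)"
proof -
  define m where "m = (INF x\<in>{x::'a. norm x = 1}. inner (T x) x)"
  obtain K where K: "K > 0" "\<And>x. norm (T x) \<le> K * norm x"
    using bounded_clinear_bound[OF T] by blast
  obtain u :: 'a where "u \<noteq> 0" using nt by blast
  then have "norm (u /\<^sub>R norm u) = 1" by simp
  then have ne: "{x::'a. norm x = 1} \<noteq> {}" by blast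
  note bd = bdd_below_numerical_range[OF T]
  note m_le = INF_numerical_range_le[OF T, folded m_def]
  have inner_sa: "inner (T x) y = inner x (T y)" for x y by (simp add: Re_cinner[symmetric] sa)
  have shift: "bounded_clinear (\<lambda>x. T x - complex_of_real t *\<^sub>C x)" for t
    by (intro bounded_clinear_minus T bounded_clinear_scale bounded_clinear_ident)
  have below: "complex_of_real t \<notin> cspectrum T" if "t < m" for t
  proof -
    have "(m - t) * (norm x)\<^sup>2 \<le> inner (T x - complex_of_real t *\<^sub>C x) x" for x
      using m_le[of x] by (simp add: scaleC_complex_of_real inner_diff_left power2_norm_eq_inner algebra_simps)
    note co = this
    have "0 < m - t" using that by simp
    obtain R where R: "bounded_clinear R" "\<And>x. R (T x - complex_of_real t *\<^sub>C x) = x"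
      "\<And>x. T (R x) - complex_of_real t *\<^sub>C R x = x"
      by (rule coercive_imp_invertible[OF shift[of t] \<open>0 < m - t\<close> co]) (rule that; blast)
    \<comment> \<open>Coercivity inverts T - t, whereas \<open>cspectrum\<close> asks for an inverse
      of t - T; hence the sign.\<close>
    have "bounded_clinear (\<lambda>x. (-1) *\<^sub>C R x)" by (rule bounded_clinear_scale[OF R(1)])
    moreover have "(-1) *\<^sub>C R (complex_of_real t *\<^sub>C x - T x) = x" for x
    proof -
      have "R (complex_of_real t *\<^sub>C x - T x) = - R (T x - complex_of_real t *\<^sub>C x)"
        using linear_neg[OF bounded_linear.linear[OF bounded_clinear_linear[OF R(1)]], of "T x - complex_of_real t *\<^sub>C x"]
        by simp
      then show ?thesis by (simp add: R(2) scaleC_minus_left)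
    qed
    moreover have "complex_of_real t *\<^sub>C ((-1) *\<^sub>C R x) - T ((-1) *\<^sub>C R x) = x" for x
      using R(3)[of x]
      by (simp add: scaleC_minus_left scaleC_minus_right linear_neg[OF bounded_linear.linear[OF bounded_clinear_linear[OF T]]])
    ultimately show ?thesis unfolding cspectrum_def by blast
  qed
  have at: "complex_of_real m \<in> cspectrum T"
  proof (rule ccontr)
    assume n: "complex_of_real m \<notin> cspectrum T"
    define P where "P x = T x - complex_of_real m *\<^sub>C x" for x
    have P: "bounded_clinear P" unfolding P_def by (rule shift)
    obtain M where M: "M > 0" "\<And>x. norm (P x) \<le> M * norm x"
      using bounded_clinear_bound[OF P] by blast
    obtain B where B: "B > 0" "\<And>x. norm (resolvent T m x) \<le> B * norm x"
      using bounded_clinear_bound[OF bounded_clinear_resolvent[OF n]] by blast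
    have P0: "0 \<le> inner (P x) x" for x
      using m_le[of x] by (simp add: P_def scaleC_complex_of_real inner_diff_left power2_norm_eq_inner)
    have Psa: "inner (P x) y = inner x (P y)" for x y
      by (simp add: P_def inner_diff_left inner_diff_right inner_sa scaleC_complex_of_real)
    \<comment> \<open>Positivity of \<open>P\<close> at \<open>x - P x / M\<close>.\<close>
    have PP: "(norm (P x))\<^sup>2 \<le> M * inner (P x) x" for x
    proof -
      have lin: "linear P" using P bounded_clinear_linear bounded_linear.linear by blast
      have "0 \<le> inner (P (x - (1/M) *\<^sub>R P x)) (x - (1/M) *\<^sub>R P x)" by (rule P0)
      also have "\<dots> = inner (P x) x - 2 / M * (norm (P x))\<^sup>2 + (1/M)\<^sup>2 * inner (P (P x)) (P x)"
        unfolding power2_norm_eq_inner linear_diff[OF lin] linear_cmul[OF lin]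
        by (simp add: inner_diff_left inner_diff_right Psa[of x "P x"] Psa[of "P x" x] 
            Psa[of "P x" "P x", symmetric] inner_commute[of x "P x"] power2_eq_square)
          (simp add: Psa diff_divide_distrib)
      also have "\<dots> \<le> inner (P x) x - 2 / M * (norm (P x))\<^sup>2 + (1/M)\<^sup>2 * (M * (norm (P x))\<^sup>2)"
      proof (intro add_mono mult_left_mono order_refl)
        have "inner (P (P x)) (P x) \<le> norm (P (P x)) * norm (P x)" by (rule norm_cauchy_schwarz)
        also have "\<dots> \<le> (M * norm (P x)) * norm (P x)" using M(2)[of "P x"] by (intro mult_right_mono) auto
        finally show "inner (P (P x)) (P x) \<le> M * (norm (P x))\<^sup>2" by (simp add: power2_eq_square mult_ac)
      qed simp
      also have "\<dots> = inner (P x) x - (norm (P x))\<^sup>2 / M" using M(1) by (simp add: field_simps power2_eq_square)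
      finally show ?thesis using M(1) by (simp add: field_simps)
    qed
    \<comment> \<open>Chosen so that \<open>B\<^sup>2 * (M * e)\<close> is 1/2, against the lower
      bound 1 that the bounded inverse enforces.\<close>
    define e where "e = 1 / (2 * B\<^sup>2 * M)"
    have "e > 0" using B M by (simp add: e_def)
    then obtain x where x: "norm x = 1" "inner (T x) x < m + e"
      using cINF_less_iff[OF ne bd, of "m + e"] by (auto simp: m_def)
    have "inner (P x) x < e" using x by (simp add: P_def scaleC_complex_of_real inner_diff_left power2_norm_eq_inner[symmetric])
    then have "(norm (P x))\<^sup>2 < M * e" using PP[of x] M(1) by (smt (verit) mult_less_cancel_left_pos)
    have "resolvent T m (complex_of_real m *\<^sub>C x - T x) = x" by (rule resolvent_left[OF n])
    then have "1 \<le> B * norm (P x)"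
      using B(2)[of "complex_of_real m *\<^sub>C x - T x"] x(1) by (simp add: P_def norm_minus_commute)
    then have "1 \<le> B\<^sup>2 * (norm (P x))\<^sup>2" by (metis one_power2 power_mono power_mult_distrib zero_le_one)
    also have "\<dots> < B\<^sup>2 * (M * e)" using \<open>(norm (P x))\<^sup>2 < M * e\<close> B(1) by simp
    also have "\<dots> = 1/2" using B(1) M(1) by (simp add: e_def)
    finally show False by simp
  qed
  have "min_spectrum T = m"
    unfolding min_spectrum_def
  proof (rule Least_equality)
    show "complex_of_real m \<in> cspectrum T" by (rule at)
    show "m \<le> t" if "complex_of_real t \<in> cspectrum T" for t
      using below[of t] that by (cases "t < m") auto
  qed
  then show ?thesis by (simp add: m_def)
qed

text \<open>T + c is positive. Its form at \<theta>x - y, with \<theta> rotating the value at (x, y)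
  onto the nonnegative axis, isolates twice the modulus. The norm of that vector is at most 2, so c
  enters with factor 4, halved at the end. Unlike the usual Cauchy-Schwarz product of square roots,
  the right-hand side is linear in T and can be integrated directly.\<close>

lemma selfadjoint_form_bound:
  fixes T :: "'a::complex_inner \<Rightarrow> 'a"
  assumes T: "bounded_clinear T" and sa: "\<And>x y. cinner (T x) y = cinner x (T y)"
    and c: "c \<ge> 0" "\<And>v. - c * (norm v)\<^sup>2 \<le> inner (T v) v" and xy: "norm x = 1" "norm y = 1"
  shows "cmod (cinner (T x) y) \<le> (inner (T x) x + inner (T y) y) / 2 + 2 * c"
proof -
  obtain \<theta> where \<theta>: "cmod \<theta> = 1" "\<theta> * cinner (T x) y = of_real (cmod (cinner (T x) y))"
    using unit_multiple_norm by blast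
  define w where "w = \<theta> *\<^sub>C x - y"
  have yx: "cinner (T y) x = cnj (cinner (T x) y)" by (metis cinner_commute sa)
  have u: "\<theta> * cnj \<theta> = 1" using \<theta>(1) complex_norm_square[of \<theta>] by simp
  have "cinner (T w) w = (\<theta> * cnj \<theta>) * cinner (T x) x - \<theta> * cinner (T x) y
      - cnj (\<theta> * cinner (T x) y) + cinner (T y) y"
    by (simp add: w_def bounded_clinear_diff[OF T] bounded_clinear_scaleC[OF T] cinner_diff_left cinner_diff_right
        cinner_scaleC_left cinner_scaleC_right yx algebra_simps)
  then have "inner (T w) w = inner (T x) x - 2 * cmod (cinner (T x) y) + inner (T y) y"
    by (simp add: u \<theta>(2) Re_cinner[symmetric])
  moreover have "- c * 4 \<le> inner (T w) w"
  proof -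
    have "norm w \<le> 2" using norm_triangle_ineq4[of "\<theta> *\<^sub>C x" y] \<theta>(1) xy by (simp add: w_def norm_scaleC)
    then have "(norm w)\<^sup>2 \<le> 2\<^sup>2" by (intro power_mono) auto
    then have "c * (norm w)\<^sup>2 \<le> c * 4" using c(1) by (intro mult_left_mono) auto
    then show ?thesis using c(2)[of w] by linarith
  qed
  ultimately have "2 * cmod (cinner (T x) y) \<le> inner (T x) x + inner (T y) y + 4 * c" by linarith
  then show ?thesis by (simp add: field_simps)
qed

text \<open>An infimum of functions inherits a modulus of continuity that they share. This yields
  the continuity behind the measurability of \<open>alpha_minus\<close>.\<close>

lemma INF_le_INF_add:
  fixes f g :: "'b \<Rightarrow> real"
  assumes "S \<noteq> {}" "bdd_below (f ` S)" "\<And>x. x \<in> S \<Longrightarrow> f x \<le> g x + d"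
  shows "(INF x\<in>S. f x) \<le> (INF x\<in>S. g x) + d"
proof -
  have "(INF x\<in>S. f x) - d \<le> (INF x\<in>S. g x)"
    using assms by (intro cINF_greatest) (auto simp: diff_le_eq intro: cINF_lower2)
  then show ?thesis by simp
qed

section \<open>Lipschitz functions are differentiable almost everywhere\<close>

text \<open>F and x - F x are both nondecreasing and their increments add up to interval lengths.
  Consequently the Stieltjes measure of F is dominated by Lebesgue measure and has a
  density.\<close>

lemma interval_measure_plus_eq_lborel:
  fixes F :: "real \<Rightarrow> real"
  assumes mono: "\<And>x y. x \<le> y \<Longrightarrow> F x \<le> F y" and mono': "\<And>x y. x \<le> y \<Longrightarrow> F y - F x \<le> y - x"
    and B: "B \<in> sets borel"
  shows "emeasure lborel B = emeasure (interval_measure F) B + emeasure (interval_measure (\<lambda>x. x - F x)) B"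
proof -
  let ?G = "\<lambda>x. x - F x"
  have contF: "continuous_on UNIV F"
  proof -
    have "dist (F x) (F y) \<le> dist x y" for x y
      using mono[of x y] mono[of y x] mono'[of x y] mono'[of y x]
      by (cases "x \<le> y") (simp_all add: dist_real_def abs_if)
    then have "1-lipschitz_on UNIV F" by (intro lipschitz_onI) auto
    then show ?thesis by (rule lipschitz_on_continuous_on)
  qed
  have contG: "continuous_on UNIV ?G" by (intro continuous_intros contF)
  have monoG: "?G x \<le> ?G y" if "x \<le> y" for x y using mono'[OF that] by simp
  let ?\<mu> = "\<lambda>A. emeasure (interval_measure F) A + emeasure (interval_measure ?G) A"
  define M where "M = measure_of UNIV (sets borel) ?\<mu>"
  have em: "emeasure M A = ?\<mu> A" if "A \<in> sets borel" for A
    unfolding M_def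
  proof (rule emeasure_measure_of_sigma)
    show "sigma_algebra UNIV (sets (borel :: real measure))"
      using sets.sigma_algebra_axioms[of "borel :: real measure"] by simp
    show "positive (sets borel) ?\<mu>" by (simp add: positive_def)
    show "countably_additive (sets borel) ?\<mu>"
    proof (rule countably_additiveI)
      fix A :: "nat \<Rightarrow> real set" 
      assume A: "range A \<subseteq> sets borel" "disjoint_family A" "\<Union> (range A) \<in> sets borel"
      show "(\<Sum>i. ?\<mu> (A i)) = ?\<mu> (\<Union> (range A))"
        using suminf_emeasure[of A "interval_measure F"] suminf_emeasure[of A "interval_measure ?G"] A
        by (subst suminf_add[symmetric]) auto
    qed
  qed (rule that)
  have "lborel = M"
  proof (rule lborel_eqI)
    show "sets M = sets borel" unfolding M_def
      using sets.sigma_sets_eq[of "borel :: real measure"] by simp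
    fix l u :: real assume "\<And>b. b \<in> Basis \<Longrightarrow> l \<bullet> b \<le> u \<bullet> b"
    then have lu: "l \<le> u" by auto
    \<comment> \<open>Lebesgue measure is characterised on open boxes, Stieltjes measures are
      evaluated on closed intervals; continuity of \<open>H\<close> makes the endpoints
      null.\<close>
    have Ico: "emeasure (interval_measure H) {l<..<u} = ennreal (H u - H l)" 
      if H: "continuous_on UNIV H" "\<And>x y. x \<le> y \<Longrightarrow> H x \<le> H y" for H
    proof (cases "l < u")
      case True
      have sing: "emeasure (interval_measure H) {x} = 0" for x
        using emeasure_interval_measure_Icc[of x x H] H by simp
      have "emeasure (interval_measure H) {l..u} = emeasure (interval_measure H) {l<..<u}"
      proof (rule emeasure_eq_AE)
        have "AE x in interval_measure H. x \<noteq> l \<and> x \<noteq> u"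
          using sing by (intro AE_conjI AE_I[where N="{l}"] AE_I[where N="{u}"]) auto
        then show "AE x in interval_measure H. (x \<in> {l..u}) = (x \<in> {l<..<u})" 
          by eventually_elim auto
      qed auto
      then show ?thesis using emeasure_interval_measure_Icc[of l u H] H lu by simp
    qed (use lu in auto)
    have "emeasure M (box l u) = ennreal (F u - F l) + ennreal (?G u - ?G l)"
      by (simp add: em box_real Ico[OF contF mono] Ico[OF contG monoG])
    also have "\<dots> = ennreal (u - l)"
      using mono[OF lu] mono'[OF lu] by (simp flip: ennreal_plus)
    finally show "emeasure M (box l u) = ennreal (prod ((\<bullet>) (u - l)) Basis)" by simp
  qed
  then show ?thesis using em[OF B] by simp
qed

text \<open>Vitali covering. Points of N with \<tau>-mass above e r in arbitrarily small balls of
  radius r are covered, up to a negligible set, by disjoint such balls inside an open set of tiny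
  \<tau>-mass. Each ball has length 2 r, less than 2/e times its mass, so the total length is tiny
  too.\<close>

lemma measure_cball_over_radius_tendsto_0:
  fixes \<tau> :: "real measure"
  assumes \<tau>: "finite_measure \<tau>" "sets \<tau> = sets borel" and N: "N \<in> sets borel" "emeasure \<tau> N = 0"
  shows "negligible {x\<in>N. \<not> ((\<lambda>r. measure \<tau> (cball x r) / r) \<longlongrightarrow> 0) (at_right 0)}"
proof -
  interpret finite_measure \<tau> by (rule \<tau>)
  define S where "S e = {x\<in>N. \<forall>d>0. \<exists>r. 0 < r \<and> r < d \<and> measure \<tau> (cball x r) > e * r}" for e
  have negS: "negligible (S e)" if "e > 0" for e
    unfolding negligible_outer_le
  proof (intro allI impI)
    fix \<eta> :: real assume "\<eta> > 0"
    \<comment> \<open>The loss factor from \<tau>-mass to length is 2/e, so mass \<delta> yields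
      length at most \<eta>.\<close>
    define \<delta> where "\<delta> = \<eta> * e / 2"
    have "\<delta> > 0" using \<open>\<eta> > 0\<close> \<open>e > 0\<close> by (simp add: \<delta>_def)
    have "(INF U\<in>{U. N \<subseteq> U \<and> open U}. emeasure \<tau> U) < ennreal \<delta>"
      using outer_regular[OF \<tau>(2) _ N(1)] N(2) \<open>\<delta> > 0\<close> emeasure_finite by simp
    then obtain U where U: "N \<subseteq> U" "open U" "emeasure \<tau> U < ennreal \<delta>"
      by (auto simp: INF_less_iff)
    have mU: "measure \<tau> U < \<delta>" using U(3) \<open>\<delta> > 0\<close> by (simp add: emeasure_eq_measure ennreal_less_iff)
    define K where "K = {(x, r). x \<in> N \<and> 0 < r \<and> cball x r \<subseteq> U \<and> measure \<tau> (cball x r) > e * r}"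
    obtain C where C: "countable C" "C \<subseteq> K"
      "pairwise (\<lambda>i j. disjnt (cball (fst i) (snd i)) (cball (fst j) (snd j))) C"
      "negligible (S e - (\<Union>i\<in>C. cball (fst i) (snd i)))"
    proof (rule Vitali_covering_theorem_cballs[of K snd "S e" fst])
      fix x d :: real assume x: "x \<in> S e" "0 < d"
      then have "x \<in> U" using U by (auto simp: S_def)
      then obtain d' where d': "d' > 0" "cball x d' \<subseteq> U" using U(2) open_contains_cball by blast
      have xN: "x \<in> N" and all: "\<forall>d>0. \<exists>r. 0 < r \<and> r < d \<and> measure \<tau> (cball x r) > e * r"
        using x(1) by (simp_all add: S_def)
      have "0 < min d d'" using x(2) d'(1) by simp
      then obtain r where r: "0 < r" "r < min d d'" "measure \<tau> (cball x r) > e * r"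
        using all by blast
      have "cball x r \<subseteq> U" using d'(2) r(2)
        using subset_cball[of r d' x] by simp
      with xN r show "\<exists>i. i \<in> K \<and> x \<in> cball (fst i) (snd i) \<and> snd i < d"
        by (intro exI[of _ "(x, r)"]) (simp add: K_def)
    qed (simp_all add: K_def split_beta)
    let ?b = "\<lambda>i. cball (fst i) (snd i)"
    have fin: "(\<Sum>i\<in>D. measure lebesgue (?b i)) \<le> \<eta>" if D: "D \<subseteq> C" "finite D" for D
    proof -
      have "(\<Sum>i\<in>D. measure lebesgue (?b i)) \<le> (\<Sum>i\<in>D. 2 / e * measure \<tau> (?b i))"
      proof (rule sum_mono)
        fix i assume "i \<in> D"
        then have "0 < snd i" "measure \<tau> (?b i) > e * snd i" using D C(2) by (auto simp: K_def)
        then show "measure lebesgue (?b i) \<le> 2 / e * measure \<tau> (?b i)"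
          using \<open>e > 0\<close> by (simp add: cball_eq_atLeastAtMost field_simps)
      qed
      also have "\<dots> = 2 / e * measure \<tau> (\<Union>i\<in>D. ?b i)"
        unfolding sum_distrib_left[symmetric]
      proof (subst measure_finite_Union[OF D(2)])
        show "disjoint_family_on ?b D"
          using C(3) D(1) unfolding disjoint_family_on_def pairwise_def disjnt_def by blast
      qed (auto simp: \<tau> emeasure_eq_measure)
      also have "\<dots> \<le> 2 / e * \<delta>"
      proof (intro mult_left_mono)
        have "?b i \<subseteq> U" if "i \<in> D" for i
        proof -
          have "i \<in> K" using that D(1) C(2) by blast
          then show ?thesis by (simp add: K_def split_beta)
        qed
        then have "(\<Union>i\<in>D. ?b i) \<subseteq> U" by (rule UN_least)
        then have "measure \<tau> (\<Union>i\<in>D. ?b i) \<le> measure \<tau> U"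
          by (rule finite_measure_mono) (simp add: U(2) \<tau>(2))
        then show "measure \<tau> (\<Union>i\<in>D. ?b i) \<le> \<delta>" using mU by simp
      qed (use \<open>e > 0\<close> in auto)
      finally show ?thesis using \<open>e > 0\<close> by (simp add: \<delta>_def)
    qed
    have un: "(\<Union>i\<in>C. ?b i) \<in> lmeasurable" "measure lebesgue (\<Union>i\<in>C. ?b i) \<le> \<eta>"
      using fmeasurable_UN_bound[OF C(1), of ?b lebesgue \<eta>] measure_UN_bound[OF C(1), of ?b lebesgue \<eta>]
        order_trans[OF measure_UNION_le fin] by auto
    show "\<exists>T. S e \<subseteq> T \<and> T \<in> lmeasurable \<and> measure lebesgue T \<le> \<eta>"
    proof (intro exI conjI)
      let ?T = "(S e - (\<Union>i\<in>C. ?b i)) \<union> (\<Union>i\<in>C. ?b i)"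
      show "S e \<subseteq> ?T" by blast
      show "?T \<in> lmeasurable" by (rule fmeasurable.Un[OF negligible_imp_measurable[OF C(4)] un(1)])
      show "measure lebesgue ?T \<le> \<eta>"
      proof -
        have "measure lebesgue ?T \<le> measure lebesgue (S e - (\<Union>i\<in>C. ?b i)) + measure lebesgue (\<Union>i\<in>C. ?b i)"
          by (rule measure_Un_le[OF negligible_imp_sets[OF C(4)] fmeasurableD[OF un(1)]])
        then show ?thesis using un(2) negligible_imp_measure0[OF C(4)] by linarith
      qed
    qed
  qed
  have "{x\<in>N. \<not> ((\<lambda>r. measure \<tau> (cball x r) / r) \<longlongrightarrow> 0) (at_right 0)} \<subseteq> (\<Union>n. S (1 / real (Suc n)))"
  proof
    fix x assume x: "x \<in> {x\<in>N. \<not> ((\<lambda>r. measure \<tau> (cball x r) / r) \<longlongrightarrow> 0) (at_right 0)}"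
    show "x \<in> (\<Union>n. S (1 / real (Suc n)))"
    proof (rule ccontr)
      assume "x \<notin> (\<Union>n. S (1 / real (Suc n)))"
      then have *: "\<exists>d>0. \<forall>r. 0 < r \<and> r < d \<longrightarrow> measure \<tau> (cball x r) \<le> 1 / real (Suc n) * r" for n
      proof -
        have "x \<notin> S (1 / real (Suc n))" using \<open>x \<notin> (\<Union>n. S (1 / real (Suc n)))\<close> by blast
        moreover have "x \<in> N" using x by simp
        ultimately have "\<not> (\<forall>d>0. \<exists>r. 0 < r \<and> r < d \<and> measure \<tau> (cball x r) > 1 / real (Suc n) * r)"
          unfolding S_def mem_Collect_eq by simp
        then obtain d where d: "d > 0" "\<not> (\<exists>r. 0 < r \<and> r < d \<and> measure \<tau> (cball x r) > 1 / real (Suc n) * r)"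
          by blast
        show ?thesis
        proof (intro exI[of _ d] conjI d(1) allI impI)
          fix r assume "0 < r \<and> r < d"
          with d(2) show "measure \<tau> (cball x r) \<le> 1 / real (Suc n) * r" by (meson not_less)
        qed
      qed
      have "((\<lambda>r. measure \<tau> (cball x r) / r) \<longlongrightarrow> 0) (at_right 0)"
        unfolding tendsto_iff
      proof (intro allI impI)
        fix e :: real assume "e > 0"
        then obtain n where n: "1 / real (Suc n) < e" using nat_approx_posE by metis
        obtain d where d: "d > 0" "\<And>r. 0 < r \<Longrightarrow> r < d \<Longrightarrow> measure \<tau> (cball x r) \<le> 1 / real (Suc n) * r"
          using *[of n] by blast
        show "\<forall>\<^sub>F r in at_right 0. dist (measure \<tau> (cball x r) / r) 0 < e"
          unfolding eventually_at_right_field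
        proof (intro exI[of _ d] conjI d(1) allI impI)
          fix r assume r: "0 < r" "r < d"
          have "measure \<tau> (cball x r) / r \<le> 1 / real (Suc n)" using d(2)[OF r] r by (simp add: field_simps)
          then show "dist (measure \<tau> (cball x r) / r) 0 < e" using n r by simp
        qed
      qed
      then show False using x by simp
    qed
  qed
  moreover have "negligible (\<Union>n. S (1 / real (Suc n)))"
    by (intro negligible_Union_nat negS) simp
  ultimately show ?thesis by (rule negligible_subset[rotated])
qed


text \<open>
  With \<open>w\<close> the density of \<open>F\<close>, the measure with density \<open>max 0 (w - c)\<close> vanishes where \<open>w \<le> c\<close>, so for
  almost every such point it contributes nothing to the difference quotients in the limit; hence they
  are eventually at most \<open>c + \<epsilon>\<close>. Rational \<open>c\<close> close to \<open>w x\<close>, from both sides, give the derivative.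
\<close>

lemma mono_lipschitz_differentiable_AE:
  fixes F :: "real \<Rightarrow> real"
  assumes mono: "\<And>x y. x \<le> y \<Longrightarrow> F x \<le> F y" and mono': "\<And>x y. x \<le> y \<Longrightarrow> F y - F x \<le> y - x"
  shows "negligible {x. \<not> F differentiable (at x)}"
proof -
  let ?N = "interval_measure F"
  have contF: "continuous_on UNIV F"
  proof -
    have "dist (F x) (F y) \<le> dist x y" for x y
      using mono[of x y] mono[of y x] mono'[of x y] mono'[of y x]
      by (cases "x \<le> y") (simp_all add: dist_real_def abs_if)
    then have "1-lipschitz_on UNIV F" by (intro lipschitz_onI) auto
    then show ?thesis by (rule lipschitz_on_continuous_on)
  qed
  have contF': "continuous (at_right a) F" for a
    using contF by (simp add: continuous_on_eq_continuous_within continuous_at_imp_continuous_at_within)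
  have "absolutely_continuous lborel ?N"
    unfolding absolutely_continuous_def
  proof
    fix A :: "real set" assume A: "A \<in> null_sets lborel"
    then have "A \<in> sets borel" "emeasure lborel A = 0" by auto
    then show "A \<in> null_sets ?N"
      using interval_measure_plus_eq_lborel[OF mono mono', of A] by (auto intro!: null_setsI)
  qed
  then obtain g where g: "g \<in> borel_measurable lborel" "density lborel g = ?N"
    using sigma_finite_measure.Radon_Nikodym[OF sigma_finite_lborel, of ?N] by auto
  have "sigma_finite_measure (density lborel g)"
    unfolding g(2) by (rule sigma_finite_interval_measure[OF mono contF'])
  then have fin: "AE x in lborel. g x \<noteq> \<infinity>"
    using sigma_finite_measure.sigma_finite_iff_density_finite[OF sigma_finite_lborel g(1)] by blast
  define w where "w x = enn2real (g x)" for x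
  have w0: "0 \<le> w x" for x by (simp add: w_def)
  have w[measurable]: "w \<in> borel_measurable borel" using g(1) by (simp add: w_def[abs_def])
  have wg: "AE x in lborel. g x = ennreal (w x)"
    using fin by eventually_elim (simp add: w_def top.not_eq_extremum)
  have Fw: "ennreal (F v - F u) = (\<integral>\<^sup>+x\<in>{u..v}. ennreal (w x) \<partial>lborel)" if "u \<le> v" for u v
  proof -
    have "ennreal (F v - F u) = emeasure (density lborel g) {u..v}"
      unfolding g(2) by (rule emeasure_interval_measure_Icc[OF that mono contF, symmetric])
    also have "\<dots> = (\<integral>\<^sup>+x\<in>{u..v}. g x \<partial>lborel)"
      using g(1) by (intro emeasure_density) auto
    also have "\<dots> = (\<integral>\<^sup>+x\<in>{u..v}. ennreal (w x) \<partial>lborel)"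
      by (rule nn_integral_cong_AE) (rule AE_mp[OF wg], simp)
    finally show ?thesis .
  qed
  \<comment> \<open>The truncation to a bounded window makes these measures finite, as the covering
    lemma requires.\<close>
  define \<tau> where "\<tau> h (R::nat) = density lborel (\<lambda>x. ennreal (max 0 (h x)) * indicator {- real R..real R} x)" for h :: "real \<Rightarrow> real" and R
  have fin\<tau>: "finite_measure (\<tau> h R)" if [measurable]: "h \<in> borel_measurable borel" and h: "\<And>x. h x \<le> w x + c" "c \<ge> 0" for h R c
  proof (rule finite_measureI)
    have "emeasure (\<tau> h R) (space (\<tau> h R)) = (\<integral>\<^sup>+x\<in>{-real R..real R}. ennreal (max 0 (h x)) \<partial>lborel)"
      by (simp add: \<tau>_def emeasure_density cball_eq_atLeastAtMost)
    also have "\<dots> \<le> (\<integral>\<^sup>+x\<in>{-real R..real R}. ennreal (w x) + ennreal c \<partial>lborel)"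
      using h w0 by (intro nn_integral_mono mult_right_mono) (auto simp flip: ennreal_plus intro!: ennreal_leI add_nonneg_nonneg)
    also have "\<dots> = (\<integral>\<^sup>+x\<in>{-real R..real R}. ennreal (w x) \<partial>lborel) + (\<integral>\<^sup>+x\<in>{-real R..real R}. ennreal c \<partial>lborel)"
      by (simp add: distrib_right nn_integral_add)
    also have "\<dots> = ennreal (F R - F (-real R)) + ennreal c * ennreal (2 * R)"
      by (subst Fw) (simp_all add: nn_integral_cmult_indicator)
    also have "\<dots> < \<infinity>" by (simp add: ennreal_mult_less_top)
    finally show "emeasure (\<tau> h R) (space (\<tau> h R)) \<noteq> \<infinity>" by simp
  qed
  have em\<tau>: "emeasure (\<tau> h R) A = (\<integral>\<^sup>+x\<in>A. ennreal (max 0 (h x)) \<partial>lborel)"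
    if [measurable]: "h \<in> borel_measurable borel" "A \<in> sets borel" and "A \<subseteq> {- real R..real R}" for h R A
  proof -
    have "emeasure (\<tau> h R) A = (\<integral>\<^sup>+x. ennreal (max 0 (h x)) * indicator {- real R..real R} x * indicator A x \<partial>lborel)"
      unfolding \<tau>_def by (rule emeasure_density) auto
    also have "\<dots> = (\<integral>\<^sup>+x\<in>A. ennreal (max 0 (h x)) \<partial>lborel)"
      using that(3) by (intro nn_integral_cong) (auto simp: indicator_def split: if_splits)
    finally show ?thesis .
  qed
  define P where "P h R x \<longleftrightarrow> ((\<lambda>r. measure (\<tau> h R) (cball x r) / r) \<longlongrightarrow> 0) (at_right 0)" for h R x
  have neg: "negligible {x \<in> {x. h x \<le> 0}. \<not> P h R x}" 
    if [measurable]: "h \<in> borel_measurable borel" and h: "\<And>x. h x \<le> w x + c" "c \<ge> 0" for h R c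
    unfolding P_def
  proof (rule measure_cball_over_radius_tendsto_0[OF fin\<tau>[OF that]])
    show "sets (\<tau> h R) = sets borel" by (simp add: \<tau>_def)
    show "{x. h x \<le> 0} \<in> sets borel" by measurable
    have "emeasure (\<tau> h R) {x. h x \<le> 0} = (\<integral>\<^sup>+x. ennreal (max 0 (h x)) * indicator {- real R..real R} x * indicator {x. h x \<le> 0} x \<partial>lborel)"
      unfolding \<tau>_def by (rule emeasure_density) auto
    also have "\<dots> = (\<integral>\<^sup>+x. 0 \<partial>(lborel::real measure))"
      by (intro nn_integral_cong) (auto simp: indicator_def max_def)
    finally show "emeasure (\<tau> h R) {x. h x \<le> 0} = 0" by simp
  qed
  \<comment> \<open>Only rational levels and integer windows occur, so the union is countable and
    stays negligible.\<close>
  define B where "B = (\<Union>R::nat. \<Union>c\<in>\<rat>\<inter>{0..}. {x \<in> {x. w x - c \<le> 0}. \<not> P (\<lambda>x. w x - c) R x} \<union> {x \<in> {x. c - w x \<le> 0}. \<not> P (\<lambda>x. c - w x) R x})"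
  have "negligible B"
    unfolding B_def
  proof (intro negligible_countable_Union[OF countable_image] ballI)
    fix S assume "S \<in> range (\<lambda>R::nat. \<Union>c\<in>\<rat>\<inter>{0..}. {x \<in> {x. w x - c \<le> 0}. \<not> P (\<lambda>x. w x - c) R x} \<union> {x \<in> {x. c - w x \<le> 0}. \<not> P (\<lambda>x. c - w x) R x})"
    then obtain R :: nat where S: "S = (\<Union>c\<in>\<rat>\<inter>{0..}. {x \<in> {x. w x - c \<le> 0}. \<not> P (\<lambda>x. w x - c) R x} \<union> {x \<in> {x. c - w x \<le> 0}. \<not> P (\<lambda>x. c - w x) R x})"
      by blast
    show "negligible S"
      unfolding S
    proof (intro negligible_countable_Union[OF countable_image] ballI)
      show "countable (\<rat> \<inter> {0::real..})" by (rule countable_Int1) (rule countable_rat)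
      fix S assume "S \<in> (\<lambda>c. {x \<in> {x. w x - c \<le> 0}. \<not> P (\<lambda>x. w x - c) R x} \<union> {x \<in> {x. c - w x \<le> 0}. \<not> P (\<lambda>x. c - w x) R x}) ` (\<rat> \<inter> {0..})"
      then obtain c where c: "c \<ge> 0" and S: "S = {x \<in> {x. w x - c \<le> 0}. \<not> P (\<lambda>x. w x - c) R x} \<union> {x \<in> {x. c - w x \<le> 0}. \<not> P (\<lambda>x. c - w x) R x}"
        by auto
      show "negligible S" unfolding S
      proof (intro negligible_Un)
        show "negligible {x \<in> {x. w x - c \<le> 0}. \<not> P (\<lambda>x. w x - c) R x}"
          by (rule neg[where c=0]) (use c in auto)
        show "negligible {x \<in> {x. c - w x \<le> 0}. \<not> P (\<lambda>x. c - w x) R x}"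
        proof (rule neg[where c=c])
          show "c - w x \<le> w x + c" for x using w0[of x] by simp
        qed (use c in auto)
      qed
    qed
  qed simp
  moreover have "{x. \<not> F differentiable (at x)} \<subseteq> B"
  proof
    fix x assume x: "x \<in> {x. \<not> F differentiable (at x)}"
    show "x \<in> B"
    proof (rule ccontr)
      assume xB: "x \<notin> B"
      \<comment> \<open>The margin 1 keeps balls of radius at most 1 about x inside the window,
        where the truncation is invisible.\<close>
      obtain R :: nat where R: "\<bar>x\<bar> + 1 < real R" using reals_Archimedean2 by blast
      have up: "((\<lambda>r. measure (\<tau> (\<lambda>x. w x - c) R) (cball x r) / r) \<longlongrightarrow> 0) (at_right 0)" 
        if "c \<in> \<rat>" "w x \<le> c" for c
        using xB that order_trans[OF w0 that(2)] unfolding B_def P_def by fastforce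
      have lo: "((\<lambda>r. measure (\<tau> (\<lambda>x. c - w x) R) (cball x r) / r) \<longlongrightarrow> 0) (at_right 0)" 
        if "c \<in> \<rat>" "0 \<le> c" "c \<le> w x" for c
        using xB that unfolding B_def P_def by fastforce
      \<comment> \<open>Integrate w <= c + max 0 (w - c) over the interval. The lower estimate
        \<open>le_lo\<close> integrates c <= w + max 0 (c - w).\<close>
      have le_up: "F v - F u \<le> c * r + measure (\<tau> (\<lambda>x. w x - c) R) (cball x r)" 
        if uv: "u \<le> v" "v - u = r" "{u..v} \<subseteq> cball x r" "r \<le> 1" and c: "c \<ge> 0" for u v r c
      proof -
        interpret T: finite_measure "\<tau> (\<lambda>x. w x - c) R" by (rule fin\<tau>[where c=0]) (use c in auto)
        have "cball x r \<subseteq> {- real R..real R}" using uv(4) R by (auto simp: dist_real_def)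
        have "ennreal (F v - F u) \<le> (\<integral>\<^sup>+x\<in>{u..v}. ennreal c + ennreal (max 0 (w x - c)) \<partial>lborel)"
          unfolding Fw[OF uv(1)] using c
          by (intro nn_integral_mono mult_right_mono) (auto simp flip: ennreal_plus intro!: ennreal_leI)
        also have "\<dots> = ennreal c * ennreal r + (\<integral>\<^sup>+x\<in>{u..v}. ennreal (max 0 (w x - c)) \<partial>lborel)"
          using uv by (simp add: distrib_right nn_integral_add nn_integral_cmult_indicator)
        also have "(\<integral>\<^sup>+x\<in>{u..v}. ennreal (max 0 (w x - c)) \<partial>lborel) = emeasure (\<tau> (\<lambda>x. w x - c) R) {u..v}"
          by (rule em\<tau>[symmetric, OF _ _ order_trans[OF uv(3) \<open>cball x r \<subseteq> {- real R..real R}\<close>]]) auto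
        also have "ennreal c * ennreal r + \<dots> \<le> ennreal c * ennreal r + ennreal (measure (\<tau> (\<lambda>x. w x - c) R) (cball x r))"
          unfolding T.emeasure_eq_measure
          by (intro add_left_mono ennreal_leI T.finite_measure_mono uv(3)) (simp add: \<tau>_def)
        also have "\<dots> = ennreal (c * r + measure (\<tau> (\<lambda>x. w x - c) R) (cball x r))"
          using c uv by (simp add: ennreal_mult ennreal_plus)
        finally show ?thesis using c uv by (subst (asm) ennreal_le_iff) auto
      qed
      have le_lo: "c * r \<le> F v - F u + measure (\<tau> (\<lambda>x. c - w x) R) (cball x r)" 
        if uv: "u \<le> v" "v - u = r" "{u..v} \<subseteq> cball x r" "r \<le> 1" and c: "c \<ge> 0" for u v r c
      proof -
        interpret T: finite_measure "\<tau> (\<lambda>x. c - w x) R" 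
        proof (rule fin\<tau>[where c=c])
          show "c - w x \<le> w x + c" for x using w0[of x] by simp
        qed (use c in auto)
        have "cball x r \<subseteq> {- real R..real R}" using uv(4) R by (auto simp: dist_real_def)
        have "ennreal (c * r) = (\<integral>\<^sup>+x\<in>{u..v}. ennreal c \<partial>lborel)"
          using uv c by (simp add: nn_integral_cmult_indicator ennreal_mult)
        also have "\<dots> \<le> (\<integral>\<^sup>+x\<in>{u..v}. ennreal (w x) + ennreal (max 0 (c - w x)) \<partial>lborel)"
          using c w0 by (intro nn_integral_mono mult_right_mono) (auto simp flip: ennreal_plus intro!: ennreal_leI)
        also have "\<dots> = ennreal (F v - F u) + (\<integral>\<^sup>+x\<in>{u..v}. ennreal (max 0 (c - w x)) \<partial>lborel)"
          using uv by (simp add: distrib_right nn_integral_add Fw)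
        also have "(\<integral>\<^sup>+x\<in>{u..v}. ennreal (max 0 (c - w x)) \<partial>lborel) = emeasure (\<tau> (\<lambda>x. c - w x) R) {u..v}"
          by (rule em\<tau>[symmetric, OF _ _ order_trans[OF uv(3) \<open>cball x r \<subseteq> {- real R..real R}\<close>]]) auto
        also have "ennreal (F v - F u) + \<dots> \<le> ennreal (F v - F u) + ennreal (measure (\<tau> (\<lambda>x. c - w x) R) (cball x r))"
          unfolding T.emeasure_eq_measure
          by (intro add_left_mono ennreal_leI T.finite_measure_mono uv(3)) (simp add: \<tau>_def)
        also have "\<dots> = ennreal (F v - F u + measure (\<tau> (\<lambda>x. c - w x) R) (cball x r))"
          using mono[OF uv(1)] by (simp add: ennreal_plus)
        finally show ?thesis using mono[OF uv(1)] by (subst (asm) ennreal_le_iff) auto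
      qed
      have "(F has_field_derivative w x) (at x)"
        unfolding has_field_derivative_iff tendsto_iff
      proof (intro allI impI)
        fix e' :: real assume "e' > 0"
        define e where "e = e' / 4"
        have "e > 0" using \<open>e' > 0\<close> by (simp add: e_def)
        obtain c1 where c1: "c1 \<in> \<rat>" "w x < c1" "c1 < w x + e"
          using Rats_dense_in_real[of "w x" "w x + e"] \<open>e > 0\<close> by auto
        \<comment> \<open>The exceptional set treats only levels at least 0. If w x = 0 there is no
          such level strictly below it, and 0 itself is taken.\<close>
        obtain c0 where c0: "c0 \<in> \<rat>" "w x - e < c0" "c0 \<le> w x" "0 \<le> c0"
        proof (cases "w x = 0")
          case True
          then show ?thesis using that[of 0] \<open>e > 0\<close> by simp
        next
          case False
          then have "max 0 (w x - e) < w x" using w0[of x] \<open>e > 0\<close> by simp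
          then obtain q where "q \<in> \<rat>" "max 0 (w x - e) < q" "q < w x" using Rats_dense_in_real by blast
          then show ?thesis using that[of q] by simp
        qed
        have c1': "c1 \<ge> 0" using c1 w0[of x] by simp
        have "\<forall>\<^sub>F r in at_right 0. measure (\<tau> (\<lambda>x. w x - c1) R) (cball x r) / r < e \<and> measure (\<tau> (\<lambda>x. c0 - w x) R) (cball x r) / r < e"
          using order_tendstoD(2)[OF up[of c1] \<open>e > 0\<close>] order_tendstoD(2)[OF lo[of c0] \<open>e > 0\<close>] c0 c1
          by (intro eventually_conj) auto
        then obtain d where d: "d > 0" "\<And>r. 0 < r \<Longrightarrow> r < d \<Longrightarrow> measure (\<tau> (\<lambda>x. w x - c1) R) (cball x r) / r < e \<and> measure (\<tau> (\<lambda>x. c0 - w x) R) (cball x r) / r < e"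
          unfolding eventually_at_right_field by auto
        have "\<bar>(F y - F x) / (y - x) - w x\<bar> < e'" if y: "y \<noteq> x" "\<bar>y - x\<bar> < min d 1" for y
        proof -
          define r where "r = \<bar>y - x\<bar>"
          have r: "0 < r" "r < d" "r \<le> 1" using y by (auto simp: r_def)
          have ms: "measure (\<tau> (\<lambda>x. w x - c1) R) (cball x r) \<le> e * r" "measure (\<tau> (\<lambda>x. c0 - w x) R) (cball x r) \<le> e * r"
            using d(2)[OF r(1,2)] r(1) by (simp_all add: field_simps)
          have sub: "max x y - min x y = r" "{min x y..max x y} \<subseteq> cball x r"
            by (auto simp: r_def dist_real_def)
          have mm: "min x y \<le> max x y" by simp
          have quot: "(F y - F x) / (y - x) = (F (max x y) - F (min x y)) / r"
            using y(1) by (cases "x < y") (auto simp: r_def max_def min_def abs_if field_simps)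
          have "F (max x y) - F (min x y) \<le> (w x + 2 * e) * r"
            using le_up[OF mm sub r(3) c1'] ms(1) mult_right_mono[of c1 "w x + e" r] c1 r(1) by (simp add: algebra_simps)
          then have 1: "(F y - F x) / (y - x) \<le> w x + 2 * e"
            unfolding quot using r(1) by (simp add: divide_le_eq)
          have "(w x - 2 * e) * r \<le> F (max x y) - F (min x y)"
            using le_lo[OF mm sub r(3) c0(4)] ms(2) mult_right_mono[of "w x - e" c0 r] c0 r(1) by (simp add: algebra_simps)
          then have 2: "w x - 2 * e \<le> (F y - F x) / (y - x)"
            unfolding quot using r(1) by (simp add: le_divide_eq)
          show ?thesis using 1 2 \<open>e' > 0\<close> by (simp add: e_def abs_if)
        qed
        then show "\<forall>\<^sub>F y in at x. dist ((F y - F x) / (y - x)) (w x) < e'"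
          unfolding eventually_at using d(1) by (intro exI[of _ "min d 1"]) (auto simp: dist_real_def)
      qed
      then show False using x by (auto simp: real_differentiable_def)
    qed
  qed
  ultimately show ?thesis by (rule negligible_subset)
qed

text \<open>Adding D x makes the function nondecreasing, and dividing by 2 D brings its slopes into
  [0, 1]. The constant D = C + 1 is positive even when C = 0.\<close>

lemma lipschitz_differentiable_AE_real:
  fixes f :: "real \<Rightarrow> real"
  assumes "C-lipschitz_on UNIV f"
  shows "negligible {x. \<not> f differentiable (at x)}"
proof -
  define D where "D = C + 1"
  have D: "D > 0" using lipschitz_on_nonneg[OF assms] by (simp add: D_def)
  have lip: "\<bar>f x - f y\<bar> \<le> D * \<bar>x - y\<bar>" for x y
    using lipschitz_onD[OF assms, of x y] by (simp add: dist_real_def D_def algebra_simps)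
  define F where "F x = (f x + D * x) / (2 * D)" for x
  have "negligible {x. \<not> F differentiable (at x)}"
  proof (rule mono_lipschitz_differentiable_AE)
    fix x y :: real assume "x \<le> y"
    then have "\<bar>f x - f y\<bar> \<le> D * (y - x)" using lip[of x y] by simp
    then have *: "f x - f y \<le> D * (y - x)" "f y - f x \<le> D * (y - x)" by (simp_all add: abs_le_iff)
    show "F x \<le> F y" using * D by (simp add: F_def divide_right_mono algebra_simps)
    have "F y - F x = (f y - f x + D * (y - x)) / (2 * D)" by (simp add: F_def diff_divide_distrib[symmetric] algebra_simps)
    also have "\<dots> \<le> (D * (y - x) + D * (y - x)) / (2 * D)" using * D by (intro divide_right_mono) auto
    finally show "F y - F x \<le> y - x" using D by simp
  qed
  moreover have "f differentiable (at x)" if "F differentiable (at x)" for x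
  proof -
    have "f = (\<lambda>x. 2 * D * F x - D * x)" using D by (auto simp: F_def)
    moreover have "(\<lambda>x. 2 * D * F x - D * x) differentiable (at x)"
      using that by (intro derivative_intros) auto
    ultimately show ?thesis by simp
  qed
  ultimately show ?thesis by (elim negligible_subset) blast
qed

lemma lipschitz_differentiable_AE:
  fixes f :: "real \<Rightarrow> complex"
  assumes "C-lipschitz_on UNIV f"
  shows "negligible {x. \<not> f differentiable (at x)}"
proof -
  have le: "dist (Re x) (Re y) \<le> dist x y" "dist (Im x) (Im y) \<le> dist x y" for x y
    using abs_Re_le_cmod[of "x - y"] abs_Im_le_cmod[of "x - y"] by (simp_all add: dist_norm)
  have "C-lipschitz_on UNIV (\<lambda>x. Re (f x))" "C-lipschitz_on UNIV (\<lambda>x. Im (f x))"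
    using assms le unfolding lipschitz_on_def by (meson order_trans)+
  then have "negligible ({x. \<not> (\<lambda>x. Re (f x)) differentiable (at x)} \<union> {x. \<not> (\<lambda>x. Im (f x)) differentiable (at x)})"
    by (intro negligible_Un lipschitz_differentiable_AE_real)
  moreover have "f differentiable (at x)"
    if d: "(\<lambda>x. Re (f x)) differentiable (at x)" "(\<lambda>x. Im (f x)) differentiable (at x)" for x
  proof -
    obtain a b where "((\<lambda>x. Re (f x)) has_field_derivative a) (at x)" "((\<lambda>x. Im (f x)) has_field_derivative b) (at x)"
      using d unfolding real_differentiable_def by blast
    then have "(f has_vector_derivative Complex a b) (at x)"
      by (simp add: has_vector_derivative_complex_iff)
    then show ?thesis unfolding has_vector_derivative_def differentiable_def by blast
  qed
  ultimately show ?thesis by (elim negligible_subset) blast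
qed

section \<open>Riemann maps and kernel convergence\<close>

text \<open>
  The complement of \<open>K\<close> in the coordinate \<open>u = 1 / (z - a)\<close>, with \<open>0\<close> in the role of infinity. The
  explicit case \<open>u = 0\<close> is needed because \<open>a + 1 / 0 = a\<close> belongs to \<open>K\<close>.
\<close>

definition inversion_domain :: "complex \<Rightarrow> complex set \<Rightarrow> complex set"
  where "inversion_domain a K = {u. u = 0 \<or> a + 1 / u \<notin> K}"

lemma inversion_domain_iff:
  assumes "a \<in> K" shows "1 / (z - a) \<in> inversion_domain a K \<longleftrightarrow> z \<notin> K \<or> z = a"
  by (auto simp: inversion_domain_def)

lemma inversion_domain_minus_0:
  assumes "a \<in> K" shows "inversion_domain a K - {0} = (\<lambda>z. 1 / (z - a)) ` (- K)"
proof (intro equalityI subsetI)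
  fix u assume "u \<in> inversion_domain a K - {0}"
  then have "a + 1 / u \<in> - K" "u = 1 / ((a + 1 / u) - a)" by (auto simp: inversion_domain_def)
  then show "u \<in> (\<lambda>z. 1 / (z - a)) ` (- K)" by (rule image_eqI[rotated])
qed (use assms in \<open>auto simp: inversion_domain_iff\<close>)

lemma Compl_inversion_domain:
  "- inversion_domain a K = (\<lambda>z. 1 / (z - a)) ` (K - {a})"
proof (intro equalityI subsetI)
  fix u assume "u \<in> - inversion_domain a K"
  then have "a + 1 / u \<in> K - {a}" "u = 1 / ((a + 1 / u) - a)" by (simp_all add: inversion_domain_def)
  then show "u \<in> (\<lambda>z. 1 / (z - a)) ` (K - {a})" by (rule image_eqI[rotated])
qed (auto simp: inversion_domain_def)

lemma inversion_domain_mono: "K \<subseteq> K' \<Longrightarrow> inversion_domain a K' \<subseteq> inversion_domain a K"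
  by (auto simp: inversion_domain_def)

lemma inversion_domain_subset_ball:
  assumes "ball a \<rho> \<subseteq> K" "\<rho> > 0" shows "inversion_domain a K \<subseteq> ball 0 (2 / \<rho>)"
proof
  fix u assume u: "u \<in> inversion_domain a K"
  show "u \<in> ball 0 (2 / \<rho>)"
  proof (cases "u = 0")
    case False
    then have "a + 1 / u \<notin> ball a \<rho>" using u assms by (auto simp: inversion_domain_def)
    then have "\<rho> \<le> 1 / cmod u" by (simp add: dist_norm norm_divide)
    then have "cmod u * \<rho> \<le> 1" using False by (simp add: field_simps)
    then have "cmod u * \<rho> < 2" by linarith
    then show ?thesis using assms(2) by (simp add: field_simps)
  qed (use assms(2) in simp)
qed

lemma ball_subset_inversion_domain:
  assumes "bounded K" obtains \<rho> where "\<rho> > 0" "ball 0 \<rho> \<subseteq> inversion_domain a K"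
proof -
  obtain B where B: "B > 0" "\<And>z. z \<in> K \<Longrightarrow> cmod z \<le> B" using assms bounded_pos by blast
  define \<rho> where "\<rho> = 1 / (B + cmod a + 1)"
  have "u \<in> inversion_domain a K" if "cmod u < \<rho>" for u
  proof (cases "u = 0")
    case False
    then have "B + cmod a + 1 < cmod (1 / u)"
      using that B(1) by (simp add: \<rho>_def norm_divide field_simps add_pos_nonneg)
    also have "\<dots> \<le> cmod (a + 1 / u) + cmod a"
      using norm_triangle_ineq4[of "a + 1 / u" a] by simp
    finally have "B < cmod (a + 1 / u)" by simp
    then show ?thesis using B(2)[of "a + 1 / u"] by (auto simp: inversion_domain_def)
  qed (simp add: inversion_domain_def)
  moreover have "\<rho> > 0" using B(1) by (simp add: \<rho>_def add_pos_nonneg)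
  ultimately show ?thesis using that[of \<rho>] by (auto simp: subset_iff)
qed

lemma open_inversion_preimage:
  assumes "open V" shows "open {u::complex. u \<noteq> 0 \<and> a + 1 / u \<in> V}"
proof -
  have "open ((- {0}) \<inter> (\<lambda>u. a + 1 / u) -` V)"
    by (rule continuous_open_preimage) (auto intro!: continuous_intros assms)
  also have "(- {0}) \<inter> (\<lambda>u. a + 1 / u) -` V = {u. u \<noteq> 0 \<and> a + 1 / u \<in> V}" by auto
  finally show ?thesis .
qed

text \<open>A bounded open connected plane set is simply connected if its complement is connected.
  Here the complement is the image of K - {a} under the inversion, which is why K must remain
  connected after removing a.\<close>

lemma inversion_domain_properties:
  assumes K: "compact K" and a: "a \<in> interior K" and con: "connected (- K)" "connected (K - {a})"
  shows "open (inversion_domain a K)" "bounded (inversion_domain a K)"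
    "simply_connected (inversion_domain a K)"
proof -
  have aK: "a \<in> K" using a interior_subset by blast
  obtain \<rho> where \<rho>: "\<rho> > 0" "ball 0 \<rho> \<subseteq> inversion_domain a K"
    using ball_subset_inversion_domain compact_imp_bounded[OF K] by blast
  have "inversion_domain a K = ball 0 \<rho> \<union> {u. u \<noteq> 0 \<and> a + 1 / u \<in> - K}"
    using \<rho> by (auto simp: inversion_domain_def)
  then show op: "open (inversion_domain a K)"
    using open_Un[OF open_ball open_inversion_preimage[of "- K" a]] compact_imp_closed[OF K]
    by (simp add: closed_def)
  obtain \<rho>' where "\<rho>' > 0" "ball a \<rho>' \<subseteq> K" using a mem_interior by blast
  then show bd: "bounded (inversion_domain a K)"
    using inversion_domain_subset_ball bounded_subset bounded_ball by metis
  have cont: "continuous_on S (\<lambda>z. 1 / (z - a))" if "a \<notin> S" for S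
    using that by (auto intro!: continuous_intros)
  have "connected (inversion_domain a K)"
  proof -
    \<comment> \<open>The image of - K misses 0, the point at infinity; a small ball meeting that
      image fills it in without losing connectedness.\<close>
    have "inversion_domain a K = ball 0 \<rho> \<union> (\<lambda>z. 1 / (z - a)) ` (- K)"
      using \<rho> inversion_domain_minus_0[OF aK] by auto
    moreover have "connected (ball 0 \<rho> \<union> (\<lambda>z. 1 / (z - a)) ` (- K))"
    proof (rule connected_Un)
      show "connected ((\<lambda>z. 1 / (z - a)) ` (- K))"
        by (rule connected_continuous_image[OF cont con(1)]) (use aK in auto)
      have "complex_of_real (\<rho> / 2) \<in> inversion_domain a K - {0}" using \<rho> by (auto simp: subset_iff)
      then have "complex_of_real (\<rho> / 2) \<in> (\<lambda>z. 1 / (z - a)) ` (- K)"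
        unfolding inversion_domain_minus_0[OF aK] .
      moreover have "complex_of_real (\<rho> / 2) \<in> ball 0 \<rho>" using \<rho> by simp
      ultimately show "ball 0 \<rho> \<inter> (\<lambda>z. 1 / (z - a)) ` (- K) \<noteq> {}" by blast
    qed auto
    ultimately show ?thesis by simp
  qed
  moreover have "connected (- inversion_domain a K)"
    unfolding Compl_inversion_domain by (rule connected_continuous_image[OF cont con(2)]) auto
  ultimately show "simply_connected (inversion_domain a K)"
    using simply_connected_iff_simple[OF op bd] by blast
qed

text \<open>The inverse g is part of the data because the kernel theorem takes limits of the maps on
  the domain and of the inverses on the disk. Positivity of the derivative removes the freedom of
  rotation, which makes the map unique.\<close>

definition riemann_pair :: "complex set \<Rightarrow> (complex \<Rightarrow> complex) \<Rightarrow> (complex \<Rightarrow> complex) \<Rightarrow> bool"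
  where "riemann_pair S f g \<longleftrightarrow>
    open S \<and> 0 \<in> S \<and> f holomorphic_on S \<and> g holomorphic_on ball 0 1 \<and>
    (\<forall>z\<in>S. f z \<in> ball 0 1 \<and> g (f z) = z) \<and> (\<forall>w\<in>ball 0 1. g w \<in> S \<and> f (g w) = w) \<and>
    f 0 = 0 \<and> (\<exists>d>0. deriv f 0 = complex_of_real d)"

lemma deriv_mult_deriv_inverse:
  assumes "open S" "0 \<in> S" "f holomorphic_on S" "g holomorphic_on T" "open T" "0 \<in> T"
    and "\<And>z. z \<in> S \<Longrightarrow> g (f z) = z" "f 0 = 0"
  shows "deriv g 0 * deriv f 0 = 1"
proof -
  have f: "(f has_field_derivative deriv f 0) (at 0)" by (rule holomorphic_derivI[OF assms(3,1,2)])
  have "(g has_field_derivative deriv g 0) (at (f 0))" 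
    unfolding \<open>f 0 = 0\<close> by (rule holomorphic_derivI[OF assms(4,5,6)])
  from DERIV_chain[OF this f] have "((\<lambda>z. z) has_field_derivative deriv g 0 * deriv f 0) (at 0)"
    by (rule has_field_derivative_transform_within_open[OF _ assms(1,2)]) (simp add: assms(7))
  then show ?thesis using DERIV_unique[OF _ DERIV_ident] by blast
qed

lemma riemann_pairD:
  assumes "riemann_pair S f g"
  shows "open S" "0 \<in> S" "f holomorphic_on S" "g holomorphic_on ball 0 1"
    "\<And>z. z \<in> S \<Longrightarrow> cmod (f z) < 1" "\<And>z. z \<in> S \<Longrightarrow> g (f z) = z"
    "\<And>w. cmod w < 1 \<Longrightarrow> g w \<in> S" "\<And>w. cmod w < 1 \<Longrightarrow> f (g w) = w" "f 0 = 0" "g 0 = 0"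
    "\<exists>d>0. deriv f 0 = complex_of_real d \<and> deriv g 0 = complex_of_real (1 / d)"
proof -
  note a = assms[unfolded riemann_pair_def]
  show 1: "open S" "0 \<in> S" "f holomorphic_on S" "g holomorphic_on ball 0 1"
    "\<And>z. z \<in> S \<Longrightarrow> cmod (f z) < 1" "\<And>z. z \<in> S \<Longrightarrow> g (f z) = z"
    "\<And>w. cmod w < 1 \<Longrightarrow> g w \<in> S" "\<And>w. cmod w < 1 \<Longrightarrow> f (g w) = w" "f 0 = 0"
    using a by auto
  show "g 0 = 0" using 1 by metis
  obtain d where d: "d > 0" "deriv f 0 = complex_of_real d" using a by blast
  have "deriv g 0 * deriv f 0 = 1"
    by (rule deriv_mult_deriv_inverse[OF 1(1,2,3,4)]) (use 1 in auto)
  then have "deriv g 0 = complex_of_real (1 / d)" using d by (simp add: field_simps)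
  then show "\<exists>d>0. deriv f 0 = complex_of_real d \<and> deriv g 0 = complex_of_real (1 / d)"
    using d by blast
qed

text \<open>An arbitrary Riemann map is followed by a disk automorphism taking the image of 0 to 0,
  then by the rotation that makes its derivative there positive.\<close>

lemma riemann_pair_exists:
  assumes S: "open S" "simply_connected S" "bounded S" "0 \<in> S"
  obtains f g where "riemann_pair S f g"
proof -
  have "S \<noteq> {}" "S \<noteq> UNIV" using S not_bounded_UNIV by auto
  then obtain f0 g0 where f0: "f0 holomorphic_on S" "g0 holomorphic_on ball 0 1"
    "\<And>z. z \<in> S \<Longrightarrow> f0 z \<in> ball 0 1" "\<And>z. z \<in> S \<Longrightarrow> g0 (f0 z) = z"
    "\<And>w. w \<in> ball 0 1 \<Longrightarrow> g0 w \<in> S" "\<And>w. w \<in> ball 0 1 \<Longrightarrow> f0 (g0 w) = w"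
  proof -
    have "\<exists>f g. f holomorphic_on S \<and> g holomorphic_on ball 0 1 \<and>
           (\<forall>z \<in> S. f z \<in> ball 0 1 \<and> g(f z) = z) \<and>
           (\<forall>z \<in> ball 0 1. g z \<in> S \<and> f(g z) = z)"
      using Riemann_mapping_theorem[of S] S(1,2) \<open>S \<noteq> {}\<close> \<open>S \<noteq> UNIV\<close> by simp
    then obtain f g where fg: "f holomorphic_on S" "g holomorphic_on ball 0 1"
      "\<forall>z \<in> S. f z \<in> ball 0 1 \<and> g(f z) = z" "\<forall>z \<in> ball 0 1. g z \<in> S \<and> f(g z) = z"
      by blast
    show ?thesis by (rule that[of f g]) (use fg in simp_all)
  qed
  obtain m m' where m: "m (f0 0) = 0" "m holomorphic_on ball 0 1" "m ` ball 0 1 \<subseteq> ball 0 1"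
    "m' holomorphic_on ball 0 1" "m' ` ball 0 1 \<subseteq> ball 0 1"
    "\<And>z. z \<in> ball 0 1 \<Longrightarrow> m (m' z) = z" "\<And>z. z \<in> ball 0 1 \<Longrightarrow> m' (m z) = z"
  proof (rule ball_biholomorphism_exists[OF f0(3)[OF S(4)]])
    fix m m'
    assume "m (f0 0) = 0" "m holomorphic_on ball 0 1" "m ` ball 0 1 \<subseteq> ball 0 1"
      "m' holomorphic_on ball 0 1" "m' ` ball 0 1 \<subseteq> ball 0 1"
      "\<And>z. z \<in> ball 0 1 \<Longrightarrow> m (m' z) = z" "\<And>z. z \<in> ball 0 1 \<Longrightarrow> m' (m z) = z"
    then show thesis by (rule that[of m m'])
  qed
  define f1 where "f1 z = m (f0 z)" for z
  define g1 where "g1 w = g0 (m' w)" for w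
  have f1: "f1 holomorphic_on S" "g1 holomorphic_on ball 0 1"
  proof -
    have "m \<circ> f0 holomorphic_on S"
      by (rule holomorphic_on_compose_gen[OF f0(1) m(2)]) (use f0(3) in blast)
    then show "f1 holomorphic_on S" by (simp add: f1_def[abs_def] o_def)
    have "g0 \<circ> m' holomorphic_on ball 0 1"
      by (rule holomorphic_on_compose_gen[OF m(4) f0(2) m(5)])
    then show "g1 holomorphic_on ball 0 1" by (simp add: g1_def[abs_def] o_def)
  qed
  have mem: "f1 z \<in> ball 0 1" "g1 (f1 z) = z" if "z \<in> S" for z
  proof -
    have "m (f0 z) \<in> ball 0 1" using f0(3)[OF that] m(3) by blast
    then show "f1 z \<in> ball 0 1" "g1 (f1 z) = z"
      by (simp_all add: f1_def g1_def m(7)[OF f0(3)[OF that]] f0(4)[OF that] del: mem_ball)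
  qed
  have mem': "g1 w \<in> S" "f1 (g1 w) = w" if "w \<in> ball 0 1" for w
  proof -
    have "m' w \<in> ball 0 1" using that m(5) by blast
    then show "g1 w \<in> S" "f1 (g1 w) = w" by (simp_all add: f1_def g1_def f0(5,6) m(6)[OF that] del: mem_ball)
  qed
  have f10: "f1 0 = 0" by (simp add: f1_def m)
  have nz: "deriv g1 0 * deriv f1 0 = 1"
    by (rule deriv_mult_deriv_inverse[OF S(1,4) f1]) (use mem f10 in auto)
  obtain c where c: "cmod c = 1" "c * deriv f1 0 = of_real (cmod (deriv f1 0))"
    using unit_multiple_norm by blast
  have cnz: "c \<noteq> 0" using c by auto
  have scale: "w / c \<in> ball 0 1" if "w \<in> ball 0 1" for w using that c by (simp add: norm_divide)
  have "riemann_pair S (\<lambda>z. c * f1 z) (\<lambda>w. g1 (w / c))"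
    unfolding riemann_pair_def
  proof (intro conjI ballI)
    show "(\<lambda>w. g1 (w / c)) holomorphic_on ball 0 1"
    proof -
      have "g1 \<circ> (\<lambda>w. w / c) holomorphic_on ball 0 1"
        by (rule holomorphic_on_compose_gen[OF _ f1(2)]) (use scale cnz in \<open>auto intro!: holomorphic_intros\<close>)
      then show ?thesis by (simp add: o_def)
    qed
    have "deriv (\<lambda>z. c * f1 z) 0 = c * deriv f1 0"
      using f1(1) S(1,4) by (intro deriv_cmult) (auto simp: holomorphic_on_open field_differentiable_def)
    then show "\<exists>d>0. deriv (\<lambda>z. c * f1 z) 0 = complex_of_real d"
      using c nz by (intro exI[of _ "cmod (deriv f1 0)"]) auto
    show "c * f1 z \<in> ball 0 1" "g1 (c * f1 z / c) = z" if "z \<in> S" for z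
      using mem[OF that] by (simp_all add: norm_mult c cnz)
    show "g1 (w / c) \<in> S" "c * f1 (g1 (w / c)) = w" if "w \<in> ball 0 1" for w
      using mem'[OF scale[OF that]] cnz by simp_all
  qed (use S f1 f10 in \<open>auto intro!: holomorphic_intros\<close>)
  then show ?thesis using that by blast
qed

lemma Schwarz_deriv_eq_1:
  assumes "h holomorphic_on ball 0 1" "h 0 = 0" "\<And>z. cmod z < 1 \<Longrightarrow> cmod (h z) < 1"
    and "deriv h 0 = 1" "cmod z < 1"
  shows "h z = z"
proof -
  obtain \<alpha> where \<alpha>: "\<And>z. cmod z < 1 \<Longrightarrow> h z = \<alpha> * z"
    using Schwarz_Lemma(3)[OF assms(1-3), of 0] assms(4) by auto
  have "((\<lambda>z. \<alpha> * z) has_field_derivative \<alpha>) (at 0)"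
    by (auto intro!: derivative_eq_intros)
  then have "(h has_field_derivative \<alpha>) (at 0)"
    by (rule has_field_derivative_transform_within_open[of _ _ _ "ball 0 1"]) (auto simp: \<alpha>)
  then have "\<alpha> = 1" using assms(4) DERIV_imp_deriv by metis
  then show ?thesis using \<alpha> assms(5) by simp
qed

text \<open>Limits preserve only the non-strict bound by 1. The nonzero derivative excludes
  constants, and the open mapping theorem restores strictness.\<close>

lemma holomorphic_into_ball_of_cball:
  assumes "h holomorphic_on ball 0 1" "\<And>z. cmod z < 1 \<Longrightarrow> cmod (h z) \<le> 1"
    and "deriv h 0 \<noteq> 0" "cmod z < 1"
  shows "cmod (h z) < 1"
proof -
  have "\<not> h constant_on ball 0 1"
  proof
    assume "h constant_on ball 0 1"
    then obtain c where c: "\<And>z. z \<in> ball 0 1 \<Longrightarrow> h z = c" unfolding constant_on_def by blast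
    have "((\<lambda>z. c) has_field_derivative 0) (at (0::complex))" by simp
    then have "(h has_field_derivative 0) (at 0)"
      by (rule has_field_derivative_transform_within_open[of _ _ _ "ball 0 1"]) (auto simp: c)
    then show False using assms(3) DERIV_imp_deriv by metis
  qed
  then have "open (h ` ball 0 1)"
    using open_mapping_thm[OF assms(1), of "ball 0 1"] by auto
  moreover have "h ` ball 0 1 \<subseteq> cball 0 1" using assms(2) by auto
  ultimately have "h ` ball 0 1 \<subseteq> ball 0 1" by (metis interior_cball interior_maximal)
  then show ?thesis using assms(4) by (auto simp: image_subset_iff)
qed

lemma uniform_limit_subseq:
  assumes "uniform_limit S f l sequentially" "strict_mono (r :: nat \<Rightarrow> nat)"
  shows "uniform_limit S (\<lambda>k. f (r k)) l sequentially"
  using assms(1) eventually_subseq[OF assms(2)] unfolding uniform_limit_iff by blast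

lemma deriv_tendsto_of_uniform_limit:
  assumes "open S" "z \<in> S" "\<And>k. f k holomorphic_on S"
    and "\<And>K. compact K \<Longrightarrow> K \<subseteq> S \<Longrightarrow> uniform_limit K f g sequentially"
  shows "(\<lambda>k. deriv (f k) z) \<longlonglongrightarrow> deriv g z"
proof -
  obtain e where e: "e > 0" "cball z e \<subseteq> S" using assms(1,2) open_contains_cball by blast
  have sub: "ball z e \<subseteq> S" using e ball_subset_cball by blast
  have "uniform_limit (ball z e) f g sequentially"
    by (rule uniform_limit_on_subset[OF assms(4)[of "cball z e"]]) (use e in auto)
  then show ?thesis
    by (rule deriv_complex_uniform_limit)
      (use e in \<open>auto intro!: always_eventually holomorphic_on_subset[OF assms(3) sub]\<close>)
qed

lemma deriv_chain_0:
  assumes "g holomorphic_on ball 0 1" "f holomorphic_on S" "open S" "g 0 = 0" "0 \<in> S"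
  shows "deriv (\<lambda>z. f (g z)) 0 = deriv f 0 * deriv g 0"
proof -
  have "(g has_field_derivative deriv g 0) (at 0)" by (rule holomorphic_derivI[OF assms(1)]) auto
  moreover have "(f has_field_derivative deriv f 0) (at (g 0))" 
    unfolding assms(4) by (rule holomorphic_derivI[OF assms(2,3,5)])
  ultimately show ?thesis using DERIV_chain2[of f "deriv f 0" g 0 "deriv g 0"] DERIV_imp_deriv by blast
qed

text \<open>
  The limit \<open>h\<close> of the inverse maps sends the disk into the kernel \<open>D\<close> and has derivative at least
  that of \<open>g\<close> at the origin, so the Schwarz lemma forces \<open>h = g\<close>.
\<close>

theorem caratheodory_kernel_convergence:
  assumes D: "riemann_pair D f g" and Dk: "\<And>k::nat. riemann_pair (D' k) (F k) (G k)"
    and sub: "\<And>k. D \<subseteq> D' k" and bd: "\<And>k. D' k \<subseteq> ball 0 R"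
    and dec: "\<And>j k. j \<le> k \<Longrightarrow> D' k \<subseteq> D' j"
    and ker: "\<And>V. open V \<Longrightarrow> V \<subseteq> (\<Inter>k. closure (D' k)) \<Longrightarrow> V \<subseteq> D"
  obtains r where "strict_mono (r :: nat \<Rightarrow> nat)"
    "\<And>K. compact K \<Longrightarrow> K \<subseteq> D \<Longrightarrow> uniform_limit K (\<lambda>k. F (r k)) f sequentially"
    "\<And>S \<epsilon>. compact S \<Longrightarrow> S \<inter> D = {} \<Longrightarrow> \<epsilon> > 0 \<Longrightarrow>
       \<forall>\<^sub>F k in sequentially. \<forall>u\<in>S \<inter> D' (r k). cmod (F (r k) u) > 1 - \<epsilon>"
proof -
  note Dp = riemann_pairD[OF D] and Dkp = riemann_pairD[OF Dk]
  \<comment> \<open>Montel is used twice: here for the inverses on the disk, bounded by R, then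
    along the resulting subsequence for the maps themselves on D, bounded by 1.\<close>
  define HG where "HG = {h. h holomorphic_on ball 0 1 \<and> (\<forall>z\<in>ball 0 1. cmod (h z) \<le> R)}"
  have G_HG: "G k \<in> HG" for k
    using Dkp(4)[of k] Dkp(7)[of _ k] bd[of k] by (fastforce simp: HG_def)
  obtain h r1 where h: "h holomorphic_on ball 0 1" and r1: "strict_mono (r1 :: nat \<Rightarrow> nat)"
    and hpt: "\<And>x. x \<in> ball 0 1 \<Longrightarrow> (\<lambda>n. G (r1 n) x) \<longlonglongrightarrow> h x"
    and hul: "\<And>K. compact K \<Longrightarrow> K \<subseteq> ball 0 1 \<Longrightarrow> uniform_limit K (G \<circ> r1) h sequentially"
  proof (rule Montel[of "ball 0 1" HG G])
    show "\<exists>B. \<forall>h\<in>HG. \<forall>z\<in>K. cmod (h z) \<le> B" if "K \<subseteq> ball 0 1" for K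
      using that by (intro exI[of _ R]) (auto simp: HG_def)
  qed (use G_HG in \<open>auto simp: HG_def\<close>)
  define HF where "HF = {h. h holomorphic_on D \<and> (\<forall>z\<in>D. cmod (h z) \<le> 1)}"
  have F_HF: "F k \<in> HF" for k
    using holomorphic_on_subset[OF Dkp(3) sub] Dkp(5)[of _ k] sub[of k] 
    by (auto simp: HF_def intro!: less_imp_le)
  obtain q r2 where q: "q holomorphic_on D" and r2: "strict_mono (r2 :: nat \<Rightarrow> nat)"
    and qpt: "\<And>x. x \<in> D \<Longrightarrow> (\<lambda>n. F (r1 (r2 n)) x) \<longlonglongrightarrow> q x"
    and qul: "\<And>K. compact K \<Longrightarrow> K \<subseteq> D \<Longrightarrow> uniform_limit K ((\<lambda>k. F (r1 k)) \<circ> r2) q sequentially"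
  proof (rule Montel[of D HF "\<lambda>k. F (r1 k)"])
    show "\<exists>B. \<forall>h\<in>HF. \<forall>z\<in>K. cmod (h z) \<le> B" if "K \<subseteq> D" for K
      using that by (intro exI[of _ 1]) (auto simp: HF_def)
  qed (use F_HF Dp(1) in \<open>auto simp: HF_def\<close>)
  define r where "r k = r1 (r2 k)" for k
  have r: "strict_mono r" unfolding r_def[abs_def] by (rule strict_monoI) (use r1 r2 in \<open>simp add: strict_mono_less\<close>)
  have Gr: "uniform_limit K (\<lambda>k. G (r k)) h sequentially" if "compact K" "K \<subseteq> ball 0 1" for K
    using uniform_limit_subseq[OF hul[OF that] r2] by (simp add: r_def)
  have Fr: "uniform_limit K (\<lambda>k. F (r k)) q sequentially" if "compact K" "K \<subseteq> D" for K
    using qul[OF that] by (simp add: r_def o_def)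
  obtain d where d: "d > 0" "deriv f 0 = complex_of_real d" "deriv g 0 = complex_of_real (1 / d)"
    using Dp(11) by blast
  have "\<exists>dk>0. deriv (F k) 0 = complex_of_real dk \<and> deriv (G k) 0 = complex_of_real (1 / dk)" for k
    by (rule Dkp(11))
  then obtain dk where dk: "\<And>k. dk k > 0" "\<And>k. deriv (F k) 0 = complex_of_real (dk k)"
    "\<And>k. deriv (G k) 0 = complex_of_real (1 / dk k)" by metis
  \<comment> \<open>Schwarz for F k after g: the larger domain has the smaller derivative at 0.
    Hence the derivatives 1 / dk of the inverses stay above 1/d, and the limit h cannot be
    constant.\<close>
  have dk_le: "dk k \<le> d" for k
  proof -
    have sub': "g z \<in> D' k" if "cmod z < 1" for z using Dp(7)[OF that] sub by blast
    have "cmod (deriv (\<lambda>z. F k (g z)) 0) \<le> 1"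
    proof (rule Schwarz_Lemma(2)[where \<xi>=0])
      show "(\<lambda>z. F k (g z)) holomorphic_on ball 0 1"
        using holomorphic_on_compose_gen[OF Dp(4) Dkp(3)[of k]] sub' by (auto simp: o_def image_subset_iff)
    qed (use Dp Dkp sub' in auto)
    also have "deriv (\<lambda>z. F k (g z)) 0 = complex_of_real (dk k / d)"
      by (subst deriv_chain_0[OF Dp(4) Dkp(3) Dkp(1) Dp(10) Dkp(2)]) (simp add: dk d)
    finally show ?thesis using dk(1)[of k] d(1) by (simp add: norm_divide)
  qed
  have "(\<lambda>k. deriv ((G \<circ> r1) k) 0) \<longlonglongrightarrow> deriv h 0"
    by (rule deriv_tendsto_of_uniform_limit[OF _ _ _ hul]) (use Dkp(4) in auto)
  then have dlim: "(\<lambda>k. complex_of_real (1 / dk (r1 k))) \<longlonglongrightarrow> deriv h 0" by (simp add: dk)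
  have Re_h: "(\<lambda>k. 1 / dk (r1 k)) \<longlonglongrightarrow> Re (deriv h 0)" using tendsto_Re[OF dlim] by simp
  have Im_h: "Im (deriv h 0) = 0" using tendsto_Im[OF dlim] by (simp add: LIMSEQ_const_iff)
  have "1 / d \<le> 1 / dk k" for k using dk_le[of k] dk(1)[of k] by (simp add: frac_le)
  then have Re_ge: "1 / d \<le> Re (deriv h 0)" by (intro LIMSEQ_le_const[OF Re_h]) auto
  define dh where "dh = Re (deriv h 0)"
  have dh: "deriv h 0 = complex_of_real dh" "dh \<ge> 1 / d" "dh > 0"
    using Im_h Re_ge d(1) by (auto simp: dh_def complex_eq_iff intro: less_le_trans[of 0 "1/d"])
  have h0: "h 0 = 0" using hpt[of 0] Dkp(10) by (simp add: LIMSEQ_const_iff)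
  have "\<not> h constant_on ball 0 1"
  proof
    assume "h constant_on ball 0 1"
    then obtain c where c: "\<And>z. z \<in> ball 0 1 \<Longrightarrow> h z = c" unfolding constant_on_def by blast
    have "((\<lambda>z. c) has_field_derivative 0) (at (0::complex))" by simp
    then have "(h has_field_derivative 0) (at 0)"
      by (rule has_field_derivative_transform_within_open[of _ _ _ "ball 0 1"]) (auto simp: c)
    then show False using dh DERIV_imp_deriv by fastforce
  qed
  then have "open (h ` ball 0 1)"
    using open_mapping_thm[OF h, of "ball 0 1"] by auto
  \<comment> \<open>Since the domains decrease, limits of G k w lie in every closure. Together with
    openness of the image, the hypothesis \<open>ker\<close> then places the image inside D.\<close>
  moreover have "h ` ball 0 1 \<subseteq> (\<Inter>k. closure (D' k))"
  proof safe
    fix w :: complex and j assume w: "w \<in> ball 0 1"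
    show "h w \<in> closure (D' j)"
    proof (rule Lim_in_closed_set[OF closed_closure _ _ hpt[OF w]])
      have "G (r1 k) w \<in> closure (D' j)" if "k \<ge> j" for k
      proof -
        have "G (r1 k) w \<in> D' (r1 k)" using Dkp(7) w by auto
        moreover have "j \<le> r1 k" using seq_suble[OF r1, of k] that by linarith
        ultimately show ?thesis using dec closure_subset by blast
      qed
      then show "\<forall>\<^sub>F k in sequentially. G (r1 k) w \<in> closure (D' j)"
        using eventually_sequentially by blast
    qed simp
  qed
  ultimately have hD: "h ` ball 0 1 \<subseteq> D" by (rule ker)
  have fh: "(\<lambda>z. f (h z)) holomorphic_on ball 0 1"
    using holomorphic_on_compose_gen[OF h Dp(3)] hD by (auto simp: o_def)
  have fh0: "f (h 0) = 0" by (simp add: h0 Dp)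
  have fh1: "cmod (f (h z)) < 1" if "cmod z < 1" for z
    using that hD Dp(5) by (auto simp: image_subset_iff)
  have dfh: "deriv (\<lambda>z. f (h z)) 0 = complex_of_real (d * dh)"
    by (subst deriv_chain_0[OF h Dp(3,1) h0 Dp(2)]) (simp add: dh d)
  have "cmod (deriv (\<lambda>z. f (h z)) 0) \<le> 1"
    by (rule Schwarz_Lemma(2)[OF fh fh0 fh1, of 0]) auto
  then have "d * dh \<le> 1" using d(1) dh(3) by (simp add: dfh norm_mult)
  moreover have "1 \<le> d * dh" using dh(2) d(1) by (simp add: field_simps)
  ultimately have ddh: "d * dh = 1" by simp
  have "f (h z) = z" if "cmod z < 1" for z
    by (rule Schwarz_deriv_eq_1[OF fh fh0 fh1 _ that]) (simp_all add: dfh ddh del: of_real_mult)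
  then have hg: "h z = g z" if "cmod z < 1" for z using Dp(6)[of "h z"] hD that by force
  have qd: "deriv q 0 = complex_of_real d"
  proof -
    have "(\<lambda>k. deriv (F (r k)) 0) \<longlonglongrightarrow> deriv q 0"
      by (rule deriv_tendsto_of_uniform_limit[OF Dp(1,2) holomorphic_on_subset[OF Dkp(3) sub] Fr])
    then have l1: "(\<lambda>k. complex_of_real (dk (r k))) \<longlonglongrightarrow> deriv q 0" by (simp add: dk(2))
    have "(\<lambda>k. 1 / dk (r1 (r2 k))) \<longlonglongrightarrow> dh"
      using LIMSEQ_subseq_LIMSEQ[OF Re_h r2] by (simp add: o_def dh_def)
    then have "(\<lambda>k. 1 / (1 / dk (r1 (r2 k)))) \<longlonglongrightarrow> 1 / dh"
      by (rule tendsto_divide[OF tendsto_const]) (rule less_imp_neq[OF dh(3), symmetric])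
    then have l2: "(\<lambda>k. complex_of_real (dk (r k))) \<longlonglongrightarrow> complex_of_real (1 / dh)"
      unfolding tendsto_of_real_iff by (simp add: r_def)
    have "1 / dh = d" using ddh dh(3) by (simp add: field_simps)
    then show ?thesis using LIMSEQ_unique[OF l1 l2] by simp
  qed
  have qg: "(\<lambda>z. q (g z)) holomorphic_on ball 0 1"
    using holomorphic_on_compose_gen[OF Dp(4) q] Dp(7) by (auto simp: o_def image_subset_iff)
  have q0: "q 0 = 0" using qpt[OF Dp(2)] Dkp(9) by (simp add: LIMSEQ_const_iff)
  \<comment> \<open>The derivative of q at 0 is 1/dh = d and that of g is 1/d. The equality case of
    the Schwarz lemma then identifies q with f.\<close>
  have dqg: "deriv (\<lambda>z. q (g z)) 0 = 1"
    by (subst deriv_chain_0[OF Dp(4) q Dp(1) Dp(10,2)]) (use d qd in simp)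
  have qle: "cmod (q u) \<le> 1" if "u \<in> D" for u
    by (rule LIMSEQ_le_const2[OF tendsto_norm[OF qpt[OF that]]])
      (use F_HF that in \<open>auto simp: HF_def\<close>)
  have "q (g z) = z" if "cmod z < 1" for z
  proof (rule Schwarz_deriv_eq_1[OF qg _ _ dqg that])
    show "q (g 0) = 0" by (simp add: Dp q0)
    show "cmod (q (g z)) < 1" if "cmod z < 1" for z
      by (rule holomorphic_into_ball_of_cball[OF qg _ _ that]) (use qle Dp(7) dqg in auto)
  qed
  then have qf: "q u = f u" if "u \<in> D" for u using Dp(5,6)[OF that] by metis
  show ?thesis
  proof (rule that[OF r])
    show "uniform_limit K (\<lambda>k. F (r k)) f sequentially" if K: "compact K" "K \<subseteq> D" for K
      using Fr[OF K] qf K(2) uniform_limit_cong'[of K "\<lambda>k. F (r k)" "\<lambda>k. F (r k)" q f] by blast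
    fix S :: "complex set" and \<epsilon> :: real assume S: "compact S" "S \<inter> D = {}" "\<epsilon> > 0"
    \<comment> \<open>If F k u lay in this smaller disk, u = G k (F k u) would be close to the image
      of the disk under g. That image is a compact part of D and so has positive distance from
      S.\<close>
    let ?B = "cball (0::complex) (1 - \<epsilon>)"
    have Bsub: "?B \<subseteq> ball 0 1" using S(3) by auto
    have gB: "continuous_on ?B g" using holomorphic_on_imp_continuous_on[OF Dp(4)] Bsub continuous_on_subset by blast
    have "compact (g ` ?B)" by (rule compact_continuous_image[OF gB]) simp
    moreover have "g ` ?B \<inter> S = {}" using Dp(7) Bsub S(2) by (force simp: subset_iff)
    ultimately obtain \<rho> where \<rho>: "\<rho> > 0" "\<And>x y. x \<in> g ` ?B \<Longrightarrow> y \<in> S \<Longrightarrow> \<rho> \<le> dist x y"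
      using separate_compact_closed[of "g ` ?B" S] compact_imp_closed[OF S(1)] by metis
    have "uniform_limit ?B (\<lambda>k. G (r k)) h sequentially" by (rule Gr) (use Bsub in auto)
    then have "\<forall>\<^sub>F k in sequentially. \<forall>w\<in>?B. dist (G (r k) w) (h w) < \<rho>"
      using \<rho>(1) unfolding uniform_limit_iff by blast
    then show "\<forall>\<^sub>F k in sequentially. \<forall>u\<in>S \<inter> D' (r k). cmod (F (r k) u) > 1 - \<epsilon>"
    proof eventually_elim
      case (elim k)
      show ?case
      proof (intro ballI, rule ccontr)
        fix u assume u: "u \<in> S \<inter> D' (r k)" and "\<not> 1 - \<epsilon> < cmod (F (r k) u)"
        then have w: "F (r k) u \<in> ?B" by simp
        then have "dist (G (r k) (F (r k) u)) (g (F (r k) u)) < \<rho>"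
          using elim hg Bsub by force
        then have "dist (g (F (r k) u)) u < \<rho>" using Dkp(6) u by (simp add: dist_commute)
        then show False using \<rho>(2)[of "g (F (r k) u)" u] w u by force
      qed
    qed
  qed
qed

section \<open>Exterior maps of Jordan regions\<close>

lemma filterlim_affine_inverse_at_infinity:
  "filterlim (\<lambda>u::complex. a + 1 / u) at_infinity (at 0)"
proof -
  have "filterlim (\<lambda>u::complex. inverse u) at_infinity (at 0)"
    by (rule filterlim_inverse_at_infinity)
  from tendsto_add_filterlim_at_infinity[OF tendsto_const[of a] this]
  show ?thesis by (simp add: divide_inverse)
qed

lemma filterlim_inverse_affine_at_0:
  "filterlim (\<lambda>z::complex. 1 / (z - a)) (at 0) at_infinity"
  unfolding filterlim_at
proof
  have "filterlim (\<lambda>z::complex. -a + z) at_infinity at_infinity"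
    by (rule tendsto_add_filterlim_at_infinity[OF tendsto_const filterlim_ident])
  then have "filterlim (\<lambda>z::complex. z - a) at_infinity at_infinity" by simp
  then show "((\<lambda>z. 1 / (z - a)) \<longlongrightarrow> 0) at_infinity"
    by (rule tendsto_divide_0[OF tendsto_const])
  have "\<forall>\<^sub>F z in at_infinity. z \<noteq> a"
    unfolding eventually_at_infinity by (intro exI[of _ "cmod a + 1"]) auto
  then show "\<forall>\<^sub>F z in at_infinity. 1 / (z - a) \<in> UNIV \<and> 1 / (z - a) \<noteq> 0"
    by eventually_elim simp
qed

lemma exterior_map_of_riemann_pair:
  assumes f: "riemann_pair (inversion_domain a E) f g" and a: "a \<in> E"
  shows "is_exterior_map E (\<lambda>z. 1 / f (1 / (z - a)))"
proof -
  note fp = riemann_pairD[OF f]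
  let ?D = "inversion_domain a E"
  have mem: "1 / (z - a) \<in> ?D - {0}" if "z \<in> - E" for z
    using that a by (auto simp: inversion_domain_iff)
  have nz: "f u \<noteq> 0" if "u \<in> ?D - {0}" for u using that fp(6)[of u] fp(10) by force
  have "f \<circ> (\<lambda>z. 1 / (z - a)) holomorphic_on - E"
    by (rule holomorphic_on_compose_gen[OF _ fp(3)]) (use mem a in \<open>auto intro!: holomorphic_intros\<close>)
  then have "(\<lambda>z. f (1 / (z - a))) holomorphic_on - E" by (simp add: o_def)
  then have hol: "(\<lambda>z. 1 / f (1 / (z - a))) holomorphic_on - E"
    using mem nz by (intro holomorphic_intros) blast+
  have bij: "bij_betw (\<lambda>z. 1 / f (1 / (z - a))) (- E) (- cball 0 1)"
  proof (rule bij_betw_byWitness[where f'="\<lambda>w. a + 1 / g (1 / w)"])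
    show "\<forall>z\<in>- E. a + 1 / g (1 / (1 / f (1 / (z - a)))) = z"
      using mem fp(6) by auto
    show "\<forall>w\<in>- cball 0 1. 1 / f (1 / ((a + 1 / g (1 / w)) - a)) = w"
    proof
      fix w :: complex assume "w \<in> - cball 0 1"
      then have "cmod (1 / w) < 1" by (simp add: norm_divide divide_less_eq)
      then show "1 / f (1 / ((a + 1 / g (1 / w)) - a)) = w" using fp(8) by simp
    qed
    show "(\<lambda>z. 1 / f (1 / (z - a))) ` (- E) \<subseteq> - cball 0 1"
    proof clarify
      fix z assume z: "z \<notin> E" "1 / f (1 / (z - a)) \<in> cball 0 1"
      then have "f (1 / (z - a)) \<noteq> 0" "cmod (f (1 / (z - a))) < 1" using nz mem fp(5) by auto
      then show False using z(2) by (simp add: norm_divide divide_le_eq)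
    qed
    show "(\<lambda>w. a + 1 / g (1 / w)) ` (- cball 0 1) \<subseteq> - E"
    proof clarify
      fix w assume w: "w \<notin> cball 0 1" "a + 1 / g (1 / w) \<in> E"
      then have *: "cmod (1 / w) < 1" by (simp add: norm_divide divide_less_eq)
      have "w \<noteq> 0" using w by auto
      then have "g (1 / w) \<noteq> 0" using fp(8)[OF *] fp(9) by auto
      then show False using fp(7)[OF *] w(2) by (simp add: inversion_domain_def)
    qed
  qed
  obtain d where d: "d > 0" "deriv f 0 = complex_of_real d" using fp(11) by blast
  have der: "(f has_field_derivative complex_of_real d) (at 0)"
    using holomorphic_derivI[OF fp(3,1,2)] d by simp
  then have "((\<lambda>u. (f u - f 0) / (u - 0)) \<longlongrightarrow> complex_of_real d) (at 0)"
    unfolding has_field_derivative_iff .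
  then have q: "((\<lambda>u. f u / u) \<longlongrightarrow> complex_of_real d) (at 0)" by (simp add: fp(9))
  have evD: "\<forall>\<^sub>F u in at 0. u \<in> ?D - {0}"
    using fp(1,2) by (auto simp: eventually_at_topological intro!: exI[of _ ?D])
  have f0: "(f \<longlongrightarrow> 0) (at 0)"
    using DERIV_isCont[OF der] unfolding isCont_def fp(9) .
  have "filterlim (\<lambda>u. 1 / f u) at_infinity (at 0)"
  proof -
    have "filterlim f (at 0) (at 0)"
      unfolding filterlim_at using f0 evD by (auto elim: eventually_mono simp: nz)
    from filterlim_compose[OF filterlim_inverse_at_infinity this] show ?thesis by (simp add: divide_inverse)
  qed
  from filterlim_compose[OF this filterlim_inverse_affine_at_0[of a]]
  have inf: "filterlim (\<lambda>z. 1 / f (1 / (z - a))) at_infinity at_infinity" .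
  \<comment> \<open>The quotient is rewritten so that u cancels: f u / u tends to d and a u + 1
    tends to 1.\<close>
  have "((\<lambda>u. (1 / f u) / (a + 1 / u)) \<longlongrightarrow> complex_of_real (1 / d)) (at 0)"
  proof (rule Lim_transform_eventually)
    show "((\<lambda>u. 1 / ((f u / u) * (a * u + 1))) \<longlongrightarrow> complex_of_real (1 / d)) (at 0)"
    proof -
      have "((\<lambda>u. (f u / u) * (a * u + 1)) \<longlongrightarrow> complex_of_real d * (a * 0 + 1)) (at 0)"
        by (intro tendsto_intros q)
      from tendsto_divide[OF tendsto_const[of 1] this] d(1) show ?thesis by simp
    qed
    show "\<forall>\<^sub>F u in at 0. 1 / (f u / u * (a * u + 1)) = 1 / f u / (a + 1 / u)"
      using evD
    proof eventually_elim
      case (elim u)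
      then show ?case by (simp add: field_simps)
    qed
  qed
  from filterlim_compose[OF this filterlim_inverse_affine_at_0[of a]]
  have "((\<lambda>z. 1 / f (1 / (z - a)) / z) \<longlongrightarrow> complex_of_real (1 / d)) at_infinity" by simp
  then have "\<exists>c>0. ((\<lambda>z. 1 / f (1 / (z - a)) / z) \<longlongrightarrow> complex_of_real c) at_infinity"
    using d(1) by (intro exI[of _ "1 / d"]) auto
  then show ?thesis unfolding is_exterior_map_def using hol bij inf by blast
qed

text \<open>As \<open>exterior_map\<close> is an arbitrary choice, its properties have to be derived
  from \<open>is_exterior_map\<close> alone. The behaviour at infinity makes 0 a removable
  singularity and supplies the positive derivative.\<close>

lemma riemann_pair_of_exterior_map:
  assumes \<Phi>: "is_exterior_map E \<Phi>" and D: "open (inversion_domain a E)" and a: "a \<in> E"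
  obtains g where "riemann_pair (inversion_domain a E) (\<lambda>u. if u = 0 then 0 else 1 / \<Phi> (a + 1 / u)) g"
proof -
  let ?D = "inversion_domain a E"
  define f where "f u = (if u = 0 then 0 else 1 / \<Phi> (a + 1 / u))" for u
  have hol\<Phi>: "\<Phi> holomorphic_on - E" and bij: "bij_betw \<Phi> (- E) (- cball 0 1)"
    and inf: "filterlim \<Phi> at_infinity at_infinity" using \<Phi> unfolding is_exterior_map_def by auto
  obtain c where c: "c > 0" "((\<lambda>z. \<Phi> z / z) \<longlongrightarrow> complex_of_real c) at_infinity"
    using \<Phi> unfolding is_exterior_map_def by blast
  have D0: "0 \<in> ?D" by (simp add: inversion_domain_def)
  have mem: "a + 1 / u \<in> - E" if "u \<in> ?D - {0}" for u using that by (auto simp: inversion_domain_def)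
  have big: "cmod (\<Phi> z) > 1" if "z \<in> - E" for z using bij_betwE[OF bij] that by force
  have "\<Phi> \<circ> (\<lambda>u. a + 1 / u) holomorphic_on ?D - {0}"
    by (rule holomorphic_on_compose_gen[OF _ hol\<Phi>]) (use mem in \<open>auto intro!: holomorphic_intros\<close>)
  then have 1: "(\<lambda>u. \<Phi> (a + 1 / u)) holomorphic_on ?D - {0}" by (simp add: o_def)
  have nz: "\<Phi> (a + 1 / u) \<noteq> 0" if "u \<in> ?D - {0}" for u using big[OF mem[OF that]] by auto
  have "(\<lambda>u. 1 / \<Phi> (a + 1 / u)) holomorphic_on ?D - {0}"
    using 1 nz by (intro holomorphic_intros) blast+
  then have fh': "f holomorphic_on ?D - {0}"
    by (rule holomorphic_transform) (auto simp: f_def)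
  have evn: "\<forall>\<^sub>F u::complex in at 0. u \<noteq> 0" by (simp add: eventually_at_filter)
  have evD: "\<forall>\<^sub>F u in at 0. u \<in> ?D - {0}"
    using D D0 by (auto simp: eventually_at_topological intro!: exI[of _ ?D])
  have "((\<lambda>u. 1 / \<Phi> (a + 1 / u)) \<longlongrightarrow> 0) (at 0)"
    by (rule tendsto_divide_0[OF tendsto_const filterlim_compose[OF inf filterlim_affine_inverse_at_infinity]])
  then have "(f \<longlongrightarrow> 0) (at 0)"
    by (rule Lim_transform_eventually) (rule eventually_mono[OF evn], simp add: f_def)
  then have f0: "(f \<longlongrightarrow> f 0) (at 0)" by (simp add: f_def)
  have cont: "continuous_on ?D f"
    unfolding continuous_on_eq_continuous_at[OF D]
  proof
    fix u assume "u \<in> ?D"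
    show "isCont f u"
    proof (cases "u = 0")
      case True
      then show ?thesis using f0 by (simp add: isCont_def)
    next
      case False
      then show ?thesis
        using holomorphic_on_imp_continuous_on[OF fh'] \<open>u \<in> ?D\<close> D
        by (simp add: continuous_on_eq_continuous_at open_delete)
    qed
  qed
  have fh: "f holomorphic_on ?D"
    by (rule no_isolated_singularity[OF cont fh' D]) simp
  have ball: "f u \<in> ball 0 1" if "u \<in> ?D" for u
    using big[OF mem[of u]] that by (auto simp: f_def norm_divide divide_less_eq)
  have inj: "inj_on f ?D"
  proof (rule inj_onI)
    fix u v assume uv: "u \<in> ?D" "v \<in> ?D" "f u = f v"
    show "u = v"
    proof (cases "u = 0 \<or> v = 0")
      case True
      then show ?thesis using uv nz[of u] nz[of v] by (auto simp: f_def split: if_splits)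
    next
      case False
      then have "\<Phi> (a + 1 / u) = \<Phi> (a + 1 / v)" using uv(3) by (simp add: f_def)
      then have "a + 1 / u = a + 1 / v"
        using bij_betw_imp_inj_on[OF bij] mem[of u] mem[of v] uv False unfolding inj_on_def by blast
      then show ?thesis using False by (simp add: field_simps)
    qed
  qed
  have surj: "\<exists>u\<in>?D. f u = w" if "w \<in> ball 0 1" for w
  proof (cases "w = 0")
    case True
    then show ?thesis using D0 by (auto simp: f_def)
  next
    case False
    then have "1 / w \<in> - cball 0 1" using that by (simp add: norm_divide less_divide_eq)
    then obtain z where z: "z \<in> - E" "\<Phi> z = 1 / w" using bij unfolding bij_betw_def by (metis imageE)
    have "z \<noteq> a" using z(1) a by auto
    then show ?thesis using z False by (intro bexI[of _ "1 / (z - a)"]) (auto simp: f_def inversion_domain_def)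
  qed
  have img: "f ` ?D = ball 0 1"
  proof (intro equalityI subsetI)
    fix w assume "w \<in> ball (0::complex) 1"
    then obtain u where "u \<in> ?D" "f u = w" using surj by blast
    then show "w \<in> f ` ?D" by blast
  qed (use ball in blast)
  obtain g where g: "g holomorphic_on f ` ?D" "\<And>z. z \<in> ?D \<Longrightarrow> deriv f z * deriv g (f z) = 1"
      "\<And>z. z \<in> ?D \<Longrightarrow> g (f z) = z"
    using holomorphic_has_inverse[OF fh D inj] by metis
  have dlim: "((\<lambda>u. (f u - f 0) / (u - 0)) \<longlongrightarrow> complex_of_real (1 / c)) (at 0)"
  proof (rule Lim_transform_eventually)
    have "((\<lambda>u. \<Phi> (a + 1 / u) / (a + 1 / u)) \<longlongrightarrow> complex_of_real c) (at 0)"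
      by (rule filterlim_compose[OF c(2) filterlim_affine_inverse_at_infinity])
    then have "((\<lambda>u. (\<Phi> (a + 1 / u) / (a + 1 / u)) * (a * u + 1)) \<longlongrightarrow> complex_of_real c * (a * 0 + 1)) (at 0)"
      by (intro tendsto_intros)
    from tendsto_divide[OF tendsto_const[of 1] this] c(1)
    show "((\<lambda>u. 1 / ((\<Phi> (a + 1 / u) / (a + 1 / u)) * (a * u + 1))) \<longlongrightarrow> complex_of_real (1 / c)) (at 0)"
      by simp
    have "((\<lambda>u. a * u + 1) \<longlongrightarrow> 1) (at 0)" by (auto intro!: tendsto_eq_intros)
    then have "\<forall>\<^sub>F u in at 0. a * u + 1 \<noteq> 0" by (rule tendsto_imp_eventually_ne) simp
    with evD show "\<forall>\<^sub>F u in at 0. 1 / ((\<Phi> (a + 1 / u) / (a + 1 / u)) * (a * u + 1)) = (f u - f 0) / (u - 0)"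
    proof eventually_elim
      case (elim u)
      then have "u \<noteq> 0" by auto
      define s where "s = a + 1 / u"
      have su: "a * u + 1 = s * u" using \<open>u \<noteq> 0\<close> by (simp add: s_def distrib_right)
      then have "s \<noteq> 0" using elim(2) by auto
      have "\<Phi> s / s * (a * u + 1) = \<Phi> s * u" unfolding su using \<open>s \<noteq> 0\<close> by simp
      then show ?case using \<open>u \<noteq> 0\<close> by (simp add: f_def s_def)
    qed
  qed
  then have "(f has_field_derivative complex_of_real (1 / c)) (at 0)"
    unfolding has_field_derivative_iff .
  then have "deriv f 0 = complex_of_real (1 / c)" by (rule DERIV_imp_deriv)
  then have df: "\<exists>d>0. deriv f 0 = complex_of_real d" using c(1) by (intro exI[of _ "1 / c"]) simp
  have inv: "g w \<in> ?D \<and> f (g w) = w" if w: "w \<in> ball 0 1" for w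
  proof -
    obtain u where u: "u \<in> ?D" "f u = w" using surj[OF w] by blast
    then have "g w = u" using g(3) by blast
    then show ?thesis using u by blast
  qed
  have "f 0 = 0" by (simp add: f_def)
  then have "riemann_pair ?D f g"
    unfolding riemann_pair_def
  proof (intro conjI ballI)
    show "g holomorphic_on ball 0 1" using g(1) unfolding img .
    show "f z \<in> ball 0 1" "g (f z) = z" if "z \<in> ?D" for z using ball[OF that] g(3)[OF that] by simp_all
    show "g w \<in> ?D" "f (g w) = w" if "w \<in> ball 0 1" for w using inv[OF that] by simp_all
  qed (simp_all add: D D0 fh df)
  moreover have "f = (\<lambda>u. if u = 0 then 0 else 1 / \<Phi> (a + 1 / u))" by (simp add: f_def fun_eq_iff)
  ultimately show ?thesis using that[of g] by simp
qed

section \<open>Geometry of a Jordan region and approximation of its exterior map\<close>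

locale jordan_region =
  fixes p :: "real \<Rightarrow> complex" and C U E :: "complex set"
  assumes simple: "simple_path p" and loop: "pathfinish p = pathstart p"
    and C: "C = path_image p" and U: "U = inside C" and E: "E = C \<union> U"
begin

lemmas jordan = Jordan_inside_outside[OF simple loop, folded C, folded U]

lemma open_U: "open U" and connected_U: "connected U" and U_ne: "U \<noteq> {}" and bounded_U: "bounded U"
  and frontier_U: "frontier U = C" and connected_outside: "connected (outside C)"
  using jordan by auto

lemma compact_C: "compact C"
  unfolding C by (rule compact_simple_path_image[OF simple])

lemma C_Int_U: "C \<inter> U = {}"
  using inside_no_overlap[of C] unfolding U by blast

lemma closure_U: "closure U = E"
  using frontier_U open_U C_Int_U unfolding E by (metis closure_Un_frontier inf_sup_aci(5))

lemma Compl_E: "- E = outside C"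
  unfolding E U by (metis Un_commute double_complement inside_outside outside_inside union_with_inside
      union_with_outside)

lemma compact_E: "compact E"
  using closure_U bounded_U compact_closure by blast

lemma simply_connected_U: "simply_connected U"
  using simply_connected_inside_simple_path[OF simple] unfolding U C .

lemma interior_E_supset: "U \<subseteq> interior E"
  using open_U E by (simp add: interior_maximal)

text \<open>E - {a} is connected because it lies between the punctured open set U - {a} and its
  closure.\<close>

lemma inversion_domain_E:
  assumes "a \<in> U"
  shows "open (inversion_domain a E)" "bounded (inversion_domain a E)" "simply_connected (inversion_domain a E)"
proof -
  have "connected (U - {a})" using open_U connected_U by (simp add: connected_open_delete)
  moreover have "E - {a} \<subseteq> closure (U - {a})"
  proof -
    have "U - {a} \<union> {a} = U" using assms by blast
    then have "E = closure (U - {a}) \<union> {a}" by (metis closure_U closure_Un closure_closed closed_singleton)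
    then show ?thesis by blast
  qed
  moreover have "U - {a} \<subseteq> E - {a}" using E by blast
  ultimately have "connected (E - {a})" using connected_intermediate_closure by blast
  then show "open (inversion_domain a E)" "bounded (inversion_domain a E)" "simply_connected (inversion_domain a E)"
    using inversion_domain_properties[OF compact_E, of a] interior_E_supset assms connected_outside Compl_E by auto
qed

lemma is_exterior_map_exterior_map: "is_exterior_map E (exterior_map E)"
proof -
  obtain a where a: "a \<in> U" using U_ne by blast
  obtain f g where "riemann_pair (inversion_domain a E) f g"
    using riemann_pair_exists[OF inversion_domain_E(1,3,2)[OF a]] by (auto simp: inversion_domain_def)
  then have "is_exterior_map E (\<lambda>z. 1 / f (1 / (z - a)))"
    by (rule exterior_map_of_riemann_pair) (use a E in auto)
  then show ?thesis unfolding exterior_map_def using someI[of "is_exterior_map E"] by blast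
qed

text \<open>
  The compact sets \<open>K k\<close> are images of closed disks under a Riemann map of the inside; the maps
  \<open>P k\<close> are the reciprocals of the exterior maps of (a subsequence of) the \<open>K k\<close>.
\<close>

lemma exterior_map_approximation:
  obtains a K P where "a \<in> U"
    "\<And>k::nat. compact (K k)" "\<And>k. K k \<subseteq> U" 
    "\<And>k. P k holomorphic_on - K k" "\<And>k z. z \<notin> K k \<Longrightarrow> P k z \<noteq> 0 \<and> cmod (P k z) < 1"
    "\<And>S. compact S \<Longrightarrow> S \<subseteq> - E \<Longrightarrow> uniform_limit S P (\<lambda>z. 1 / exterior_map E z) sequentially"
    "\<And>\<epsilon>. \<epsilon> > 0 \<Longrightarrow> \<forall>\<^sub>F k in sequentially. \<forall>z\<in>C. cmod (P k z) > 1 - \<epsilon>"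
    "\<exists>M. \<forall>k. \<forall>z. cmod (z - a) > M \<longrightarrow> cmod (P k z) \<le> M / cmod (z - a)"
proof -
  have "U \<noteq> UNIV" using bounded_U not_bounded_UNIV by auto
  obtain \<psi> \<phi> where \<phi>: "\<psi> holomorphic_on U" "\<phi> holomorphic_on ball 0 1"
    "\<forall>z\<in>U. \<psi> z \<in> ball 0 1 \<and> \<phi> (\<psi> z) = z" "\<forall>w\<in>ball 0 1. \<phi> w \<in> U \<and> \<psi> (\<phi> w) = w"
  proof -
    have "\<exists>f g. f holomorphic_on U \<and> g holomorphic_on ball 0 1 \<and>
           (\<forall>z \<in> U. f z \<in> ball 0 1 \<and> g(f z) = z) \<and>
           (\<forall>z \<in> ball 0 1. g z \<in> U \<and> f(g z) = z)"
      using Riemann_mapping_theorem[of U] open_U simply_connected_U U_ne \<open>U \<noteq> UNIV\<close> by simp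
    then show ?thesis using that by blast
  qed
  define a where "a = \<phi> 0"
  have aU: "a \<in> U" using \<phi>(4) by (simp add: a_def)
  \<comment> \<open>Radii increasing to 1; the shift by 2 keeps the first one positive.\<close>
  define \<rho> where "\<rho> k = 1 - 1 / (real k + 2)" for k :: nat
  have \<rho>: "0 < \<rho> k" "\<rho> k < 1" for k by (simp_all add: \<rho>_def)
  have \<rho>_mono: "\<rho> j \<le> \<rho> k" if "j \<le> k" for j k using that by (simp add: \<rho>_def frac_le)
  define K where "K k = \<phi> ` cball 0 (\<rho> k)" for k
  have sub: "cball 0 (\<rho> k) \<subseteq> ball (0::complex) 1" for k using le_less_trans[OF _ \<rho>(2)] by auto
  have cont\<phi>: "continuous_on S \<phi>" if "S \<subseteq> ball 0 1" for S
    using holomorphic_on_imp_continuous_on[OF \<phi>(2)] that continuous_on_subset by blast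
  have inj\<phi>: "inj_on \<phi> S" if "S \<subseteq> ball 0 1" for S
    using \<phi>(4) that by (metis inj_on_inverseI subsetD)
  have KU: "K k \<subseteq> U" for k using \<phi>(4) sub unfolding K_def by blast
  have KE: "K k \<subseteq> E" for k using KU E by blast
  have compK: "compact (K k)" for k unfolding K_def by (intro compact_continuous_image cont\<phi> sub compact_cball)
  have K_mono: "K j \<subseteq> K k" if "j \<le> k" for j k
    unfolding K_def by (intro image_mono subset_cball \<rho>_mono that)
  have openK: "open (\<phi> ` ball 0 (\<rho> k))" for k
  proof -
    have "\<phi> ` ball 0 (\<rho> k) = U \<inter> \<psi> -` ball 0 (\<rho> k)"
    proof (intro equalityI subsetI)
      fix z assume "z \<in> \<phi> ` ball 0 (\<rho> k)"
      then obtain w where w: "w \<in> ball 0 (\<rho> k)" "z = \<phi> w" by blast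
      then have "w \<in> ball 0 1" using sub[of k] ball_subset_cball by blast
      then show "z \<in> U \<inter> \<psi> -` ball 0 (\<rho> k)" using \<phi>(4) w by simp
    next
      fix z assume z: "z \<in> U \<inter> \<psi> -` ball 0 (\<rho> k)"
      then have "z = \<phi> (\<psi> z)" using \<phi>(3) by auto
      then show "z \<in> \<phi> ` ball 0 (\<rho> k)" using z by (metis IntD2 image_eqI vimage_eq)
    qed
    moreover have "open (U \<inter> \<psi> -` ball 0 (\<rho> k))"
      by (rule continuous_open_preimage[OF holomorphic_on_imp_continuous_on[OF \<phi>(1)] open_U open_ball])
    ultimately show ?thesis by simp
  qed
  have int: "\<phi> ` ball 0 (\<rho> k) \<subseteq> interior (K k)" for k
    by (rule interior_maximal[OF _ openK]) (use ball_subset_cball in \<open>auto simp: K_def\<close>)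
  have aK: "a \<in> interior (K k)" for k
    using int[of k] \<rho>(1)[of k] by (auto simp: a_def)
  then have aK': "a \<in> K k" for k using interior_subset by blast
  have U_int: "z \<in> (\<Union>k. interior (K k))" if "z \<in> U" for z
  proof -
    have "cmod (\<psi> z) < 1" using \<phi>(3) that by auto
    then obtain n where "inverse (real (Suc n)) < 1 - cmod (\<psi> z)" using reals_Archimedean[of "1 - cmod (\<psi> z)"] by auto
    moreover have "1 / (real n + 2) \<le> inverse (real (Suc n))" by (simp add: field_simps)
    ultimately have "\<psi> z \<in> ball 0 (\<rho> n)" by (simp add: \<rho>_def)
    then have "z \<in> \<phi> ` ball 0 (\<rho> n)" using \<phi>(3) that by (metis image_eqI)
    then show ?thesis using int by blast
  qed
  have conK: "connected (- K k)" for k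
  proof (rule connected_complement_homeomorphic_convex_compact)
    have "cball (0::complex) (\<rho> k) homeomorphic K k"
      unfolding K_def
      by (rule homeomorphic_compact[where f=\<phi>]) (simp_all add: cont\<phi>[OF sub] inj\<phi>[OF sub])
    then show "K k homeomorphic cball (0::complex) (\<rho> k)" by (rule homeomorphic_sym[THEN iffD1])
  qed auto
  have conK': "connected (K k - {a})" for k
  proof -
    have "K k - {a} = \<phi> ` (cball 0 (\<rho> k) - {0})"
      unfolding K_def a_def using inj\<phi>[OF sub[of k]] \<rho>(1)[of k] 
      by (subst inj_on_image_set_diff[of \<phi> "cball 0 (\<rho> k)"]) auto
    moreover have "connected (cball (0::complex) (\<rho> k) - {0})"
      by (rule connected_punctured_convex) (use \<rho>(1)[of k] in \<open>simp_all add: aff_dim_cball\<close>)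
    ultimately show ?thesis
      using connected_continuous_image[OF cont\<phi>] sub by (metis Diff_subset order_trans)
  qed
  define D' where "D' k = inversion_domain a (K k)" for k
  let ?D = "inversion_domain a E"
  have "\<exists>F G. riemann_pair (D' k) F G" for k
  proof -
    have "0 \<in> D' k" by (simp add: D'_def inversion_domain_def)
    from riemann_pair_exists[OF inversion_domain_properties(1,3,2)[OF compK aK conK conK', folded D'_def] this]
    show ?thesis by blast
  qed
  then obtain F G where FG: "\<And>k. riemann_pair (D' k) (F k) (G k)" by metis
  define f where "f u = (if u = 0 then 0 else 1 / exterior_map E (a + 1 / u))" for u
  obtain g where g: "riemann_pair ?D f g"
    using riemann_pair_of_exterior_map[OF is_exterior_map_exterior_map inversion_domain_E(1)[OF aU]] aU E
    unfolding f_def[abs_def] by blast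
  have sub': "?D \<subseteq> D' k" for k unfolding D'_def by (rule inversion_domain_mono[OF KE])
  obtain \<delta> where \<delta>: "\<delta> > 0" "ball a \<delta> \<subseteq> K 0" using aK[of 0] mem_interior by blast
  \<comment> \<open>The interiors of the sets K k exhaust U, so V cannot meet the inversion of U. As
    V is open and E is the closure of U, it cannot meet the inversion of E either.\<close>
  have ker: "V \<subseteq> ?D" if V: "open V" "V \<subseteq> (\<Inter>k. closure (D' k))" for V
  proof
    have notU: "a + 1 / u \<notin> U" if u: "u \<in> V" "u \<noteq> 0" for u
    proof
      assume "a + 1 / u \<in> U"
      then obtain k where k: "a + 1 / u \<in> interior (K k)" using U_int by blast
      let ?W = "{u. u \<noteq> 0 \<and> a + 1 / u \<in> interior (K k)}"
      have "open ?W" by (rule open_inversion_preimage) simp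
      moreover have "?W \<inter> D' k = {}" using interior_subset[of "K k"] by (auto simp: D'_def inversion_domain_def)
      ultimately have "?W \<inter> closure (D' k) = {}" using open_Int_closure_eq_empty by blast
      then show False using k u V(2) by blast
    qed
    fix u assume u: "u \<in> V"
    show "u \<in> ?D"
    proof (rule ccontr)
      assume "u \<notin> ?D"
      then have u0: "u \<noteq> 0" and uE: "a + 1 / u \<in> E" by (auto simp: inversion_domain_def)
      have "open ((\<lambda>z. 1 / (z - a)) -` V \<inter> (- {a}))"
        by (subst Int_commute, rule continuous_open_preimage) (auto intro!: continuous_intros V)
      moreover have "a + 1 / u \<in> (\<lambda>z. 1 / (z - a)) -` V \<inter> (- {a})" using u u0 by simp
      moreover have "a + 1 / u \<in> closure U" using uE closure_U by simp
      ultimately obtain z where z: "z \<in> U" "z \<in> (\<lambda>z. 1 / (z - a)) -` V \<inter> (- {a})"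
        unfolding closure_iff_nhds_not_empty by blast
      then show False using notU[of "1 / (z - a)"] by auto
    qed
  qed
  obtain r where r: "strict_mono (r :: nat \<Rightarrow> nat)"
    "\<And>K. compact K \<Longrightarrow> K \<subseteq> ?D \<Longrightarrow> uniform_limit K (\<lambda>k. F (r k)) f sequentially"
    "\<And>S \<epsilon>. compact S \<Longrightarrow> S \<inter> ?D = {} \<Longrightarrow> \<epsilon> > 0 \<Longrightarrow>
       \<forall>\<^sub>F k in sequentially. \<forall>u\<in>S \<inter> D' (r k). cmod (F (r k) u) > 1 - \<epsilon>"
  proof (rule caratheodory_kernel_convergence[OF g FG sub' _ _ ker])
    show "D' k \<subseteq> ball 0 (2 / \<delta>)" for k
      unfolding D'_def by (rule inversion_domain_subset_ball) (use \<delta> K_mono[of 0 k] in auto)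
    show "D' k \<subseteq> D' j" if "j \<le> k" for j k
      unfolding D'_def by (rule inversion_domain_mono[OF K_mono[OF that]])
    fix r :: "nat \<Rightarrow> nat"
    assume "strict_mono r"
      "\<And>K. compact K \<Longrightarrow> K \<subseteq> ?D \<Longrightarrow> uniform_limit K (\<lambda>k. F (r k)) f sequentially"
      "\<And>S \<epsilon>. compact S \<Longrightarrow> S \<inter> ?D = {} \<Longrightarrow> \<epsilon> > 0 \<Longrightarrow>
         \<forall>\<^sub>F k in sequentially. \<forall>u\<in>S \<inter> D' (r k). cmod (F (r k) u) > 1 - \<epsilon>"
    then show thesis by (rule that[of r])
  qed
  define P where "P k z = F (r k) (1 / (z - a))" for k z
  note Fp = riemann_pairD[OF FG]
  have mem: "1 / (z - a) \<in> D' k" "1 / (z - a) \<noteq> 0" if "z \<notin> K k" for z k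
    using that aK'[of k] by (auto simp: D'_def inversion_domain_iff)
  have inv_cont: "continuous_on S (\<lambda>z. 1 / (z - a))" if "a \<notin> S" for S
    using that by (auto intro!: continuous_intros)
  show ?thesis
  proof (rule that[of a "\<lambda>k. K (r k)" P, OF aU compK KU])
    fix k
    have "F (r k) \<circ> (\<lambda>z. 1 / (z - a)) holomorphic_on - K (r k)"
      by (rule holomorphic_on_compose_gen[OF _ Fp(3)]) (use mem aK'[of "r k"] in \<open>auto intro!: holomorphic_intros\<close>)
    then show "P k holomorphic_on - K (r k)" by (simp add: P_def[abs_def] o_def)
    fix z assume "z \<notin> K (r k)"
    from mem[OF this] show "P k z \<noteq> 0 \<and> cmod (P k z) < 1"
      unfolding P_def using Fp(5,6,10) by metis
  next
    fix S :: "complex set" assume S: "compact S" "S \<subseteq> - E"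
    have aS: "a \<notin> S" using S aU E by blast
    let ?S = "(\<lambda>z. 1 / (z - a)) ` S"
    have "compact ?S" by (rule compact_continuous_image[OF inv_cont[OF aS] S(1)])
    moreover have "?S \<subseteq> ?D" using S(2) aU E by (auto simp: inversion_domain_iff)
    ultimately have "uniform_limit ?S (\<lambda>k. F (r k)) f sequentially" by (rule r(2))
    moreover have "f (1 / (z - a)) = 1 / exterior_map E z" if "z \<in> S" for z
      using that aS by (auto simp: f_def)
    ultimately show "uniform_limit S P (\<lambda>z. 1 / exterior_map E z) sequentially"
      unfolding uniform_limit_iff P_def by (simp add: ball_simps)
  next
    fix \<epsilon> :: real assume "\<epsilon> > 0"
    have aC: "a \<notin> C" using aU C_Int_U by blast
    let ?S = "(\<lambda>z. 1 / (z - a)) ` C"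
    have "compact ?S" by (rule compact_continuous_image[OF inv_cont[OF aC] compact_C])
    moreover have "?S \<inter> ?D = {}" using E aU aC by (auto simp: inversion_domain_iff)
    ultimately have "\<forall>\<^sub>F k in sequentially. \<forall>u\<in>?S \<inter> D' (r k). cmod (F (r k) u) > 1 - \<epsilon>"
      using r(3) \<open>\<epsilon> > 0\<close> by blast
    then show "\<forall>\<^sub>F k in sequentially. \<forall>z\<in>C. cmod (P k z) > 1 - \<epsilon>"
    proof eventually_elim
      case (elim k)
      show ?case
      proof
        fix z assume "z \<in> C"
        then have "z \<notin> K (r k)" using KU C_Int_U by blast
        from mem(1)[OF this] show "1 - \<epsilon> < cmod (P k z)" using elim \<open>z \<in> C\<close> by (auto simp: P_def)
      qed
    qed
  next
    obtain \<eta> where \<eta>: "\<eta> > 0" "ball 0 \<eta> \<subseteq> ?D" 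
      using ball_subset_inversion_domain compact_imp_bounded[OF compact_E] by blast
    \<comment> \<open>One ball about 0 lies in all the domains, so the rescaled Schwarz lemma gives
      a bound uniform in k. In the original coordinate this is the common decay at infinity.\<close>
    have Schw: "cmod (F k u) \<le> cmod u / \<eta>" if "cmod u < \<eta>" for k u
    proof -
      have sub2: "complex_of_real \<eta> * z \<in> D' k" if "cmod z < 1" for z
      proof -
        have "complex_of_real \<eta> * z \<in> ball 0 \<eta>" using that \<eta>(1) by (simp add: norm_mult)
        then show ?thesis using \<eta>(2) sub' by blast
      qed
      have "F k \<circ> (\<lambda>z. complex_of_real \<eta> * z) holomorphic_on ball 0 1"
        by (rule holomorphic_on_compose_gen[OF _ Fp(3)[of k]]) (use sub2 in \<open>auto intro!: holomorphic_intros\<close>)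
      then have "cmod ((F k \<circ> (\<lambda>z. complex_of_real \<eta> * z)) (u / \<eta>)) \<le> cmod (u / \<eta>)"
        by (rule Schwarz_Lemma(1)) (use Fp sub2 that \<eta> in \<open>auto simp: norm_divide\<close>)
      then show ?thesis using \<eta>(1) by (simp add: norm_divide)
    qed
    show "\<exists>M. \<forall>k. \<forall>z. cmod (z - a) > M \<longrightarrow> cmod (P k z) \<le> M / cmod (z - a)"
    proof (intro exI[of _ "1 / \<eta>"] allI impI)
      fix k z assume z: "1 / \<eta> < cmod (z - a)"
      have "0 < cmod (z - a)" using z \<eta>(1) by (meson divide_pos_pos less_trans zero_less_one)
      then have "cmod (1 / (z - a)) < \<eta>" using z \<eta>(1) by (simp add: norm_divide field_simps)
      from Schw[OF this, of "r k"] show "cmod (P k z) \<le> 1 / \<eta> / cmod (z - a)"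
        by (simp add: P_def norm_divide mult.commute)
    qed
  qed
qed

end

section \<open>Integrals along Lipschitz loops\<close>

text \<open>Appending s and t to a partition of [0, s] gives a partition of [0, t], so length s plus
  the chord is at most length t.\<close>

lemma dist_le_of_arc_length:
  assumes len: "\<And>s. s \<in> {0..L} \<Longrightarrow> arc_length \<sigma> 0 s = ennreal s"
    and st: "0 \<le> s" "s \<le> t" "t \<le> L"
  shows "dist (\<sigma> s) (\<sigma> t) \<le> t - s"
proof -
  let ?T = "\<lambda>s. {ts. sorted ts \<and> set ts \<subseteq> {0..s::real}}"
  let ?V = "\<lambda>ts. \<Sum>i<length ts - 1. ennreal (dist (\<sigma> (ts ! i)) (\<sigma> (ts ! Suc i)))"
  have "?V ts + ennreal (dist (\<sigma> s) (\<sigma> t)) \<le> ennreal t" if ts: "ts \<in> ?T s" for ts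
  proof -
    let ?ts = "ts @ [s, t]"
    let ?f = "\<lambda>i. ennreal (dist (\<sigma> (?ts ! i)) (\<sigma> (?ts ! Suc i)))"
    have "?V ts = (\<Sum>i<length ts - 1. ?f i)"
    proof (rule sum.cong[OF refl])
      fix i assume "i \<in> {..<length ts - 1}"
      then have "i < length ts" "Suc i < length ts" by auto
      then show "ennreal (dist (\<sigma> (ts ! i)) (\<sigma> (ts ! Suc i))) = ?f i" by (simp add: nth_append)
    qed
    moreover have "ennreal (dist (\<sigma> s) (\<sigma> t)) = ?f (length ts)" by (simp add: nth_append)
    \<comment> \<open>The extended list also has a link from the last entry of \<open>ts\<close> to
      s. Dropping it only lowers the sum and spares a case distinction for the empty list.\<close>
    ultimately have "?V ts + ennreal (dist (\<sigma> s) (\<sigma> t)) = (\<Sum>i\<in>insert (length ts) {..<length ts - 1}. ?f i)"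
      by (subst sum.insert) (auto simp: add.commute)
    also have "\<dots> \<le> (\<Sum>i<length ?ts - 1. ?f i)"
      by (rule sum_mono2) auto
    also have "\<dots> \<le> arc_length \<sigma> 0 t"
      unfolding arc_length_def
    proof (rule SUP_upper)
      show "?ts \<in> ?T t" using ts st by (fastforce simp: sorted_append)
    qed
    also have "\<dots> = ennreal t" using len[of t] st by simp
    finally show ?thesis .
  qed
  then have "(SUP ts\<in>?T s. ?V ts + ennreal (dist (\<sigma> s) (\<sigma> t))) \<le> ennreal t"
    by (rule SUP_least)
  moreover have "(SUP ts\<in>?T s. ?V ts + ennreal (dist (\<sigma> s) (\<sigma> t))) = (SUP ts\<in>?T s. ?V ts) + ennreal (dist (\<sigma> s) (\<sigma> t))"
    by (rule ennreal_SUP_add_left) (auto intro!: exI[of _ "[]"])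
  moreover have "(SUP ts\<in>?T s. ?V ts) = ennreal s"
    using len[of s] st by (simp add: arc_length_def)
  ultimately have "ennreal s + ennreal (dist (\<sigma> s) (\<sigma> t)) \<le> ennreal t" by simp
  then have "ennreal (s + dist (\<sigma> s) (\<sigma> t)) \<le> ennreal t" using st by (simp add: ennreal_plus)
  then show ?thesis using st by (subst (asm) ennreal_le_iff) auto
qed

text \<open>The global Cauchy theorem concerns one closed path, so p and the reverse of q are joined
  along a connecting path and back. The set T guarantees that such a path exists inside
  \<Omega>.\<close>

lemma contour_integral_homologous:
  assumes \<Omega>: "open \<Omega>" and H: "H holomorphic_on \<Omega>"
    and p: "valid_path p" "pathfinish p = pathstart p" "path_image p \<subseteq> \<Omega>"
    and q: "valid_path q" "pathfinish q = pathstart q" "path_image q \<subseteq> \<Omega>"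
    and wn: "\<And>w. w \<notin> \<Omega> \<Longrightarrow> winding_number p w = winding_number q w"
    and T: "connected T" "T \<subseteq> \<Omega>" "pathstart p \<in> T" "pathstart q \<in> T"
  shows "contour_integral p H = contour_integral q H"
proof -
  let ?W = "connected_component_set \<Omega> (pathstart p)"
  have "T \<subseteq> ?W" using T by (intro connected_component_maximal)
  then have "pathstart p \<in> ?W" "pathstart q \<in> ?W" using T by auto
  then obtain g where g: "polynomial_function g" "path_image g \<subseteq> ?W" "pathstart g = pathstart p" "pathfinish g = pathstart q"
    using connected_open_polynomial_connected[OF open_connected_component[OF \<Omega>] connected_connected_component]
    by blast
  have gv: "valid_path g" using g(1) by (rule valid_path_polynomial_function)
  have g\<Omega>: "path_image g \<subseteq> \<Omega>" using g(2) connected_component_subset by blast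
  define \<gamma> where "\<gamma> = p +++ (g +++ (reversepath q +++ reversepath g))"
  have v: "valid_path (reversepath q)" "valid_path (reversepath g)" using q gv by (simp_all add: valid_path_imp_reverse)
  have \<gamma>v: "valid_path \<gamma>" unfolding \<gamma>_def
    using p q g gv v by (intro valid_path_join) auto
  have int: "H contour_integrable_on r" if "valid_path r" "path_image r \<subseteq> \<Omega>" for r
    by (rule contour_integrable_holomorphic_simple[OF H \<Omega> that])
  have "(H has_contour_integral 0) \<gamma>"
  proof (rule Cauchy_theorem_global[OF \<Omega> H \<gamma>v])
    show "pathfinish \<gamma> = pathstart \<gamma>" using g by (simp add: \<gamma>_def)
    show "path_image \<gamma> \<subseteq> \<Omega>" unfolding \<gamma>_def 
      using p q g g\<Omega> by (simp add: path_image_join)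
    fix w assume w: "w \<notin> \<Omega>"
    have n: "w \<notin> path_image p" "w \<notin> path_image q" "w \<notin> path_image g" using w p q g\<Omega> by auto
    have pt: "path p" "path q" "path g" using p q gv valid_path_imp_path by auto
    show "winding_number \<gamma> w = 0"
      unfolding \<gamma>_def using n pt p q g wn[OF w]
      by (simp add: winding_number_join not_in_path_image_join winding_number_reversepath path_image_join)
  qed
  then have "contour_integral \<gamma> H = 0" by (rule contour_integral_unique)
  moreover have "contour_integral \<gamma> H = contour_integral p H + (contour_integral g H + (- contour_integral q H + - contour_integral g H))"
  proof -
    have i: "H contour_integrable_on p" "H contour_integrable_on q" "H contour_integrable_on g"
      using int p q gv g\<Omega> by auto
    have ir: "H contour_integrable_on reversepath q" "H contour_integrable_on reversepath g"
      using i q gv by (simp_all add: contour_integrable_reversepath)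
    show ?thesis unfolding \<gamma>_def
      using p q g gv v i ir
      by (simp add: contour_integral_join contour_integrable_join contour_integral_reversepath valid_path_join)
  qed
  ultimately show ?thesis by simp
qed

lemma norm_scaleR_inverse_le_1:
  fixes x :: "'a::real_normed_vector"
  assumes "norm x \<le> q" "q > 0" shows "norm (x /\<^sub>R q) \<le> 1"
  using assms by (simp add: divide_inverse[symmetric] mult.commute[of "inverse q"])

text \<open>The factor c is needed because both ends of a smoothing window move: relative to the
  point L t they sit at t h and (t - 1) h.\<close>

lemma has_vector_derivative_scaled_quotient:
  fixes f :: "real \<Rightarrow> 'a::real_normed_vector"
  assumes D: "(f has_vector_derivative D) (at s)" and h: "h \<longlonglongrightarrow> 0" "\<And>k::nat. h k > 0"
  shows "(\<lambda>k. (f (s + c * h k) - f s) /\<^sub>R h k) \<longlonglongrightarrow> c *\<^sub>R D"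
proof (cases "c = 0")
  case False
  have "((\<lambda>y. (1 / norm (y - s)) *\<^sub>R (f y - (f s + (y - s) *\<^sub>R D))) \<longlongrightarrow> 0) (at s)"
    using D unfolding has_vector_derivative_def has_derivative_within by simp
  moreover have "filterlim (\<lambda>k. s + c * h k) (at s) sequentially"
    unfolding filterlim_at
  proof
    show "(\<lambda>k. s + c * h k) \<longlonglongrightarrow> s" using tendsto_add[OF tendsto_const tendsto_mult[OF tendsto_const h(1)]] by simp
    show "\<forall>\<^sub>F k in sequentially. s + c * h k \<in> UNIV \<and> s + c * h k \<noteq> s"
      using False h(2) by (auto simp: less_imp_neq[symmetric])
  qed
  ultimately have "(\<lambda>k. (1 / norm ((s + c * h k) - s)) *\<^sub>R (f (s + c * h k) - (f s + ((s + c * h k) - s) *\<^sub>R D))) \<longlonglongrightarrow> 0"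
    by (rule filterlim_compose)
  from tendsto_scaleR[OF tendsto_const[of "\<bar>c\<bar>"] this]
  have "(\<lambda>k. \<bar>c\<bar> *\<^sub>R (1 / norm ((s + c * h k) - s)) *\<^sub>R (f (s + c * h k) - (f s + ((s + c * h k) - s) *\<^sub>R D))) \<longlonglongrightarrow> 0"
    by simp
  moreover have "\<bar>c\<bar> *\<^sub>R (1 / norm ((s + c * h k) - s)) *\<^sub>R (f (s + c * h k) - (f s + ((s + c * h k) - s) *\<^sub>R D))
      = (f (s + c * h k) - f s) /\<^sub>R h k - c *\<^sub>R D" for k
  proof -
    have n: "norm ((s + c * h k) - s) = \<bar>c\<bar> * h k" using h(2)[of k] by (simp add: abs_mult)
    have c: "\<bar>c\<bar> * (1 / (\<bar>c\<bar> * h k)) = inverse (h k)" using False by (simp add: divide_inverse)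
    have e: "(s + c * h k) - s = c * h k" and i: "inverse (h k) * (c * h k) = c" using h(2)[of k] by simp_all
    show ?thesis unfolding n scaleR_scaleR c unfolding e
      by (simp add: scaleR_diff_right scaleR_add_right i del: inverse_eq_divide)
  qed
  ultimately have "(\<lambda>k. (f (s + c * h k) - f s) /\<^sub>R h k - c *\<^sub>R D) \<longlonglongrightarrow> 0" by simp
  then show ?thesis by (simp add: LIM_zero_iff)
qed simp

locale lipschitz_loop =
  fixes L :: real and \<sigma> :: "real \<Rightarrow> complex"
  assumes L: "L > 0" and endpoints: "\<sigma> L = \<sigma> 0"
    and lip: "\<And>s t. \<lbrakk>0 \<le> s; s \<le> t; t \<le> L\<rbrakk> \<Longrightarrow> dist (\<sigma> s) (\<sigma> t) \<le> t - s"
begin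

text \<open>A constant extension beyond both endpoints: windows may overhang the interval, and the
  Lipschitz constant is kept.\<close>

definition \<tau> where "\<tau> s = \<sigma> (max 0 (min L s))"

definition V where "V s = vector_derivative \<sigma> (at s within {0..L})"

definition bad where "bad = {s. \<not> \<tau> differentiable (at s)} \<union> {0, L}"

lemma \<tau>_lip: "norm (\<tau> s - \<tau> t) \<le> \<bar>s - t\<bar>"
proof -
  have *: "norm (\<tau> s - \<tau> t) \<le> \<bar>s - t\<bar>" if "s \<le> t" for s t
  proof -
    have "dist (\<tau> s) (\<tau> t) \<le> max 0 (min L t) - max 0 (min L s)"
      unfolding \<tau>_def using that L by (intro lip) auto
    also have "\<dots> \<le> t - s" using that by (auto simp: max_def min_def)
    finally show ?thesis using that by (simp add: dist_norm)
  qed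
  show ?thesis using *[of s t] *[of t s] by (cases "s \<le> t") (simp_all add: norm_minus_commute abs_minus_commute)
qed

lemma \<tau>_eq: "s \<in> {0..L} \<Longrightarrow> \<tau> s = \<sigma> s"
  by (simp add: \<tau>_def)

lemma \<tau>_lipschitz: "1-lipschitz_on UNIV \<tau>"
  by (rule lipschitz_onI) (use \<tau>_lip in \<open>simp_all add: dist_norm\<close>)

lemma \<tau>_continuous: "continuous_on S \<tau>"
  using lipschitz_on_continuous_on[OF \<tau>_lipschitz] continuous_on_subset by blast

lemma \<sigma>_continuous: "continuous_on {0..L} \<sigma>"
  using \<tau>_continuous by (rule continuous_on_eq) (rule \<tau>_eq)

lemma negligible_bad: "negligible bad"
  unfolding bad_def using lipschitz_differentiable_AE[OF \<tau>_lipschitz]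
  by (intro negligible_Un) (auto intro: negligible_finite)

lemma V_derivative:
  assumes "s \<in> {0..L}" "s \<notin> bad"
  shows "(\<tau> has_vector_derivative V s) (at s)"
proof -
  have "\<tau> differentiable (at s)" using assms(2) by (simp add: bad_def)
  then obtain D where D: "(\<tau> has_vector_derivative D) (at s)"
    using vector_derivative_works by blast
  then have "(\<tau> has_vector_derivative D) (at s within {0..L})"
    by (rule has_vector_derivative_at_within)
  then have "(\<sigma> has_vector_derivative D) (at s within {0..L})"
    by (rule has_vector_derivative_transform[OF assms(1), rotated]) (simp add: \<tau>_eq)
  then have "V s = D" unfolding V_def
    by (rule vector_derivative_within_closed_interval[OF L assms(1)])
  then show ?thesis using D by simp
qed

lemma norm_V_le:
  assumes "s \<in> {0..L}" "s \<notin> bad"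
  shows "norm (V s) \<le> 1"
proof -
  have "(\<lambda>k. (\<tau> (s + 1 * (1 / real (Suc k))) - \<tau> s) /\<^sub>R (1 / real (Suc k))) \<longlonglongrightarrow> 1 *\<^sub>R V s"
    by (rule has_vector_derivative_scaled_quotient[OF V_derivative[OF assms] LIMSEQ_Suc[OF lim_1_over_n]]) simp
  then have "(\<lambda>k. norm ((\<tau> (s + 1 * (1 / real (Suc k))) - \<tau> s) /\<^sub>R (1 / real (Suc k)))) \<longlonglongrightarrow> norm (V s)"
    by (intro tendsto_norm) simp
  moreover have "norm ((\<tau> (s + 1 * (1 / real (Suc k))) - \<tau> s) /\<^sub>R (1 / real (Suc k))) \<le> 1" for k
  proof -
    have q: "1 / real (Suc k) > 0" by simp
    from norm_scaleR_inverse_le_1[OF _ q] show ?thesis using \<tau>_lip[of "s + 1 * (1 / real (Suc k))" s] by simp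
  qed
  ultimately show ?thesis by (intro LIMSEQ_le_const2) auto
qed

text \<open>
  The mean of \<open>\<tau>\<close> over a window of length \<open>h\<close> whose position slides from \<open>[-h, 0]\<close> to \<open>[L, L + h]\<close>:
  a closed \<open>C\<^sup>1\<close> path within \<open>h\<close> of \<open>\<sigma>\<close>, whose derivative is a difference quotient of \<open>\<tau>\<close>.
\<close>

definition base where "base h t = L * t - h * (1 - t)"

definition smooth where "smooth h t = integral {base h t..base h t + h} \<tau> /\<^sub>R h"

definition smooth' where
  "smooth' h t = (L + h) *\<^sub>R ((\<tau> (base h t + h) - \<tau> (base h t)) /\<^sub>R h)"

text \<open>The window reaches from L t - h (1 - t) to L t + h t, so all its points are within h of
  L t.\<close>

lemma smooth_near:
  assumes h: "0 < h" and t: "t \<in> {0..1}"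
  shows "norm (smooth h t - \<sigma> (L * t)) \<le> h"
proof -
  let ?b = "base h t"
  have Lt: "L * t \<in> {0..L}" using t L by (auto simp: mult_left_le)
  have bt: "\<bar>u - L * t\<bar> \<le> h" if "u \<in> {?b..?b + h}" for u
  proof -
    have "0 \<le> h * t" "h * t \<le> h" using t h by (auto simp: mult_left_le)
    then show ?thesis using that by (auto simp: base_def abs_le_iff algebra_simps)
  qed
  have "integral {?b..?b + h} (\<lambda>u. \<tau> u - \<tau> (L * t)) = integral {?b..?b + h} \<tau> - h *\<^sub>R \<tau> (L * t)"
    using h by (subst integral_diff) (auto intro!: integrable_continuous_interval \<tau>_continuous)
  then have "smooth h t - \<tau> (L * t) = integral {?b..?b + h} (\<lambda>u. \<tau> u - \<tau> (L * t)) /\<^sub>R h"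
    using h by (simp add: smooth_def scaleR_diff_right)
  moreover have "norm (integral {?b..?b + h} (\<lambda>u. \<tau> u - \<tau> (L * t))) \<le> h * (?b + h - ?b)"
  proof (rule integral_bound)
    show "norm (\<tau> u - \<tau> (L * t)) \<le> h" if "u \<in> {?b..?b + h}" for u
      using \<tau>_lip[of u "L * t"] bt[OF that] by linarith
  qed (use h in \<open>auto intro!: continuous_intros \<tau>_continuous\<close>)
  ultimately show ?thesis using h \<tau>_eq[OF Lt] by (simp add: field_simps)
qed

text \<open>The first and the last window lie entirely outside the open interval, where \<tau> is
  constant, so the smoothed path closes up exactly.\<close>

lemma smooth_endpoints:
  assumes h: "0 < h"
  shows "smooth h 0 = \<sigma> 0" "smooth h 1 = \<sigma> 0"
proof -
  have "integral {-h..0} \<tau> = integral {-h..0} (\<lambda>_. \<sigma> 0)"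
    by (rule integral_cong) (use L in \<open>auto simp: \<tau>_def\<close>)
  then show "smooth h 0 = \<sigma> 0" using h by (simp add: smooth_def base_def)
  have "integral {L..L + h} \<tau> = integral {L..L + h} (\<lambda>_. \<sigma> L)"
    by (rule integral_cong) (use L in \<open>auto simp: \<tau>_def\<close>)
  then show "smooth h 1 = \<sigma> 0" using h endpoints by (simp add: smooth_def base_def)
qed

lemma smooth_derivative:
  assumes h: "0 < h" "h < 1" and t: "t \<in> {0..1}"
  shows "(smooth h has_vector_derivative smooth' h t) (at t)"
proof -
  \<comment> \<open>Ample room: for h < 1 every window lies in the interior of this interval, so the
    antiderivative S is differentiable wherever it is evaluated.\<close>
  let ?I = "{- 2..L + 2}"
  define S where "S u = integral {- 2..u} \<tau>" for u
  have S: "(S has_vector_derivative \<tau> u) (at u)" if "u \<in> {- 2<..<L + 2}" for u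
  proof -
    have "(S has_vector_derivative \<tau> u) (at u within ?I)"
      unfolding S_def using that by (intro integral_has_vector_derivative \<tau>_continuous) auto
    moreover have "at u within ?I = at u"
      by (rule at_within_interior) (use that in simp)
    ultimately show ?thesis by simp
  qed
  have b: "- h \<le> base h t" "base h t \<le> L"
  proof -
    have "0 \<le> (L + h) * t" "(L + h) * t \<le> L + h" using t L h by (auto simp: mult_left_le)
    then show "- h \<le> base h t" "base h t \<le> L" by (auto simp: base_def algebra_simps)
  qed
  have base': "(base h has_vector_derivative (L + h)) (at t)"
    unfolding base_def[abs_def]
    by (auto intro!: derivative_eq_intros simp: has_real_derivative_iff_has_vector_derivative[symmetric])
  have 1: "((S \<circ> base h) has_vector_derivative (L + h) *\<^sub>R \<tau> (base h t)) (at t)"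
    by (rule vector_diff_chain_at[OF base' S]) (use b h in auto)
  have base'': "((\<lambda>t. base h t + h) has_vector_derivative (L + h)) (at t)"
    using has_vector_derivative_add[OF base' has_vector_derivative_const[of h]] by simp
  have 2: "((S \<circ> (\<lambda>t. base h t + h)) has_vector_derivative (L + h) *\<^sub>R \<tau> (base h t + h)) (at t)"
    by (rule vector_diff_chain_at[OF base'' S]) (use b h in auto)
  have 3: "((\<lambda>t. (S (base h t + h) - S (base h t)) /\<^sub>R h) has_vector_derivative smooth' h t) (at t)"
    using bounded_linear.has_vector_derivative[OF bounded_linear_scaleR_right has_vector_derivative_diff[OF 2 1], of "inverse h"]
    by (simp add: o_def smooth'_def scaleR_diff_right mult.commute)
  have "continuous_on UNIV (base h)" unfolding base_def[abs_def] by (intro continuous_intros)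
  then have op: "open (base h -` {- 2<..<L + 1})" by (rule open_vimage[rotated]) simp
  show ?thesis
  proof (rule has_vector_derivative_transform_within_open[OF 3 op])
    show "t \<in> base h -` {- 2<..<L + 1}" using b h by auto
    fix u assume "u \<in> base h -` {- 2<..<L + 1}"
    then have u: "- 2 \<le> base h u" "base h u \<le> base h u + h" using h by auto
    have "S (base h u) + integral {base h u..base h u + h} \<tau> = S (base h u + h)"
      unfolding S_def
      by (rule Henstock_Kurzweil_Integration.integral_combine[OF u])
        (intro integrable_continuous_interval \<tau>_continuous)
    then have "integral {base h u..base h u + h} \<tau> = S (base h u + h) - S (base h u)"
      by (simp add: algebra_simps)
    then show "(S (base h u + h) - S (base h u)) /\<^sub>R h = smooth h u" by (simp add: smooth_def)
  qed
qed

lemma smooth_valid_path: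
  assumes h: "0 < h" "h < 1"
  shows "valid_path (smooth h)"
proof -
  have "continuous_on {0..1} (smooth' h)"
    unfolding smooth'_def[abs_def] base_def
    by (intro continuous_intros continuous_on_compose2[OF \<tau>_continuous[of UNIV]]) auto
  then have "smooth h C1_differentiable_on {0..1}"
    unfolding C1_differentiable_on_def using smooth_derivative[OF h] by blast
  then show ?thesis
    unfolding valid_path_def by (rule C1_differentiable_imp_piecewise)
qed

text \<open>Each smoothed loop is \<C>^1, stays in \<Omega> and has the winding numbers of \<sigma>,
  so its contour integral is already that over q. As h tends to 0 the integrands converge off a null
  set and are dominated by a constant.\<close>

theorem loop_integral_eq:
  assumes \<Omega>: "open \<Omega>" "\<sigma> ` {0..L} \<subseteq> \<Omega>" and H: "H holomorphic_on \<Omega>"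
    and q: "valid_path q" "pathfinish q = pathstart q" "path_image q \<subseteq> \<Omega>"
    and wn: "\<And>w. w \<notin> \<Omega> \<Longrightarrow> winding_number (\<lambda>t. \<sigma> (L * t)) w = winding_number q w"
    and T: "connected T" "T \<subseteq> \<Omega>" "\<sigma> 0 \<in> T" "pathstart q \<in> T"
  shows "((\<lambda>s. H (\<sigma> s) * V s) has_integral contour_integral q H) {0..L}"
proof -
  have compK: "compact (\<sigma> ` {0..L})" by (rule compact_continuous_image[OF \<sigma>_continuous]) simp
  obtain \<epsilon> where \<epsilon>: "\<epsilon> > 0" "(\<Union>x\<in>\<sigma> ` {0..L}. ball x \<epsilon>) \<subseteq> \<Omega>"
    using compact_subset_open_imp_ball_epsilon_subset[OF compK \<Omega>(1,2)] by blast
  define K where "K = {x + y |x y. x \<in> \<sigma> ` {0..L} \<and> y \<in> cball 0 (\<epsilon> / 2)}"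
  have "compact K" unfolding K_def by (rule compact_sums[OF compK compact_cball])
  have "K \<subseteq> \<Omega>"
  proof
    fix z assume "z \<in> K"
    then obtain x y where "x \<in> \<sigma> ` {0..L}" "norm y \<le> \<epsilon> / 2" "z = x + y" by (auto simp: K_def)
    then have "z \<in> ball x \<epsilon>" using \<epsilon>(1) by (simp add: dist_norm)
    then show "z \<in> \<Omega>" using \<epsilon>(2) \<open>x \<in> _\<close> by blast
  qed
  have "compact (H ` K)"
    using \<open>compact K\<close> \<open>K \<subseteq> \<Omega>\<close> holomorphic_on_imp_continuous_on[OF H]
    by (meson compact_continuous_image continuous_on_subset)
  then obtain B where B: "B > 0" "\<And>z. z \<in> K \<Longrightarrow> norm (H z) \<le> B"
    using compact_imp_bounded bounded_pos by (metis imageI)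
  \<comment> \<open>Below 1 for the derivative of the smoothing, and at most \<epsilon>/2 so that
    the smoothed loops stay in the compact set K.\<close>
  define \<delta> where "\<delta> = min 1 (\<epsilon> / 2) / 2"
  have \<delta>: "\<delta> > 0" "\<delta> < 1" "\<delta> \<le> \<epsilon> / 2" using \<epsilon>(1) by (auto simp: \<delta>_def)
  define h where "h k = \<delta> / real (Suc k)" for k
  have h0: "h k > 0" for k using \<delta> by (simp add: h_def)
  have h\<delta>: "h k \<le> \<delta>" for k
  proof -
    have "\<delta> \<le> \<delta> * real (Suc k)" using \<delta>(1) by simp
    then show ?thesis by (simp add: h_def divide_le_eq del: of_nat_Suc)
  qed
  have h1: "h k < 1" for k using h\<delta>[of k] \<delta> by linarith
  have hlim: "h \<longlonglongrightarrow> 0"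
    using tendsto_mult[OF tendsto_const[of \<delta>] LIMSEQ_Suc[OF lim_1_over_n]] by (simp add: h_def[abs_def])
  have pathL: "path (\<lambda>t. \<sigma> (L * t))"
    unfolding path_def
    by (rule continuous_on_compose2[OF \<sigma>_continuous]) (use L in \<open>auto intro!: continuous_intros simp: mult_left_le\<close>)
  have inL: "L * t \<in> {0..L}" if "t \<in> {0..1}" for t using that L by (auto simp: mult_left_le)
  have pK: "smooth (h k) t \<in> K" if "t \<in> {0..1}" for k t
  proof -
    have "norm (smooth (h k) t - \<sigma> (L * t)) \<le> \<epsilon> / 2"
      using smooth_near[OF h0[of k] that] h\<delta>[of k] \<delta> by linarith
    then show ?thesis unfolding K_def using inL[OF that]
      by (intro CollectI exI[of _ "\<sigma> (L * t)"] exI[of _ "smooth (h k) t - \<sigma> (L * t)"]) auto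
  qed
  have ci: "contour_integral (smooth (h k)) H = contour_integral q H" for k
  proof (rule contour_integral_homologous[OF \<Omega>(1) H smooth_valid_path[OF h0 h1] _ _ q _ T(1,2)])
    show "pathfinish (smooth (h k)) = pathstart (smooth (h k))"
      using smooth_endpoints[OF h0[of k]] by (simp add: pathfinish_def pathstart_def)
    show "path_image (smooth (h k)) \<subseteq> \<Omega>" using pK \<open>K \<subseteq> \<Omega>\<close> by (auto simp: path_image_def)
    show "pathstart (smooth (h k)) \<in> T" using smooth_endpoints(1)[OF h0[of k]] T(3) by (simp add: pathstart_def)
    show "pathstart q \<in> T" by (rule T(4))
    fix w assume w: "w \<notin> \<Omega>"
    have "winding_number (smooth (h k)) w = winding_number (\<lambda>t. \<sigma> (L * t)) w"
    proof (rule winding_number_nearby_loops_eq[OF pathL])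
      show "path (smooth (h k))" by (rule valid_path_imp_path[OF smooth_valid_path[OF h0 h1]])
      show "pathfinish (\<lambda>t. \<sigma> (L * t)) = pathstart (\<lambda>t. \<sigma> (L * t))" by (simp add: pathfinish_def pathstart_def endpoints)
      show "pathfinish (smooth (h k)) = pathstart (smooth (h k))"
        using smooth_endpoints[OF h0[of k]] by (simp add: pathfinish_def pathstart_def)
      fix t :: real assume t: "t \<in> {0..1}"
      have "w \<notin> ball (\<sigma> (L * t)) \<epsilon>" using w \<epsilon>(2) inL[OF t] by blast
      then have "\<epsilon> \<le> norm (\<sigma> (L * t) - w)" by (simp add: dist_norm)
      then show "norm (smooth (h k) t - \<sigma> (L * t)) < norm (\<sigma> (L * t) - w)"
        using smooth_near[OF h0[of k] t] h\<delta>[of k] \<delta> by linarith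
    qed
    then show "winding_number (smooth (h k)) w = winding_number q w" using wn[OF w] by simp
  qed
  have hi: "((\<lambda>t. H (smooth (h k) t) * smooth' (h k) t) has_integral contour_integral q H) {0..1}" for k
  proof -
    have "H contour_integrable_on (smooth (h k))"
      by (rule contour_integrable_holomorphic_simple[OF H \<Omega>(1) smooth_valid_path[OF h0 h1]])
        (use pK \<open>K \<subseteq> \<Omega>\<close> in \<open>auto simp: path_image_def\<close>)
    then have "(H has_contour_integral contour_integral q H) (smooth (h k))"
      unfolding ci[of k, symmetric] by (rule has_contour_integral_integral)
    then have "((\<lambda>t. H (smooth (h k) t) * vector_derivative (smooth (h k)) (at t)) has_integral contour_integral q H) {0..1}"
      unfolding has_contour_integral .
    then show ?thesis
      by (rule has_integral_eq[rotated]) (simp add: vector_derivative_at[OF smooth_derivative[OF h0 h1]])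
  qed
  \<comment> \<open>The exceptional set transported to the parameter interval [0, 1]; a linear image
    of a negligible set is negligible.\<close>
  define N where "N = (\<lambda>s. inverse L *\<^sub>R s) ` bad"
  have negN: "negligible N"
    unfolding N_def
    by (rule negligible_differentiable_image_negligible[OF order_refl negligible_bad])
      (rule bounded_linear_imp_differentiable_on[OF bounded_linear_scaleR_right])
  have notbad: "L * t \<notin> bad" if "t \<notin> N" for t
  proof
    assume "L * t \<in> bad"
    then have "inverse L *\<^sub>R (L * t) \<in> N" unfolding N_def by (rule imageI)
    moreover have "inverse L *\<^sub>R (L * t) = t" using L by simp
    ultimately have "t \<in> N" by (simp only:)
    then show False using that by simp
  qed
  define g where "g t = (if t \<in> N then 0 else H (\<sigma> (L * t)) * (L *\<^sub>R V (L * t)))" for t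
  define gk where "gk k t = (if t \<in> N then 0 else H (smooth (h k) t) * smooth' (h k) t)" for k t
  have gk: "(gk k has_integral contour_integral q H) {0..1}" for k
    by (rule has_integral_spike[OF negN _ hi[of k]]) (simp add: gk_def)
  have bound: "norm (gk k t) \<le> B * (L + 1)" if "t \<in> {0..1}" for k t
  proof (cases "t \<in> N")
    case False
    have "norm (smooth' (h k) t) \<le> L + 1"
    proof -
      have "norm (\<tau> (base (h k) t + h k) - \<tau> (base (h k) t)) \<le> h k"
        using \<tau>_lip[of "base (h k) t + h k" "base (h k) t"] h0[of k] by simp
      then have "norm ((\<tau> (base (h k) t + h k) - \<tau> (base (h k) t)) /\<^sub>R h k) \<le> 1"
        by (rule norm_scaleR_inverse_le_1[OF _ h0])
      then have "(L + h k) * norm ((\<tau> (base (h k) t + h k) - \<tau> (base (h k) t)) /\<^sub>R h k) \<le> (L + h k) * 1"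
        using L h0[of k] by (intro mult_left_mono) auto
      moreover have "norm (smooth' (h k) t) = (L + h k) * norm ((\<tau> (base (h k) t + h k) - \<tau> (base (h k) t)) /\<^sub>R h k)"
        unfolding smooth'_def norm_scaleR[of "L + h k"] using L h0[of k] by (simp only: abs_of_pos add_pos_pos)
      ultimately have "norm (smooth' (h k) t) \<le> L + h k" by (simp only: mult_1_right)
      then show ?thesis using h1[of k] by linarith
    qed
    then have "norm (H (smooth (h k) t)) * norm (smooth' (h k) t) \<le> B * (L + 1)"
      using B(2)[OF pK[OF that]] B(1) by (intro mult_mono) auto
    then show ?thesis using False by (simp add: gk_def norm_mult)
  qed (use B L in \<open>simp add: gk_def\<close>)
  have lim: "(\<lambda>k. gk k t) \<longlonglongrightarrow> g t" if t: "t \<in> {0..1}" for t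
  proof (cases "t \<in> N")
    case True then show ?thesis by (simp add: g_def gk_def)
  next
    case False
    let ?s = "L * t"
    note D = V_derivative[OF inL[OF t] notbad[OF False]]
    \<comment> \<open>The increment over the window is the difference of two increments from L t,
      with slopes t and t - 1, so the limit is exactly V.\<close>
    have "(\<lambda>k. (\<tau> (?s + t * h k) - \<tau> ?s) /\<^sub>R h k - (\<tau> (?s + (t - 1) * h k) - \<tau> ?s) /\<^sub>R h k) \<longlonglongrightarrow> t *\<^sub>R V ?s - (t - 1) *\<^sub>R V ?s"
      by (intro tendsto_diff has_vector_derivative_scaled_quotient[OF D hlim h0])
    moreover have "(\<tau> (?s + t * h k) - \<tau> ?s) /\<^sub>R h k - (\<tau> (?s + (t - 1) * h k) - \<tau> ?s) /\<^sub>R h k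
        = (\<tau> (base (h k) t + h k) - \<tau> (base (h k) t)) /\<^sub>R h k" for k
    proof -
      have b1: "base (h k) t + h k = ?s + t * h k" and b2: "base (h k) t = ?s + (t - 1) * h k"
        by (simp_all add: base_def algebra_simps)
      show ?thesis unfolding b1 unfolding b2 by (simp add: scaleR_diff_right)
    qed
    moreover have "t *\<^sub>R V ?s - (t - 1) *\<^sub>R V ?s = V ?s" by (simp add: scaleR_diff_left[symmetric])
    ultimately have "(\<lambda>k. (\<tau> (base (h k) t + h k) - \<tau> (base (h k) t)) /\<^sub>R h k) \<longlonglongrightarrow> V ?s" by simp
    then have 1: "(\<lambda>k. smooth' (h k) t) \<longlonglongrightarrow> (L + 0) *\<^sub>R V ?s"
      unfolding smooth'_def by (intro tendsto_intros hlim)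
    have "(\<lambda>k. smooth (h k) t - \<sigma> ?s) \<longlonglongrightarrow> 0"
      by (rule Lim_null_comparison[OF _ hlim]) (simp add: smooth_near[OF h0 t])
    then have 2: "(\<lambda>k. smooth (h k) t) \<longlonglongrightarrow> \<sigma> ?s" by (simp add: LIM_zero_iff)
    have "\<sigma> ?s \<in> \<Omega>" using \<Omega>(2) inL[OF t] by blast
    then have "isCont H (\<sigma> ?s)"
      using holomorphic_on_imp_continuous_on[OF H] \<Omega>(1) continuous_on_eq_continuous_at by blast
    then have "(\<lambda>k. H (smooth (h k) t)) \<longlonglongrightarrow> H (\<sigma> ?s)" using 2 by (rule isCont_tendsto_compose)
    from tendsto_mult[OF this 1] show ?thesis using False by (simp add: g_def gk_def)
  qed
  have ci: "(\<lambda>_. B * (L + 1)) integrable_on {0..1::real}"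
    by (intro integrable_continuous_interval continuous_intros)
  note dc = dominated_convergence[where f=gk and g=g, OF has_integral_integrable[OF gk] ci bound lim]
  note dc(2)
  moreover have "integral {0..1} (gk k) = contour_integral q H" for k using gk by (rule integral_unique)
  ultimately have "integral {0..1} g = contour_integral q H" by (simp add: LIMSEQ_const_iff)
  then have "(g has_integral contour_integral q H) {0..1}" using dc(1) by (metis integrable_integral)
  then have "((\<lambda>t. L *\<^sub>R (H (\<sigma> (L * t)) * V (L * t))) has_integral contour_integral q H) {0..1}"
    by (rule has_integral_spike[OF negN, rotated]) (simp add: g_def)
  from has_integral_affinity'[OF this[folded cbox_interval], of "1 / L" 0]
  have "((\<lambda>s. L *\<^sub>R (H (\<sigma> s) * V s)) has_integral L *\<^sub>R contour_integral q H) {0..L}"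
    using L by simp
  from has_integral_cmul[OF this, of "1 / L"] L show ?thesis by simp
qed

text \<open>On \<open>bad\<close> the value of V may be an arbitrary default, so bounds are asked
  for only off this null set and the integrand is replaced by 0 on it.\<close>

lemma loop_integrand_absolutely_integrable:
  assumes "f \<in> borel_measurable (lebesgue_on {0..L})" 
    and "\<And>s. s \<in> {0..L} \<Longrightarrow> s \<notin> bad \<Longrightarrow> norm (f s) \<le> B"
  shows "(f :: real \<Rightarrow> 'b::euclidean_space) absolutely_integrable_on {0..L}"
proof -
  have neg: "negligible bad" by (rule negligible_bad)
  have "(\<lambda>s. if s \<in> bad then 0 else f s) absolutely_integrable_on {0..L}"
  proof (rule measurable_bounded_by_integrable_imp_absolutely_integrable)
    show "(\<lambda>s. if s \<in> bad then 0 else f s) \<in> borel_measurable (lebesgue_on {0..L})"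
    proof (rule measurable_If_set)
      show "bad \<inter> space (lebesgue_on {0..L}) \<in> sets (lebesgue_on {0..L})"
        using negligible_imp_sets[OF neg] by (auto simp: sets_restrict_space_iff)
    qed (use assms in auto)
    show "(\<lambda>_. \<bar>B\<bar>) integrable_on {0..L}" by (intro integrable_continuous_interval continuous_intros)
    show "norm (if s \<in> bad then 0 else f s) \<le> \<bar>B\<bar>" if "s \<in> {0..L}" for s
      using assms(2)[OF that] by auto
  qed simp
  then show ?thesis
    by (rule absolutely_integrable_spike[OF _ neg]) auto
qed

end

section \<open>Contour integrals of the resolvent and Faber polynomials\<close>

lemma contour_integral_circlepath_outside_eq:
  assumes H: "H holomorphic_on - cball a \<rho>0" and \<rho>: "\<rho>0 < \<rho>" "0 < \<rho>" "\<rho> \<le> R"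
  shows "contour_integral (circlepath a R) H = contour_integral (circlepath a \<rho>) H"
proof (rule contour_integral_homologous[where \<Omega>="- cball a \<rho>0" and T="(\<lambda>t. a + complex_of_real t) ` {\<rho>..R}"])
  show "connected ((\<lambda>t. a + complex_of_real t) ` {\<rho>..R})"
    by (intro connected_continuous_image continuous_intros) simp
  show "winding_number (circlepath a R) w = winding_number (circlepath a \<rho>) w" if "w \<notin> - cball a \<rho>0" for w
    using that \<rho> by (simp add: winding_number_circlepath dist_norm norm_minus_commute)
qed (use \<rho> H in \<open>auto simp: dist_norm norm_minus_commute\<close>)

text \<open>The circle may be enlarged without changing the integral, and over radius R the integral
  is O(1/R).\<close>

lemma contour_integral_circlepath_decay:
  assumes H: "H holomorphic_on - cball a \<rho>0" and \<rho>: "\<rho>0 < \<rho>" "0 < \<rho>"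
    and decay: "\<And>z. cmod (z - a) > Rmin \<Longrightarrow> cmod (H z) \<le> M / (cmod (z - a))\<^sup>2"
  shows "contour_integral (circlepath a \<rho>) H = 0"
proof -
  let ?I = "contour_integral (circlepath a \<rho>) H"
  have bound: "cmod ?I \<le> 2 * pi * \<bar>M\<bar> / R" if R: "R > max \<rho> Rmin" for R
  proof -
    have R': "\<rho> \<le> R" "Rmin < R" "R > 0" using R \<rho> by auto
    have "H contour_integrable_on circlepath a R"
      by (rule contour_integrable_holomorphic_simple[OF H]) (use R' \<rho> in \<open>auto simp: dist_norm norm_minus_commute\<close>)
    then have "(H has_contour_integral contour_integral (circlepath a R) H) (circlepath a R)"
      by (rule has_contour_integral_integral)
    then have "cmod (contour_integral (circlepath a R) H) \<le> (\<bar>M\<bar> / R\<^sup>2) * (2 * pi * R)"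
    proof (rule has_contour_integral_bound_circlepath)
      fix z assume "cmod (z - a) = R"
      then have "cmod (H z) \<le> M / R\<^sup>2" using decay[of z] R'(2) by simp
      also have "\<dots> \<le> \<bar>M\<bar> / R\<^sup>2" by (intro divide_right_mono) auto
      finally show "cmod (H z) \<le> \<bar>M\<bar> / R\<^sup>2" .
    qed (use R' in auto)
    then show ?thesis
      unfolding contour_integral_circlepath_outside_eq[OF H \<rho> R'(1)] using R'(3) by (simp add: power2_eq_square mult_ac)
  qed
  have "(\<lambda>k. 2 * pi * \<bar>M\<bar> * (1 / real k)) \<longlonglongrightarrow> 2 * pi * \<bar>M\<bar> * 0"
    by (intro tendsto_intros lim_1_over_n)
  moreover have "\<forall>\<^sub>F k in sequentially. cmod ?I \<le> 2 * pi * \<bar>M\<bar> * (1 / real k)"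
  proof -
    obtain m :: nat where m: "max \<rho> Rmin < real m" using reals_Archimedean2 by blast
    show ?thesis unfolding eventually_sequentially
    proof (intro exI[of _ m] allI impI)
      fix k assume "m \<le> k"
      then have "max \<rho> Rmin < real k" using m by linarith
      from bound[OF this] show "cmod ?I \<le> 2 * pi * \<bar>M\<bar> * (1 / real k)" by simp
    qed
  qed
  ultimately have "cmod ?I \<le> 2 * pi * \<bar>M\<bar> * 0"
    by (rule tendsto_lowerbound) simp
  then show ?thesis by simp
qed

text \<open>The lower bound on \<rho>0 ensures that |z| - KA is at least |z - a| / 2 outside the
  disk. This is where the factor 2 in \<open>r_decay\<close> comes from.\<close>

locale resolvent_setting =
  fixes A :: "'a::complex_hilbert \<Rightarrow> 'a" and KA :: real and a :: complex and \<rho>0 :: real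
  assumes A: "bounded_clinear A" and KA: "\<And>x. norm (A x) \<le> KA * norm x"
    and spec: "cspectrum A \<subseteq> cball a \<rho>0"
    and \<rho>0: "2 * (KA + cmod a) \<le> \<rho>0" "0 < \<rho>0"
begin

definition r where "r x y z = cinner (resolvent A z x) y"

lemma r_holomorphic: "S \<inter> cspectrum A = {} \<Longrightarrow> r x y holomorphic_on S"
  unfolding r_def[abs_def]
  by (rule holomorphic_on_subset[OF holomorphic_on_cinner_resolvent[OF A]]) auto

lemma r_holomorphic_outside: "r x y holomorphic_on - cball a \<rho>0"
  by (rule r_holomorphic) (use spec in auto)

lemma r_decay:
  assumes z: "cmod (z - a) > \<rho>0"
  shows "cmod (r x y z) \<le> 2 * norm x * norm y / cmod (z - a)"
proof -
  have zs: "z \<notin> cspectrum A" using spec z by (auto simp: dist_norm norm_minus_commute)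
  have pos: "cmod (z - a) > 0" using z \<rho>0 by linarith
  have "cmod (z - a) \<le> cmod z + cmod a" by (rule norm_triangle_ineq4)
  moreover have "X / 2 \<le> Y - K" if "X \<le> Y + c" "R < X" "2 * (K + c) \<le> R" for X Y K R c :: real
    using that by (simp add: field_simps)
  ultimately have zK: "cmod (z - a) / 2 \<le> cmod z - KA" using z \<rho>0(1) by blast
  then have zK': "cmod z > KA" using pos by linarith
  have "cmod (r x y z) \<le> norm (resolvent A z x) * norm y" unfolding r_def by (rule norm_cinner_le)
  also have "\<dots> \<le> norm x / (cmod z - KA) * norm y"
    by (intro mult_right_mono norm_resolvent_le[OF zs KA zK']) simp
  also have "\<dots> \<le> norm x / (cmod (z - a) / 2) * norm y"
    by (rule mult_right_mono[OF divide_left_mono[OF zK norm_ge_zero mult_pos_pos] norm_ge_zero])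
      (use zK' pos in simp_all)
  finally show ?thesis by (simp add: mult_ac)
qed

text \<open>It trades a factor z for an application of A, up to a term entire in z. This is one step
  of the Laurent expansion at infinity and drives the induction on powers.\<close>

lemma r_shift:
  assumes "z \<notin> cspectrum A"
  shows "z * r x y z = cinner x y + r (A x) y z"
proof -
  have "resolvent A z (A x) = z *\<^sub>C resolvent A z x - x"
  proof -
    note R = bounded_clinear_resolvent[OF assms]
    have "x = resolvent A z (z *\<^sub>C x) - resolvent A z (A x)"
      using resolvent_left[OF assms, of x] by (simp add: bounded_clinear_diff[OF R])
    then show ?thesis by (simp add: bounded_clinear_scaleC[OF R] algebra_simps)
  qed
  then show ?thesis by (simp add: r_def cinner_diff_left cinner_scaleC_left)
qed

lemma r_diff_scaleC: 
  assumes "z \<notin> cspectrum A" shows "r (x - c *\<^sub>C w) y z = r x y z - c * r w y z"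
proof -
  note R = bounded_clinear_resolvent[OF assms]
  show ?thesis by (simp add: r_def bounded_clinear_diff[OF R] bounded_clinear_scaleC[OF R] cinner_diff_left cinner_scaleC_left)
qed

context
  fixes \<rho> assumes \<rho>: "\<rho>0 < \<rho>"
begin

lemma \<rho>_pos: "\<rho> > 0" using \<rho> \<rho>0 by linarith

lemma sphere_notin: "z \<in> sphere a \<rho> \<Longrightarrow> z \<notin> cspectrum A"
  using spec \<rho> by (auto simp: dist_norm norm_minus_commute subset_iff)

lemma integrable_outside:
  assumes "H holomorphic_on - cball a \<rho>0" shows "H contour_integrable_on circlepath a \<rho>"
  by (rule contour_integrable_holomorphic_simple[OF assms])
    (use \<rho> \<rho>_pos in \<open>auto simp: dist_norm norm_minus_commute\<close>)

text \<open>Expanding once about a leaves the residue term 1/(z - a) and a remainder of order 1/|z -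
  a|^2, whose integral vanishes.\<close>

lemma contour_integral_r: "contour_integral (circlepath a \<rho>) (r x y) = 2 * pi * \<i> * cinner x y"
proof -
  let ?w = "A x - a *\<^sub>C x"
  have out: "z - a \<noteq> 0" "z \<notin> cspectrum A" if "z \<notin> cball a \<rho>0" for z
    using that spec \<rho>0 by auto
  have hol1: "(\<lambda>z. cinner x y * (1 / (z - a))) holomorphic_on - cball a \<rho>0"
    using out by (intro holomorphic_intros) auto
  have hol2: "(\<lambda>z. r ?w y z / (z - a)) holomorphic_on - cball a \<rho>0"
    using out by (intro holomorphic_intros r_holomorphic_outside) auto
  have eq: "r x y z = cinner x y * (1 / (z - a)) + r ?w y z / (z - a)" if "z \<notin> cball a \<rho>0" for z
  proof -
    have "(z - a) * r x y z = cinner x y + r ?w y z"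
      using r_shift[OF out(2)[OF that], of x y] r_diff_scaleC[OF out(2)[OF that], of "A x" a x y] by (simp add: algebra_simps)
    then have "r x y z = (cinner x y + r ?w y z) / (z - a)" using out(1)[OF that] by (simp add: field_simps)
    then show ?thesis by (simp add: add_divide_distrib)
  qed
  have "contour_integral (circlepath a \<rho>) (r x y) =
      contour_integral (circlepath a \<rho>) (\<lambda>z. cinner x y * (1 / (z - a)) + r ?w y z / (z - a))"
  proof (rule contour_integral_cong[OF refl])
    fix z assume "z \<in> path_image (circlepath a \<rho>)"
    then have "z \<notin> cball a \<rho>0" using \<rho> \<rho>_pos by (auto simp: dist_norm norm_minus_commute)
    then show "r x y z = cinner x y * (1 / (z - a)) + r ?w y z / (z - a)" by (rule eq)
  qed
  also have "\<dots> = contour_integral (circlepath a \<rho>) (\<lambda>z. cinner x y * (1 / (z - a))) +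
      contour_integral (circlepath a \<rho>) (\<lambda>z. r ?w y z / (z - a))"
    by (rule contour_integral_add[OF integrable_outside[OF hol1] integrable_outside[OF hol2]])
  also have "contour_integral (circlepath a \<rho>) (\<lambda>z. r ?w y z / (z - a)) = 0"
  proof (rule contour_integral_circlepath_decay[OF hol2 \<rho> \<rho>_pos])
    fix z assume z: "cmod (z - a) > \<rho>0"
    show "cmod (r ?w y z / (z - a)) \<le> 2 * norm ?w * norm y / (cmod (z - a))\<^sup>2"
      using divide_right_mono[OF r_decay[OF z, of ?w y], of "cmod (z - a)"]
      by (simp add: norm_divide power2_eq_square)
  qed
  also have "contour_integral (circlepath a \<rho>) (\<lambda>z. cinner x y * (1 / (z - a))) = cinner x y * (2 * pi * \<i>)"
    using \<rho>_pos by (subst contour_integral_lmul)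
      (auto intro!: contour_integrable_holomorphic_simple[where S="- {a}"] holomorphic_intros
        simp: contour_integral_circlepath)
  finally show ?thesis by simp
qed

lemma contour_integral_power_r:
  "contour_integral (circlepath a \<rho>) (\<lambda>z. z ^ k * r x y z) = 2 * pi * \<i> * cinner ((A ^^ k) x) y"
proof (induction k arbitrary: x)
  case 0
  then show ?case by (simp add: contour_integral_r)
next
  case (Suc k)
  have hol: "(\<lambda>z. z ^ k * r (A x) y z) holomorphic_on - cball a \<rho>0"
    by (intro holomorphic_intros r_holomorphic_outside)
  have hol': "(\<lambda>z. z ^ k * cinner x y) holomorphic_on S" for S
    by (intro holomorphic_intros)
  have "contour_integral (circlepath a \<rho>) (\<lambda>z. z ^ Suc k * r x y z) =
      contour_integral (circlepath a \<rho>) (\<lambda>z. z ^ k * cinner x y + z ^ k * r (A x) y z)"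
  proof (rule contour_integral_cong[OF refl])
    fix z assume "z \<in> path_image (circlepath a \<rho>)"
    then have "z \<notin> cspectrum A" using sphere_notin \<rho>_pos by simp
    from r_shift[OF this, of x y] show "z ^ Suc k * r x y z = z ^ k * cinner x y + z ^ k * r (A x) y z"
      by (simp add: distrib_left[symmetric] mult.assoc[symmetric] mult.commute[of z])
  qed
  also have "\<dots> = contour_integral (circlepath a \<rho>) (\<lambda>z. z ^ k * cinner x y) +
      contour_integral (circlepath a \<rho>) (\<lambda>z. z ^ k * r (A x) y z)"
    by (rule contour_integral_add[OF integrable_outside[OF hol'] integrable_outside[OF hol]])
  also have "contour_integral (circlepath a \<rho>) (\<lambda>z. z ^ k * cinner x y) = 0"
    by (rule contour_integral_unique[OF Cauchy_theorem_convex_simple[OF hol' convex_UNIV]]) auto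
  finally show ?case by (simp add: Suc.IH funpow_swap1)
qed

lemma cinner_sum_left: "cinner (\<Sum>i\<in>I. f i) (y::'b::complex_inner) = (\<Sum>i\<in>I. cinner (f i) y)"
  by (induction I rule: infinite_finite_induct) (simp_all add: cinner_add_left)

lemma contour_integral_poly_r:
  "contour_integral (circlepath a \<rho>) (\<lambda>z. poly p z * r x y z) = 2 * pi * \<i> * cinner (poly_op p A x) y"
proof -
  have hol: "(\<lambda>z. z ^ k * r x y z) holomorphic_on - cball a \<rho>0" for k
    by (intro holomorphic_intros r_holomorphic_outside)
  have "contour_integral (circlepath a \<rho>) (\<lambda>z. poly p z * r x y z) =
      contour_integral (circlepath a \<rho>) (\<lambda>z. \<Sum>k\<le>degree p. coeff p k * (z ^ k * r x y z))"
    by (simp add: poly_altdef sum_distrib_right mult.assoc)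
  also have "\<dots> = (\<Sum>k\<le>degree p. coeff p k * (2 * pi * \<i> * cinner ((A ^^ k) x) y))"
    by (subst contour_integral_sum)
      (simp_all add: contour_integral_lmul integrable_outside[OF hol] contour_integrable_lmul contour_integral_power_r)
  also have "\<dots> = 2 * pi * \<i> * cinner (poly_op p A x) y"
    by (simp add: poly_op_def cinner_sum_left cinner_scaleC_left sum_distrib_left mult_ac)
  finally show ?thesis .
qed

end

end

text \<open>The remainder is holomorphic on all of S because each step divides out a removable
  singularity at 0. At infinity this separates the polynomial part of \<Phi>^n from an O(1/z)
  rest.\<close>

lemma holomorphic_taylor_remainder:
  assumes S: "open S" "0 \<in> S" and G: "G holomorphic_on S"
  shows "\<exists>p T. degree p \<le> n \<and> T holomorphic_on S \<and> (\<forall>u\<in>S. G u = poly p u + u ^ Suc n * T u)"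
  using G
proof (induction n arbitrary: G)
  case (0 G)
  define T where "T u = (if u = 0 then deriv G 0 else (G u - G 0) / u)" for u
  have "T holomorphic_on S"
  proof (rule pole_theorem_open_0[where g="\<lambda>u. G u - G 0" and a=0])
    show "(\<lambda>u. G u - G 0) holomorphic_on S" by (intro holomorphic_intros 0)
    have "deriv (\<lambda>u. G u - G 0) 0 = deriv G 0"
      using 0 S by (subst deriv_diff) (auto simp: holomorphic_on_imp_differentiable_at)
    then show "T 0 = deriv (\<lambda>u. G u - G 0) 0" by (simp add: T_def)
  qed (use S in \<open>auto simp: T_def\<close>)
  moreover have "\<forall>u\<in>S. G u = poly [:G 0:] u + u ^ Suc 0 * T u" by (simp add: T_def)
  ultimately show ?case by (intro exI[of _ "[:G 0:]"] exI[of _ T]) simp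
next
  case (Suc n G)
  obtain p T where T: "degree p \<le> n" "T holomorphic_on S" "\<forall>u\<in>S. G u = poly p u + u ^ Suc n * T u"
    using Suc.IH[OF Suc.prems] by blast
  define T' where "T' u = (if u = 0 then deriv T 0 else (T u - T 0) / u)" for u
  have "T' holomorphic_on S"
  proof (rule pole_theorem_open_0[where g="\<lambda>u. T u - T 0" and a=0])
    show "(\<lambda>u. T u - T 0) holomorphic_on S" by (intro holomorphic_intros T)
    have "deriv (\<lambda>u. T u - T 0) 0 = deriv T 0"
      using T(2) S by (subst deriv_diff) (auto simp: holomorphic_on_imp_differentiable_at)
    then show "T' 0 = deriv (\<lambda>u. T u - T 0) 0" by (simp add: T'_def)
  qed (use S in \<open>auto simp: T'_def\<close>)
  moreover have "degree (p + monom (T 0) (Suc n)) \<le> Suc n"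
    using T(1) by (intro degree_add_le) (auto intro: order_trans[OF degree_monom_le])
  moreover have "\<forall>u\<in>S. G u = poly (p + monom (T 0) (Suc n)) u + u ^ Suc (Suc n) * T' u"
  proof
    fix u assume "u \<in> S"
    moreover have "T u = T 0 + u * T' u" by (simp add: T'_def)
    ultimately show "G u = poly (p + monom (T 0) (Suc n)) u + u ^ Suc (Suc n) * T' u"
      using T(3) by (simp add: poly_monom algebra_simps)
  qed
  ultimately show ?case by blast
qed

lemma poly_eq_0_of_tendsto_0:
  assumes "(poly p \<longlongrightarrow> (0::complex)) at_infinity" shows "p = 0"
proof -
  have "poly p z = 0" for z
    by (rule Liouville_weak_0[OF _ assms]) (auto intro!: holomorphic_intros)
  then show ?thesis using poly_all_0_iff_0[of p] by blast
qed

lemma bigo_inverse_tendsto_0: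
  assumes "(f :: complex \<Rightarrow> complex) \<in> O[at_infinity](\<lambda>z. 1 / z)" shows "(f \<longlongrightarrow> 0) at_infinity"
proof -
  obtain c where c: "\<forall>\<^sub>F z in at_infinity. cmod (f z) \<le> c * cmod (1 / z)"
    using assms by (auto elim: landau_o.bigE)
  show ?thesis
  proof (rule Lim_null_comparison[OF c])
    have "((\<lambda>z::complex. 1 / z) \<longlongrightarrow> 0) at_infinity"
      by (rule tendsto_divide_0[OF tendsto_const filterlim_ident])
    from tendsto_mult[OF tendsto_const[of c] tendsto_norm[OF this]]
    show "((\<lambda>z. c * cmod (1 / z)) \<longlongrightarrow> 0) at_infinity" by simp
  qed
qed

context jordan_region
begin

text \<open>\<open>faber_poly\<close> is a \<open>THE\<close>: existence comes from a Taylor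
  expansion in u = 1/(z - a), uniqueness from Liouville, since a polynomial that is O(1/z)
  vanishes.\<close>

lemma faber_poly_bigo:
  "(\<lambda>z. exterior_map E z ^ n - poly (faber_poly E n) z) \<in> O[at_infinity](\<lambda>z. 1 / z)"
proof -
  let ?\<Phi> = "exterior_map E"
  let ?P = "\<lambda>p. (\<lambda>z. ?\<Phi> z ^ n - poly p z) \<in> O[at_infinity](\<lambda>z. 1 / z)"
  obtain a where a: "a \<in> U" using U_ne by blast
  let ?D = "inversion_domain a E"
  define f where "f u = (if u = 0 then 0 else 1 / ?\<Phi> (a + 1 / u))" for u
  obtain g where g: "riemann_pair ?D f g"
    using riemann_pair_of_exterior_map[OF is_exterior_map_exterior_map inversion_domain_E(1)[OF a]] a E
    unfolding f_def[abs_def] by blast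
  note fp = riemann_pairD[OF g]
  \<comment> \<open>Dividing out the simple zero of f leaves a nonvanishing holomorphic factor, and
    \<Phi>^n becomes u^(-n) (1/q)^n.\<close>
  define q where "q u = (if u = 0 then deriv f 0 else f u / u)" for u
  have "q holomorphic_on ?D"
    by (rule pole_theorem_open_0[OF fp(3,1), where a=0]) (use fp in \<open>auto simp: q_def\<close>)
  moreover have q0: "q u \<noteq> 0" if "u \<in> ?D" for u
  proof (cases "u = 0")
    case True
    then show ?thesis using fp(11) by (auto simp: q_def)
  next
    case False
    then have "f u \<noteq> 0" using fp(6)[OF that] fp(10) by force
    then show ?thesis using False by (simp add: q_def)
  qed
  ultimately have "(\<lambda>u. (1 / q u) ^ n) holomorphic_on ?D" by (intro holomorphic_intros) auto
  from holomorphic_taylor_remainder[OF fp(1,2) this, of n]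
  obtain P T where PT: "degree P \<le> n" "T holomorphic_on ?D"
    "\<forall>u\<in>?D. (1 / q u) ^ n = poly P u + u ^ Suc n * T u" by blast
  \<comment> \<open>Each term of degree j, divided by u^n, becomes (z - a)^(n - j); since
    \<open>degree P \<le> n\<close>, the subtraction of naturals is exact.\<close>
  define p where "p = (\<Sum>j\<le>degree P. smult (coeff P j) ([:-a, 1:] ^ (n - j)))"
  have expand: "?\<Phi> z ^ n - poly p z = (1 / (z - a)) * T (1 / (z - a))" if z: "z \<notin> E" for z
  proof -
    have za: "z \<noteq> a" using z a E by auto
    define u where "u = 1 / (z - a)"
    have u: "u \<noteq> 0" "u \<in> ?D" "1 / u = z - a"
      using za z a E by (auto simp: u_def inversion_domain_iff)
    have "?\<Phi> z = 1 / f u" using u(1) by (simp add: f_def u(3))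
    also have "f u = u * q u" using u(1) by (simp add: q_def)
    finally have "?\<Phi> z ^ n = (1 / u) ^ n * (1 / q u) ^ n" by (simp add: power_mult_distrib[symmetric])
    also have "\<dots> = (1 / u) ^ n * poly P u + u * T u"
    proof -
      have "(1 / u) ^ n * u ^ n = 1" using u(1) by (simp add: power_mult_distrib[symmetric])
      moreover have "(1 / u) ^ n * (u ^ Suc n * T u) = ((1 / u) ^ n * u ^ n) * (u * T u)" by (simp only: power_Suc mult_ac)
      moreover have "(1 / q u) ^ n = poly P u + u ^ Suc n * T u" using PT(3) u(2) by blast
      ultimately show ?thesis by (simp only: distrib_left mult_1_left)
    qed
    also have "(1 / u) ^ n * poly P u = poly p z"
    proof -
      have "(1 / u) ^ n * u ^ j = (z - a) ^ (n - j)" if "j \<le> degree P" for j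
      proof -
        have "j \<le> n" using that PT(1) by simp
        then have "(1 / u) ^ n = (1 / u) ^ (n - j) * (1 / u) ^ j" by (simp add: power_add[symmetric])
        then show ?thesis using u(1) by (simp add: u(3)[symmetric] power_one_over)
      qed
      then have "(1 / u) ^ n * poly P u = (\<Sum>j\<le>degree P. coeff P j * (z - a) ^ (n - j))"
        by (simp add: poly_altdef sum_distrib_left mult.left_commute)
      then show ?thesis by (simp add: p_def poly_sum)
    qed
    finally show ?thesis by (simp add: u_def)
  qed
  have "?P p"
  proof -
    have "isCont T 0"
      using holomorphic_on_imp_continuous_on[OF PT(2)] fp(1,2) continuous_on_eq_continuous_at by blast
    then have "(T \<longlongrightarrow> T 0) (at 0)" by (simp add: isCont_def)
    from filterlim_compose[OF this filterlim_inverse_affine_at_0[of a]]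
    have "((\<lambda>z. cmod (T (1 / (z - a)))) \<longlongrightarrow> cmod (T 0)) at_infinity" by (rule tendsto_norm)
    then have evT: "\<forall>\<^sub>F z in at_infinity. cmod (T (1 / (z - a))) < cmod (T 0) + 1"
      by (rule order_tendstoD) simp
    obtain B where B: "\<And>z. z \<in> E \<Longrightarrow> cmod z \<le> B" using compact_imp_bounded[OF compact_E] bounded_iff by blast
    have "\<forall>\<^sub>F z in at_infinity. cmod z > \<bar>B\<bar> + 2 * cmod a + 1"
      unfolding eventually_at_infinity by (intro exI[of _ "\<bar>B\<bar> + 2 * cmod a + 2"]) auto
    with evT have "\<forall>\<^sub>F z in at_infinity. cmod (?\<Phi> z ^ n - poly p z) \<le> 2 * (cmod (T 0) + 1) * cmod (1 / z)"
    proof eventually_elim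
      case (elim z)
      have "\<not> cmod z \<le> B" using elim(2) abs_ge_self[of B] norm_ge_zero[of a] by linarith
      then have zE: "z \<notin> E" using B by blast
      have tri: "cmod z \<le> cmod (z - a) + cmod a" using norm_triangle_ineq[of "z - a" a] by simp
      have z0: "cmod z > 0" using elim(2) norm_ge_zero[of a] abs_ge_zero[of B] by linarith
      have z2: "cmod z \<le> 2 * cmod (z - a)" using tri elim(2) abs_ge_zero[of B] by linarith
      have "1 / cmod (z - a) \<le> 1 / (cmod z / 2)" by (intro frac_le) (use z0 z2 in simp_all)
      then have "cmod (1 / (z - a)) \<le> 2 * cmod (1 / z)" by (simp add: norm_divide)
      then have "cmod (1 / (z - a)) * cmod (T (1 / (z - a))) \<le> 2 * cmod (1 / z) * (cmod (T 0) + 1)"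
        using elim(1) by (intro mult_mono) auto
      then show ?case unfolding expand[OF zE] norm_mult by (simp only: mult_ac)
    qed
    then show ?thesis by (rule bigoI)
  qed
  moreover have "p' = p" if "?P p'" for p'
  proof -
    have "(\<lambda>z. (?\<Phi> z ^ n - poly p z) - (?\<Phi> z ^ n - poly p' z)) \<in> O[at_infinity](\<lambda>z. 1 / z)"
      by (rule sum_in_bigo(2)[OF \<open>?P p\<close> that])
    then have "poly (p' - p) \<in> O[at_infinity](\<lambda>z. 1 / z)" by (simp add: poly_diff[abs_def] fun_diff_def)
    then show ?thesis using poly_eq_0_of_tendsto_0 bigo_inverse_tendsto_0 by fastforce
  qed
  ultimately show ?thesis unfolding faber_poly_def by (rule theI)
qed

end

section \<open>The double layer operator\<close>

text \<open>The adjoint summand of the form is the conjugate of the resolvent form with x and y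
  exchanged. This later turns it into the conjugate of a contour integral.\<close>

lemma
  fixes A :: "'a::complex_hilbert \<Rightarrow> 'a"
  assumes A: "bounded_clinear A" and s: "\<sigma> s \<notin> cspectrum A"
  shows cinner_mu_op: "cinner (mu_op L \<sigma> A s x) y =
      (outer_normal L \<sigma> s * cinner (resolvent A (\<sigma> s) x) y +
       cnj (outer_normal L \<sigma> s * cinner (resolvent A (\<sigma> s) y) x)) / of_real (2 * pi)"
    and bounded_clinear_mu_op: "bounded_clinear (mu_op L \<sigma> A s)"
    and mu_op_selfadjoint: "cinner (mu_op L \<sigma> A s x) y = cinner x (mu_op L \<sigma> A s y)"
proof -
  let ?R = "resolvent A (\<sigma> s)" and ?\<nu> = "outer_normal L \<sigma> s"
  note R = bounded_clinear_resolvent[OF s]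
  have R': "resolvent (cadjoint A) (cnj (\<sigma> s)) = cadjoint ?R" by (rule resolvent_cadjoint[OF A s])
  have *: "cinner (mu_op L \<sigma> A s x) y = (?\<nu> * cinner (?R x) y + cnj (?\<nu> * cinner (?R y) x)) / of_real (2 * pi)" for x y
    by (simp add: mu_op_def R' cinner_scaleR_left cinner_add_left cinner_scaleC_left cinner_cadjoint_left[OF R]
        cinner_commute[of x] field_simps)
  then show "cinner (mu_op L \<sigma> A s x) y = (?\<nu> * cinner (?R x) y + cnj (?\<nu> * cinner (?R y) x)) / of_real (2 * pi)" .
  have "cinner (mu_op L \<sigma> A s x) y = cnj (cinner (mu_op L \<sigma> A s y) x)"
    unfolding * by (simp add: add.commute)
  then show "cinner (mu_op L \<sigma> A s x) y = cinner x (mu_op L \<sigma> A s y)"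
    by (metis cinner_commute)
  have "bounded_clinear (\<lambda>x. complex_of_real (1 / (2 * pi)) *\<^sub>C (?\<nu> *\<^sub>C ?R x + cnj ?\<nu> *\<^sub>C cadjoint ?R x))"
    by (intro bounded_clinear_scale bounded_clinear_sum R bounded_clinear_cadjoint)
  then show "bounded_clinear (mu_op L \<sigma> A s)"
    unfolding mu_op_def[abs_def] R' scaleC_complex_of_real .
qed

lemma inner_mu_op:
  fixes A :: "'a::complex_hilbert \<Rightarrow> 'a"
  assumes A: "bounded_clinear A" and s: "\<sigma> s \<notin> cspectrum A"
  shows "inner (mu_op L \<sigma> A s x) x = Re (outer_normal L \<sigma> s * cinner (resolvent A (\<sigma> s) x) x) / pi"
  unfolding Re_cinner[symmetric] cinner_mu_op[where \<sigma>=\<sigma> and s=s, OF A s]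
  by (simp add: Re_divide_of_real field_simps del: of_real_mult)

locale operator_in_jordan_region = jordan_region p C U E + lipschitz_loop L \<sigma>
  for p C U E L \<sigma> +
  fixes A :: "'a::complex_hilbert \<Rightarrow> 'a"
  assumes A: "bounded_clinear A" and spec: "cspectrum A \<subseteq> U"
    and \<sigma>C: "\<sigma> ` {0..L} = C"
    and wn: "\<And>z. z \<in> U \<Longrightarrow> winding_number (\<lambda>t. \<sigma> (L * t)) z = 1"
begin

lemma \<sigma>_notin: "s \<in> {0..L} \<Longrightarrow> \<sigma> s \<notin> cspectrum A"
  using \<sigma>C spec C_Int_U by blast

lemma compact_spec: "compact (cspectrum A)"
  using closed_cspectrum[OF A] bounded_subset[OF bounded_U spec] by (simp add: compact_eq_bounded_closed)

lemma connected_Compl_U: "connected (- U)"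
  using simply_connected_iff_simple[OF open_U bounded_U] simply_connected_U by blast

text \<open>The complement of U is connected because U is bounded and simply connected. It contains
  both the curve and the circle and avoids the singularities of H, so it can serve as the connecting
  set.\<close>

lemma loop_integral_circlepath:
  assumes K: "compact K" "K \<subseteq> U" and H: "H holomorphic_on - K" and \<rho>: "E \<subseteq> ball a \<rho>" "\<rho> > 0"
  shows "((\<lambda>s. H (\<sigma> s) * V s) has_integral contour_integral (circlepath a \<rho>) H) {0..L}"
proof (rule loop_integral_eq[where \<Omega>="- K" and T="- U", OF _ _ H])
  show "open (- K)" by (rule open_Compl[OF compact_imp_closed[OF K(1)]])
  show "\<sigma> ` {0..L} \<subseteq> - K" using \<sigma>C K(2) C_Int_U by blast
  have UE: "U \<subseteq> ball a \<rho>" using \<rho>(1) E by blast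
  have sph: "sphere a \<rho> \<subseteq> - U" using UE by auto
  then show "path_image (circlepath a \<rho>) \<subseteq> - K" using K(2) \<rho>(2) by (simp add: subset_iff) blast
  show "winding_number (\<lambda>t. \<sigma> (L * t)) w = winding_number (circlepath a \<rho>) w" if "w \<notin> - K" for w
  proof -
    have "w \<in> U" using that K(2) by blast
    then show ?thesis using wn[of w] UE by (auto simp: winding_number_circlepath dist_norm norm_minus_commute)
  qed
  show "pathstart (circlepath a \<rho>) \<in> - U"
    using sph \<rho>(2) by (auto simp: subset_iff dist_norm)
  show "\<sigma> 0 \<in> - U" using \<sigma>C C_Int_U L by force
qed (use K connected_Compl_U in auto)

lemma outer_normal_V: "outer_normal L \<sigma> s = V s / \<i>"
  by (simp add: outer_normal_def V_def)

text \<open>The loop theorem for the constant function 1 shows that V is integrable, and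
  measurability follows.\<close>

lemma V_measurable: "V \<in> borel_measurable (lebesgue_on {0..L})"
proof -
  obtain \<rho> where \<rho>: "\<rho> > 0" "E \<subseteq> ball 0 \<rho>" using compact_imp_bounded[OF compact_E] bounded_subset_ballD by blast
  have "((\<lambda>s. 1 * V s) has_integral contour_integral (circlepath 0 \<rho>) (\<lambda>_. 1)) {0..L}"
    by (rule loop_integral_circlepath[where K="{}"]) (use \<rho> in auto)
  then show ?thesis using integrable_imp_measurable[of V "{0..L}"] has_integral_integrable by auto
qed

lemma resolvent_bound_C:
  obtains B where "B > 0" "\<And>z x. z \<in> C \<Longrightarrow> norm (resolvent A z x) \<le> B * norm x"
  using resolvent_bounded_on_compact[OF A compact_C] C_Int_U spec by blast

context
  assumes nontrivial: "\<exists>x::'a. x \<noteq> 0"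
begin

lemma alpha_minus_eq:
  assumes "s \<in> {0..L}"
  shows "alpha_minus L \<sigma> A s = max 0 (- (INF x\<in>{x::'a. norm x = 1}. inner (mu_op L \<sigma> A s x) x))"
  unfolding alpha_minus_def
  using min_spectrum_selfadjoint[OF bounded_clinear_mu_op[OF A] mu_op_selfadjoint[OF A] nontrivial, of \<sigma> s L] \<sigma>_notin[OF assms]
  by simp

lemma alpha_minus_form:
  assumes "s \<in> {0..L}"
  shows "- alpha_minus L \<sigma> A s * (norm v)\<^sup>2 \<le> inner (mu_op L \<sigma> A s v) v"
proof -
  let ?m = "INF x\<in>{x::'a. norm x = 1}. inner (mu_op L \<sigma> A s x) x"
  have "- alpha_minus L \<sigma> A s \<le> ?m" unfolding alpha_minus_eq[OF assms] by simp
  then have "- alpha_minus L \<sigma> A s * (norm v)\<^sup>2 \<le> ?m * (norm v)\<^sup>2" by (rule mult_right_mono) simp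
  also have "\<dots> \<le> inner (mu_op L \<sigma> A s v) v"
    by (rule INF_numerical_range_le[OF bounded_clinear_mu_op[where \<sigma>=\<sigma> and s=s, OF A \<sigma>_notin[OF assms]]])
  finally show ?thesis .
qed

lemma unit_sphere_nonempty: "{x::'a. norm x = 1} \<noteq> {}"
proof -
  obtain u :: 'a where "u \<noteq> 0" using nontrivial by blast
  then have "norm (u /\<^sub>R norm u) = 1" by simp
  then show ?thesis by blast
qed

text \<open>The infimum over the unit sphere is uncountable, so measurability for each vector does
  not suffice. The infimum Q is instead continuous as a function of the pair (normal, boundary
  point), with a modulus uniform in the vector, and is composed with a measurable map.\<close>

lemma alpha_minus_absolutely_integrable:
  "alpha_minus L \<sigma> A absolutely_integrable_on {0..L}"
proof -
  obtain B where B: "B > 0" "\<And>z x. z \<in> C \<Longrightarrow> norm (resolvent A z x) \<le> B * norm x"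
    using resolvent_bound_C by blast
  let ?S = "{x::'a. norm x = 1}"
  define F where "F p x = Re (fst p * cinner (resolvent A (snd p) x) x) / pi" for p :: "complex \<times> complex" and x :: 'a
  define Q where "Q p = (INF x\<in>?S. F p x)" for p :: "complex \<times> complex"
  have notin: "z \<notin> cspectrum A" if "z \<in> C" for z using that spec C_Int_U by blast
  have r_le: "cmod (cinner (resolvent A z x) x) \<le> B" if "z \<in> C" "norm x = 1" for z x
    using norm_cinner_le[of "resolvent A z x" x] B(2)[OF that(1), of x] that(2) by simp
  have F_le: "\<bar>F p x\<bar> \<le> cmod (fst p) * B / pi" if "snd p \<in> C" "norm x = 1" for p :: "complex \<times> complex" and x :: 'a
  proof -
    have "\<bar>Re (fst p * cinner (resolvent A (snd p) x) x)\<bar> \<le> cmod (fst p) * B"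
      using abs_Re_le_cmod[of "fst p * cinner (resolvent A (snd p) x) x"] mult_left_mono[OF r_le[OF that], of "cmod (fst p)"]
      by (simp add: norm_mult)
    then show ?thesis by (simp add: F_def divide_right_mono)
  qed
  have bdd: "bdd_below (F p ` ?S)" if "snd p \<in> C" for p :: "complex \<times> complex"
    by (rule bdd_belowI2[of _ "- (cmod (fst p) * B / pi)"]) (use F_le[OF that] in \<open>auto simp: abs_le_iff minus_le_iff\<close>)
  have Q_le: "\<bar>Q p\<bar> \<le> cmod (fst p) * B / pi" if "snd p \<in> C" for p :: "complex \<times> complex"
  proof -
    obtain u :: 'a where u: "norm u = 1" using unit_sphere_nonempty by blast
    have "Q p \<le> F p u" unfolding Q_def by (rule cINF_lower[OF bdd[OF that]]) (use u in simp)
    moreover have "- (cmod (fst p) * B / pi) \<le> Q p" unfolding Q_def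
      by (rule cINF_greatest[OF unit_sphere_nonempty]) (use F_le[OF that] in \<open>auto simp: abs_le_iff minus_le_iff\<close>)
    ultimately show ?thesis using F_le[OF that u] by (auto simp: abs_le_iff)
  qed
  \<comment> \<open>The first term is the change of the normal against the resolvent bound B, the
    second the change of the point against the Lipschitz bound \<open>B\<^sup>2\<close> for the
    resolvent.\<close>
  define d where "d p p' = (cmod (fst p' - fst p) * B + cmod (fst p) * (B\<^sup>2 * cmod (snd p' - snd p))) / pi" for p p' :: "complex \<times> complex"
  have F_diff: "\<bar>F p' x - F p x\<bar> \<le> d p p'" if "snd p \<in> C" "snd p' \<in> C" "norm x = 1" for p p' :: "complex \<times> complex" and x :: 'a
  proof -
    let ?r = "\<lambda>z. cinner (resolvent A z x) x"
    have "cmod (?r (snd p') - ?r (snd p)) \<le> norm (resolvent A (snd p') x - resolvent A (snd p) x) * norm x"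
      unfolding cinner_diff_left[symmetric] by (rule norm_cinner_le)
    also have "\<dots> \<le> B\<^sup>2 * cmod (snd p' - snd p)"
      using resolvent_lipschitz[OF notin notin, of "snd p" "snd p'" B x] that B by simp
    finally have 1: "cmod (?r (snd p') - ?r (snd p)) \<le> B\<^sup>2 * cmod (snd p' - snd p)" .
    have "fst p' * ?r (snd p') - fst p * ?r (snd p) = (fst p' - fst p) * ?r (snd p') + fst p * (?r (snd p') - ?r (snd p))"
      by (simp add: algebra_simps)
    then have "cmod (fst p' * ?r (snd p') - fst p * ?r (snd p)) \<le> cmod (fst p' - fst p) * cmod (?r (snd p')) + cmod (fst p) * cmod (?r (snd p') - ?r (snd p))"
      by (metis norm_mult norm_triangle_ineq)
    also have "\<dots> \<le> cmod (fst p' - fst p) * B + cmod (fst p) * (B\<^sup>2 * cmod (snd p' - snd p))"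
      by (intro add_mono mult_left_mono 1 r_le that) auto
    finally have "\<bar>Re (fst p' * ?r (snd p')) - Re (fst p * ?r (snd p))\<bar> \<le> cmod (fst p' - fst p) * B + cmod (fst p) * (B\<^sup>2 * cmod (snd p' - snd p))"
      using abs_Re_le_cmod[of "fst p' * ?r (snd p') - fst p * ?r (snd p)"] by (simp only: minus_complex.sel)
    then show ?thesis unfolding F_def d_def diff_divide_distrib[symmetric] by (simp add: divide_right_mono)
  qed
  have Q_diff: "\<bar>Q p' - Q p\<bar> \<le> d p p'" if "snd p \<in> C" "snd p' \<in> C" for p p' :: "complex \<times> complex"
  proof -
    have "Q p' \<le> Q p + d p p'" unfolding Q_def
      by (rule INF_le_INF_add[OF unit_sphere_nonempty bdd[OF that(2)]]) (use F_diff[OF that] in \<open>force simp: abs_le_iff\<close>)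
    moreover have "Q p \<le> Q p' + d p p'" unfolding Q_def
      by (rule INF_le_INF_add[OF unit_sphere_nonempty bdd[OF that(1)]]) (use F_diff[OF that] in \<open>force simp: abs_le_iff\<close>)
    ultimately show ?thesis by (simp add: abs_le_iff)
  qed
  have contQ: "continuous_on (UNIV \<times> C) Q"
    unfolding continuous_on_def
  proof
    fix p :: "complex \<times> complex" assume p: "p \<in> UNIV \<times> C"
    show "(Q \<longlongrightarrow> Q p) (at p within UNIV \<times> C)"
    proof (rule LIM_zero_cancel, rule Lim_null_comparison)
      show "\<forall>\<^sub>F p' in at p within UNIV \<times> C. norm (Q p' - Q p) \<le> d p p'"
        unfolding eventually_at_filter
      proof (intro always_eventually allI impI)
        fix p' :: "complex \<times> complex" assume "p' \<in> UNIV \<times> C"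
        then show "norm (Q p' - Q p) \<le> d p p'"
          using Q_diff[of p p'] p by (simp add: mem_Times_iff)
      qed
      have "((\<lambda>p'. (cmod (fst p' - fst p) * B + cmod (fst p) * (B\<^sup>2 * cmod (snd p' - snd p))) / pi) \<longlongrightarrow>
          (cmod (fst p - fst p) * B + cmod (fst p) * (B\<^sup>2 * cmod (snd p - snd p))) / pi) (at p within UNIV \<times> C)"
        by (intro tendsto_intros) simp
      then show "(d p \<longlongrightarrow> 0) (at p within UNIV \<times> C)" by (simp add: d_def[abs_def])
    qed
  qed
  have eq: "alpha_minus L \<sigma> A s = max 0 (- Q (V s / \<i>, \<sigma> s))" if "s \<in> {0..L}" for s
    unfolding alpha_minus_eq[OF that] Q_def F_def
    by (simp add: inner_mu_op[where \<sigma>=\<sigma> and s=s, OF A \<sigma>_notin[OF that]] outer_normal_V)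
  have [measurable]: "V \<in> borel_measurable (lebesgue_on {0..L})" by (rule V_measurable)
  have [measurable]: "\<sigma> \<in> borel_measurable (lebesgue_on {0..L})"
    by (rule continuous_imp_measurable_on_sets_lebesgue[OF \<sigma>_continuous]) simp
  have "(\<lambda>s. (V s / \<i>, \<sigma> s)) \<in> lebesgue_on {0..L} \<rightarrow>\<^sub>M restrict_space borel (UNIV \<times> C)"
    by (rule measurable_restrict_space2) (use \<sigma>C in auto)
  from measurable_compose[OF this borel_measurable_continuous_on_restrict[OF contQ]]
  have [measurable]: "(\<lambda>s. Q (V s / \<i>, \<sigma> s)) \<in> borel_measurable (lebesgue_on {0..L})" .
  have "(\<lambda>s. max 0 (- Q (V s / \<i>, \<sigma> s))) \<in> borel_measurable (lebesgue_on {0..L})" by measurable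
  then have meas: "alpha_minus L \<sigma> A \<in> borel_measurable (lebesgue_on {0..L})"
    by (rule measurable_cong[THEN iffD1, rotated]) (simp add: eq)
  show ?thesis
  proof (rule loop_integrand_absolutely_integrable[OF meas])
    fix s assume s: "s \<in> {0..L}" "s \<notin> bad"
    have sC: "\<sigma> s \<in> C" using \<sigma>C s(1) by blast
    have "\<bar>Q (V s / \<i>, \<sigma> s)\<bar> \<le> cmod (V s) * B / pi"
      using Q_le[of "(V s / \<i>, \<sigma> s)"] sC by (simp add: norm_divide norm_mult)
    also have "\<dots> \<le> 1 * B / pi"
      using norm_V_le[OF s] B(1) by (intro divide_right_mono mult_right_mono) auto
    finally show "norm (alpha_minus L \<sigma> A s) \<le> B / pi"
      using B(1) by (simp add: eq[OF s(1)] max_def abs_le_iff)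
  qed
qed

end

end

section \<open>The bound for Faber polynomials\<close>

lemma uniform_limit_pow:
  fixes l :: "'b \<Rightarrow> complex"
  assumes "uniform_limit S f l F" "bounded (l ` S)"
  shows "uniform_limit S (\<lambda>k z. f k z ^ n) (\<lambda>z. l z ^ n) F"
proof (induction n)
  case 0
  then show ?case by (simp add: uniform_limit_const)
next
  case (Suc n)
  obtain B where B: "\<And>z. z \<in> S \<Longrightarrow> cmod (l z) \<le> B" using assms(2) unfolding bounded_iff by blast
  have "bounded ((\<lambda>z. l z ^ n) ` S)"
    unfolding bounded_iff by (intro exI[of _ "B ^ n"]) (auto simp: norm_power intro: power_mono B)
  from uniform_lim_mult[OF assms(1) Suc.IH assms(2) this] show ?case by simp
qed

context operator_in_jordan_region
begin

text \<open>The form of \<mu> at x is a real part divided by \<pi>. The resolvent form integrates to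
  2 \<pi> i, the factor i cancels against the normal, and 2 remains.\<close>

lemma inner_mu_op_has_integral:
  assumes x: "norm x = 1"
  shows "((\<lambda>s. inner (mu_op L \<sigma> A s x) x) has_integral 2) {0..L}"
proof -
  obtain KA where KA: "KA > 0" "\<And>x. norm (A x) \<le> KA * norm x" using bounded_clinear_bound[OF A] by blast
  obtain b where b: "b > 0" "E \<subseteq> ball 0 b" using compact_imp_bounded[OF compact_E] bounded_subset_ballD by blast
  define \<rho>0 where "\<rho>0 = b + 2 * KA"
  have spec0: "cspectrum A \<subseteq> cball 0 \<rho>0" using spec E b KA by (force simp: \<rho>0_def)
  interpret R: resolvent_setting A KA 0 \<rho>0
    by standard (use A KA spec0 b in \<open>auto simp: \<rho>0_def\<close>)
  have "((\<lambda>s. R.r x x (\<sigma> s) * V s) has_integral contour_integral (circlepath 0 (\<rho>0 + 1)) (R.r x x)) {0..L}"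
  proof (rule loop_integral_circlepath[OF compact_spec spec])
    show "R.r x x holomorphic_on - cspectrum A" by (rule R.r_holomorphic) auto
    show "E \<subseteq> ball 0 (\<rho>0 + 1)" using b KA(1) by (force simp: \<rho>0_def)
  qed (use b KA in \<open>simp add: \<rho>0_def\<close>)
  also have "contour_integral (circlepath 0 (\<rho>0 + 1)) (R.r x x) = 2 * pi * \<i>"
    by (subst R.contour_integral_r) (use x in \<open>simp_all add: cinner_self\<close>)
  finally have "((\<lambda>s. (1 / (pi * \<i>)) * (R.r x x (\<sigma> s) * V s)) has_integral (1 / (pi * \<i>)) * (2 * pi * \<i>)) {0..L}"
    by (rule has_integral_mult_right)
  from has_integral_Re[OF this]
  have "((\<lambda>s. Re ((1 / (pi * \<i>)) * (R.r x x (\<sigma> s) * V s))) has_integral 2) {0..L}" by simp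
  then show ?thesis
  proof (rule has_integral_eq[rotated])
    fix s assume "s \<in> {0..L}"
    have "(1 / (pi * \<i>)) * (R.r x x (\<sigma> s) * V s) = (V s / \<i> * R.r x x (\<sigma> s)) / of_real pi"
      by (simp only: divide_inverse inverse_mult_distrib mult_1_left mult_ac)
    then show "Re ((1 / (pi * \<i>)) * (R.r x x (\<sigma> s) * V s)) = inner (mu_op L \<sigma> A s x) x"
      by (simp only: Re_divide_of_real inner_mu_op[where \<sigma>=\<sigma> and s=s, OF A \<sigma>_notin[OF \<open>s \<in> _\<close>]] outer_normal_V R.r_def)
  qed
qed

text \<open>For fixed k the integral of H1 is compared with that of \<mu> against 1/P^n, using that
  H2 integrates to 0. Letting k tend to infinity turns H1 into the Faber integral; only then does
  \<epsilon>, the defect of the modulus on the curve, tend to 0.\<close>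

lemma faber_form_bound:
  assumes nt: "\<exists>x::'a. x \<noteq> 0" and n: "n \<ge> 1" and x: "norm x = 1" and y: "norm y = 1"
  shows "cmod (cinner (poly_op (faber_poly E n) A x) y) \<le> 2 + 2 * integral {0..L} (alpha_minus L \<sigma> A)"
proof -
  let ?\<Phi> = "exterior_map E" and ?F = "faber_poly E n" and ?\<alpha> = "alpha_minus L \<sigma> A"
  obtain a K P where aU: "a \<in> U" and K: "\<And>k::nat. compact (K k)" "\<And>k. K k \<subseteq> U" 
    and P: "\<And>k. P k holomorphic_on - K k" "\<And>k z. z \<notin> K k \<Longrightarrow> P k z \<noteq> 0 \<and> cmod (P k z) < 1"
    and Plim: "\<And>S. compact S \<Longrightarrow> S \<subseteq> - E \<Longrightarrow> uniform_limit S P (\<lambda>z. 1 / ?\<Phi> z) sequentially"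
    and PC: "\<And>\<epsilon>. \<epsilon> > 0 \<Longrightarrow> \<forall>\<^sub>F k in sequentially. \<forall>z\<in>C. cmod (P k z) > 1 - \<epsilon>"
    and decay: "\<exists>M. \<forall>k. \<forall>z. cmod (z - a) > M \<longrightarrow> cmod (P k z) \<le> M / cmod (z - a)"
  proof (rule exterior_map_approximation)
    fix a K P
    assume "a \<in> U" "\<And>k::nat. compact (K k)" "\<And>k. K k \<subseteq> U"
      "\<And>k. P k holomorphic_on - K k" "\<And>k z. z \<notin> K k \<Longrightarrow> P k z \<noteq> 0 \<and> cmod (P k z) < 1"
      "\<And>S. compact S \<Longrightarrow> S \<subseteq> - E \<Longrightarrow> uniform_limit S P (\<lambda>z. 1 / ?\<Phi> z) sequentially"
      "\<And>\<epsilon>. \<epsilon> > 0 \<Longrightarrow> \<forall>\<^sub>F k in sequentially. \<forall>z\<in>C. cmod (P k z) > 1 - \<epsilon>"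
      "\<exists>M. \<forall>k. \<forall>z. cmod (z - a) > M \<longrightarrow> cmod (P k z) \<le> M / cmod (z - a)"
    then show thesis by (rule that[of a K P])
  qed
  from decay obtain M where M: "\<And>k z. cmod (z - a) > M \<Longrightarrow> cmod (P k z) \<le> M / cmod (z - a)" by blast
  obtain KA where KA: "KA > 0" "\<And>x. norm (A x) \<le> KA * norm x" using bounded_clinear_bound[OF A] by blast
  obtain B where B: "B > 0" "\<And>z x. z \<in> C \<Longrightarrow> norm (resolvent A z x) \<le> B * norm x"
    using resolvent_bound_C by blast
  obtain b where b: "b > 0" "E \<subseteq> ball a b" using compact_imp_bounded[OF compact_E] bounded_subset_ballD by blast
  \<comment> \<open>Large enough both for the disk to contain E and for the size condition of
    \<open>resolvent_setting\<close>.\<close>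
  define \<rho>0 where "\<rho>0 = b + 2 * (KA + cmod a)"
  have "b \<le> \<rho>0" using KA(1) by (simp add: \<rho>0_def add_nonneg_nonneg)
  then have b\<rho>0: "b \<le> \<rho>0" "0 < \<rho>0" using b(1) by simp_all
  have E0: "E \<subseteq> ball a \<rho>0" using b(2) subset_ball[OF b\<rho>0(1), of a] by blast
  have U0: "U \<subseteq> cball a \<rho>0" using E0 E ball_subset_cball by blast
  interpret R: resolvent_setting A KA a \<rho>0
    by standard (use A KA(2) spec U0 b\<rho>0 b(1) in \<open>auto simp: \<rho>0_def\<close>)
  define \<rho> where "\<rho> = \<rho>0 + 1"
  have \<rho>: "\<rho>0 < \<rho>" "0 < \<rho>" using b\<rho>0 by (auto simp: \<rho>_def)
  have E\<rho>: "E \<subseteq> ball a \<rho>" using E0 subset_ball[of \<rho>0 \<rho> a] \<rho>(1) by auto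
  have out: "- cball a \<rho>0 \<subseteq> - K k" "- cball a \<rho>0 \<subseteq> - E" for k
    using K(2)[of k] U0 E0 ball_subset_cball[of a \<rho>0] by blast+
  have \<Phi>: "?\<Phi> holomorphic_on - E" and \<Phi>_bij: "bij_betw ?\<Phi> (- E) (- cball 0 1)"
    using is_exterior_map_exterior_map unfolding is_exterior_map_def by auto
  have \<Phi>0: "?\<Phi> z \<noteq> 0" if "z \<in> - E" for z
  proof -
    have "?\<Phi> z \<in> - cball 0 1" using bij_betwE[OF \<Phi>_bij] that by blast
    then show ?thesis by auto
  qed
  let ?c = "circlepath a \<rho>"
  let ?X = "contour_integral ?c (\<lambda>z. ?\<Phi> z ^ n * R.r x y z)"

  have X: "?X = 2 * pi * \<i> * cinner (poly_op ?F A x) y"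
  proof -
    have h\<Phi>: "(\<lambda>z. ?\<Phi> z ^ n) holomorphic_on - cball a \<rho>0"
      by (intro holomorphic_intros holomorphic_on_subset[OF \<Phi> out(2)])
    have h1: "(\<lambda>z. ?\<Phi> z ^ n * R.r x y z) holomorphic_on - cball a \<rho>0"
      by (intro holomorphic_on_mult h\<Phi> R.r_holomorphic_outside)
    have h2: "(\<lambda>z. poly ?F z * R.r x y z) holomorphic_on - cball a \<rho>0"
      by (intro holomorphic_intros R.r_holomorphic_outside)
    have h3: "(\<lambda>z. (?\<Phi> z ^ n - poly ?F z) * R.r x y z) holomorphic_on - cball a \<rho>0"
      by (intro holomorphic_on_mult holomorphic_on_diff h\<Phi> R.r_holomorphic_outside) (intro holomorphic_intros)
    obtain c where c: "c > 0" "\<forall>\<^sub>F z in at_infinity. cmod (?\<Phi> z ^ n - poly ?F z) \<le> c * cmod (1 / z)"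
      using landau_o.bigE[OF faber_poly_bigo[of n]] by blast
    then obtain R1 where R1: "\<And>z. cmod z \<ge> R1 \<Longrightarrow> cmod (?\<Phi> z ^ n - poly ?F z) \<le> c * cmod (1 / z)"
      unfolding eventually_at_infinity by blast
    \<comment> \<open>Both factors are O(1/|z - a|) at infinity, so replacing \<Phi>^n by its
      polynomial part does not change the integral.\<close>
    have "contour_integral ?c (\<lambda>z. (?\<Phi> z ^ n - poly ?F z) * R.r x y z) = 0"
    proof (rule contour_integral_circlepath_decay[OF h3 \<rho>, where Rmin="max \<rho>0 (2 * \<bar>R1\<bar> + 2 * cmod a)" and M="4 * c"])
      fix z assume z: "max \<rho>0 (2 * \<bar>R1\<bar> + 2 * cmod a) < cmod (z - a)"
      have z0: "\<rho>0 < cmod (z - a)" "2 * \<bar>R1\<bar> + 2 * cmod a < cmod (z - a)" using z by auto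
      have pos: "0 < cmod (z - a)" using z0(1) b\<rho>0 by linarith
      have tri: "cmod (z - a) \<le> cmod z + cmod a" by (rule norm_triangle_ineq4)
      have zz: "cmod (z - a) \<le> 2 * cmod z" using tri z0(2) norm_ge_zero[of a] by linarith
      have zR: "R1 \<le> cmod z" using tri z0(2) norm_ge_zero[of a] abs_ge_self[of R1] by linarith
      have "cmod z > 0" using zz pos by linarith
      then have "1 / cmod z \<le> 2 / cmod (z - a)" using zz pos by (simp add: field_simps)
      then have "c * cmod (1 / z) \<le> c * (2 / cmod (z - a))" using c(1) by (intro mult_left_mono) (auto simp: norm_divide)
      then have 1: "cmod (?\<Phi> z ^ n - poly ?F z) \<le> c * (2 / cmod (z - a))" using R1[OF zR] by linarith
      have 2: "cmod (R.r x y z) \<le> 2 / cmod (z - a)" using R.r_decay[OF z0(1), of x y] x y by simp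
      have "cmod ((?\<Phi> z ^ n - poly ?F z) * R.r x y z) \<le> (c * (2 / cmod (z - a))) * (2 / cmod (z - a))"
        unfolding norm_mult using c(1) pos by (intro mult_mono 1 2) auto
      also have "\<dots> = 4 * c / (cmod (z - a))\<^sup>2" by (simp add: power2_eq_square)
      finally show "cmod ((?\<Phi> z ^ n - poly ?F z) * R.r x y z) \<le> 4 * c / (cmod (z - a))\<^sup>2" .
    qed
    moreover have "contour_integral ?c (\<lambda>z. (?\<Phi> z ^ n - poly ?F z) * R.r x y z) = ?X - contour_integral ?c (\<lambda>z. poly ?F z * R.r x y z)"
      unfolding left_diff_distrib
      by (rule contour_integral_diff[OF R.integrable_outside[OF \<rho>(1) h1] R.integrable_outside[OF \<rho>(1) h2]])
    ultimately show ?thesis using R.contour_integral_poly_r[OF \<rho>(1), of ?F x y] by simp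
  qed

  \<comment> \<open>H1 approximates the Faber integrand. In H2 the vectors are exchanged because its
    conjugate is to supply the adjoint part of \<mu>.\<close>
  define H1 where "H1 k z = R.r x y z / P k z ^ n" for k z
  define H2 where "H2 k z = P k z ^ n * R.r y x z" for k z
  let ?K = "\<lambda>k. K k \<union> cspectrum A"
  have cK: "compact (?K k)" "?K k \<subseteq> U" for k using K compact_spec spec by (auto intro: compact_Un)
  have holP: "P k holomorphic_on - ?K k" for k by (rule holomorphic_on_subset[OF P(1)]) auto
  have holr: "R.r u v holomorphic_on - ?K k" for u v k by (rule R.r_holomorphic) auto
  have H1: "H1 k holomorphic_on - ?K k" for k
    unfolding H1_def[abs_def] using P(2) by (intro holomorphic_intros holP holr) auto
  have H2: "H2 k holomorphic_on - ?K k" for k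
    unfolding H2_def[abs_def] by (intro holomorphic_intros holP holr)
  have outK: "- cball a \<rho>0 \<subseteq> - ?K k" for k using cK(2)[of k] U0 by blast

  have H1_lim: "(\<lambda>k. contour_integral ?c (H1 k)) \<longlonglongrightarrow> ?X"
  proof -
    have S: "compact (sphere a \<rho>)" "sphere a \<rho> \<subseteq> - E" using E\<rho> by auto
    have cont\<Phi>: "continuous_on (sphere a \<rho>) ?\<Phi>"
      using holomorphic_on_imp_continuous_on[OF \<Phi>] continuous_on_subset S(2) by blast
    have bdd: "bounded (f ` sphere a \<rho>)" if "continuous_on (sphere a \<rho>) f" for f :: "complex \<Rightarrow> complex"
      using compact_imp_bounded[OF compact_continuous_image[OF that S(1)]] .
    have \<Phi>nz: "\<forall>z\<in>sphere a \<rho>. ?\<Phi> z \<noteq> 0" using \<Phi>0 S(2) by blast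
    have "bounded ((\<lambda>z. ?\<Phi> z ^ n) ` sphere a \<rho>)" by (intro bdd continuous_intros cont\<Phi>)
    then obtain b\<Phi> where b\<Phi>0: "b\<Phi> > 0" and "\<forall>w\<in>(\<lambda>z. ?\<Phi> z ^ n) ` sphere a \<rho>. cmod w \<le> b\<Phi>"
      unfolding bounded_pos by blast
    then have b\<Phi>: "cmod (?\<Phi> z ^ n) \<le> b\<Phi>" if "z \<in> sphere a \<rho>" for z using that by blast
    have "uniform_limit (sphere a \<rho>) (\<lambda>k z. P k z ^ n) (\<lambda>z. (1 / ?\<Phi> z) ^ n) sequentially"
      by (rule uniform_limit_pow[OF Plim[OF S]]) (intro bdd continuous_intros cont\<Phi> \<Phi>nz)

    moreover have "bounded (R.r x y ` sphere a \<rho>)"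
    proof (rule bdd)
      have "sphere a \<rho> \<subseteq> - cball a \<rho>0" using \<rho>(1) by auto
      then show "continuous_on (sphere a \<rho>) (R.r x y)"
        using holomorphic_on_imp_continuous_on[OF R.r_holomorphic_outside] continuous_on_subset by blast
    qed
    \<comment> \<open>The uniform limit of the denominators has to stay away from 0 for the
      quotients to converge uniformly.\<close>
    moreover have "1 / b\<Phi> \<le> cmod ((1 / ?\<Phi> z) ^ n)" if "z \<in> sphere a \<rho>" for z
    proof -
      have "cmod (?\<Phi> z ^ n) > 0" using \<Phi>nz that by simp
      then have "1 / b\<Phi> \<le> 1 / cmod (?\<Phi> z ^ n)" using b\<Phi>[OF that] by (intro frac_le) simp_all
      then show ?thesis by (simp add: norm_divide norm_power power_one_over)
    qed
    ultimately have "uniform_limit (sphere a \<rho>) (\<lambda>k z. R.r x y z / P k z ^ n) (\<lambda>z. R.r x y z / (1 / ?\<Phi> z) ^ n) sequentially"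
      by (intro uniform_lim_divide[where b="1 / b\<Phi>"] uniform_limit_const) (use b\<Phi>0 in simp_all)
    then have ul: "uniform_limit (sphere a \<rho>) H1 (\<lambda>z. ?\<Phi> z ^ n * R.r x y z) sequentially"
      by (simp add: H1_def[abs_def] power_one_over mult.commute)
    have "H1 k contour_integrable_on ?c" for k
      by (rule R.integrable_outside[OF \<rho>(1) holomorphic_on_subset[OF H1 outK]])
    then show ?thesis
      by (intro contour_integral_uniform_limit_circlepath(2)[OF _ ul]) (use \<rho> in auto)
  qed

  have H2_zero: "contour_integral ?c (H2 k) = 0" for k
  proof (rule contour_integral_circlepath_decay[OF holomorphic_on_subset[OF H2 outK] \<rho>, where Rmin="max \<rho>0 \<bar>M\<bar>" and M="2 * \<bar>M\<bar>"])
    fix z assume z: "max \<rho>0 \<bar>M\<bar> < cmod (z - a)"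
    have z0: "\<rho>0 < cmod (z - a)" "M < cmod (z - a)" using z by auto
    have pos: "0 < cmod (z - a)" using z0(1) b\<rho>0 by linarith
    have "z \<in> - cball a \<rho>0" using z0(1) by (simp add: dist_norm norm_minus_commute)
    then have zK: "z \<notin> K k" using out(1)[of k] by blast
    \<comment> \<open>Here n >= 1 enters: one factor P decays like 1/|z - a|, and the others have
      modulus below 1. The resolvent form adds the second power.\<close>
    have "cmod (P k z ^ n) \<le> cmod (P k z) ^ 1"
      unfolding norm_power using P(2)[OF zK] n by (intro power_decreasing) auto
    also have "\<dots> \<le> \<bar>M\<bar> / cmod (z - a)"
    proof -
      have "M / cmod (z - a) \<le> \<bar>M\<bar> / cmod (z - a)" by (rule divide_right_mono) auto
      then show ?thesis using M[OF z0(2), of k] by simp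
    qed
    finally have 1: "cmod (P k z ^ n) \<le> \<bar>M\<bar> / cmod (z - a)" .
    have 2: "cmod (R.r y x z) \<le> 2 / cmod (z - a)" using R.r_decay[OF z0(1), of y x] x y by simp
    have "cmod (H2 k z) \<le> (\<bar>M\<bar> / cmod (z - a)) * (2 / cmod (z - a))"
      unfolding H2_def norm_mult using pos by (intro mult_mono 1 2) auto
    then show "cmod (H2 k z) \<le> 2 * \<bar>M\<bar> / (cmod (z - a))\<^sup>2" by (simp add: power2_eq_square mult_ac)
  qed

  have \<alpha>int: "?\<alpha> integrable_on {0..L}"
    using alpha_minus_absolutely_integrable[OF nt] set_lebesgue_integral_eq_integral(1) by blast
  let ?I = "integral {0..L} ?\<alpha>"
  let ?q = "\<lambda>s. (inner (mu_op L \<sigma> A s x) x + inner (mu_op L \<sigma> A s y) y) / 2 + 2 * ?\<alpha> s"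
  have q_ge: "cmod (cinner (mu_op L \<sigma> A s x) y) \<le> ?q s" if s: "s \<in> {0..L}" for s
  proof (rule selfadjoint_form_bound[OF _ _ _ _ x y])
    show "bounded_clinear (mu_op L \<sigma> A s)"
      by (rule bounded_clinear_mu_op[where \<sigma>=\<sigma> and s=s, OF A \<sigma>_notin[OF s]])
    show "cinner (mu_op L \<sigma> A s u) v = cinner u (mu_op L \<sigma> A s v)" for u v
      by (rule mu_op_selfadjoint[where \<sigma>=\<sigma> and s=s, OF A \<sigma>_notin[OF s]])
    show "- ?\<alpha> s * (norm v)\<^sup>2 \<le> inner (mu_op L \<sigma> A s v) v" for v
      by (rule alpha_minus_form[OF nt s])
  qed (simp add: alpha_minus_def)
  have q_int: "(?q has_integral (2 + 2) / 2 + 2 * ?I) {0..L}"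
    by (intro has_integral_add has_integral_divide has_integral_mult_right inner_mu_op_has_integral x y integrable_integral \<alpha>int)

  \<comment> \<open>On \<open>C\<close> the conjugate of \<open>1 / P\<^sup>n\<close> is nearly \<open>P\<^sup>n\<close>, and the integral of \<open>H2\<close> vanishes.\<close>
  have key: "cmod (contour_integral ?c (H1 k)) \<le> 2 * pi / t * (2 + 2 * ?I) + B * (1 / t - t) * L"
    if t: "0 < t" "t \<le> 1" and Pt: "\<And>z. z \<in> C \<Longrightarrow> t \<le> cmod (P k z ^ n)" for k t
  proof -
    \<comment> \<open>The conjugated H2 term contributes nothing to the integral but completes the
      resolvent term of H1 to \<mu>.\<close>
    define e where "e s = (H1 k (\<sigma> s) * V s) / \<i> + cnj ((H2 k (\<sigma> s) * V s) / \<i>)" for s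
    have i1: "((\<lambda>s. H1 k (\<sigma> s) * V s) has_integral contour_integral ?c (H1 k)) {0..L}"
      by (rule loop_integral_circlepath[OF cK H1 E\<rho> \<rho>(2)])
    have i2: "((\<lambda>s. H2 k (\<sigma> s) * V s) has_integral 0) {0..L}"
      using loop_integral_circlepath[OF cK H2 E\<rho> \<rho>(2), of k] by (simp only: H2_zero)
    have "(e has_integral contour_integral ?c (H1 k) / \<i> + cnj (0 / \<i>)) {0..L}"
      unfolding e_def[abs_def]
      using has_integral_add[OF has_integral_divide[OF i1] has_integral_cnj[THEN iffD2, OF has_integral_divide[OF i2]], of \<i> \<i>]
      by (simp only: o_def)
    then have e_int: "(e has_integral contour_integral ?c (H1 k) / \<i>) {0..L}" by simp
    have e': "((\<lambda>s. if s \<in> bad then 0 else e s) has_integral contour_integral ?c (H1 k) / \<i>) {0..L}"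
      by (rule has_integral_spike[OF negligible_bad _ e_int]) auto
    let ?Q = "\<lambda>s. 2 * pi / t * ?q s + B * (1 / t - t)"
    have const: "((\<lambda>_. B * (1 / t - t)) has_integral B * (1 / t - t) * L) {0..L}"
      using has_integral_const_real[of "B * (1 / t - t)" 0 L] L by (simp add: mult.commute)
    have Q_int: "(?Q has_integral 2 * pi / t * ((2 + 2) / 2 + 2 * ?I) + B * (1 / t - t) * L) {0..L}"
      by (intro has_integral_add has_integral_mult_right q_int const)
    have tt: "0 \<le> 1 / t - t"
    proof -
      have "t * t \<le> 1 * 1" using t by (intro mult_mono) auto
      then show ?thesis using t by (simp add: field_simps)
    qed
    have bound: "norm (if s \<in> bad then 0 else e s) \<le> ?Q s" if s: "s \<in> {0..L}" for s
    proof (cases "s \<in> bad")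
      case True
      have q0: "0 \<le> ?q s" by (rule order_trans[OF norm_ge_zero q_ge[OF s]])
      have "0 \<le> 2 * pi / t * ?q s" by (rule mult_nonneg_nonneg[OF _ q0]) (use t in simp)
      moreover have "0 \<le> B * (1 / t - t)" by (rule mult_nonneg_nonneg[OF less_imp_le[OF B(1)] tt])
      ultimately have "0 \<le> ?Q s" by (rule add_nonneg_nonneg)
      then show ?thesis using True by simp
    next
      case False
      define w where "w = P k (\<sigma> s) ^ n"
      define \<nu> where "\<nu> = V s / \<i>"
      let ?m = "cinner (mu_op L \<sigma> A s x) y"
      have sC: "\<sigma> s \<in> C" using \<sigma>C s by blast
      then have sK: "\<sigma> s \<notin> K k" using K(2) C_Int_U by blast
      have w: "w \<noteq> 0" "t \<le> cmod w" "cmod w < 1"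
      proof -
        show "w \<noteq> 0" using P(2)[OF sK] by (simp add: w_def)
        show "t \<le> cmod w" using Pt[OF sC] by (simp add: w_def)
        show "cmod w < 1" unfolding w_def norm_power using P(2)[OF sK] n by (intro power_less_one_iff[THEN iffD2]) auto
      qed
      have \<nu>1: "cmod \<nu> \<le> 1" using norm_V_le[OF s False] unfolding \<nu>_def norm_divide by simp
      have m: "\<nu> * R.r x y (\<sigma> s) + cnj (\<nu> * R.r y x (\<sigma> s)) = of_real (2 * pi) * ?m"
        unfolding cinner_mu_op[where \<sigma>=\<sigma> and s=s, OF A \<sigma>_notin[OF s]] outer_normal_V R.r_def \<nu>_def
        by (simp del: of_real_mult)
      \<comment> \<open>Writing the conjugate of w as 1/w plus a defect collects both resolvent
        terms into 2 \<pi> times the form of \<mu>, divided by w.\<close>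
      have ew: "e s = (1 / w) * (of_real (2 * pi) * ?m) + cnj (\<nu> * R.r y x (\<sigma> s)) * (cnj w - 1 / w)"
      proof -
        have "e s = R.r x y (\<sigma> s) / w * \<nu> + cnj (w * R.r y x (\<sigma> s) * \<nu>)"
          unfolding e_def H1_def H2_def w_def[symmetric] \<nu>_def by simp
        also have "\<dots> = (1 / w) * (\<nu> * R.r x y (\<sigma> s) + cnj (\<nu> * R.r y x (\<sigma> s))) + cnj (\<nu> * R.r y x (\<sigma> s)) * (cnj w - 1 / w)"
          by (simp add: algebra_simps)
        finally show ?thesis unfolding m .
      qed
      have 1: "cmod ((1 / w) * (of_real (2 * pi) * ?m)) \<le> (1 / t) * (2 * pi * ?q s)"
      proof -
        have "cmod (1 / w) \<le> 1 / t" using w t by (simp add: norm_divide frac_le)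
        moreover have "cmod (of_real (2 * pi) * ?m) \<le> 2 * pi * ?q s"
          using q_ge[OF s] by (simp add: norm_mult)
        ultimately show ?thesis unfolding norm_mult[of "1 / w"] using t by (intro mult_mono) auto
      qed
      \<comment> \<open>The defect has modulus 1/|w| - |w|, which decreases in |w|; the worst case
        is |w| = t.\<close>
      have 2: "cmod (cnj w - 1 / w) \<le> 1 / t - t"
      proof -
        have "w * cnj w = of_real ((cmod w)\<^sup>2)" by (rule complex_norm_square[symmetric])
        then have "cnj w - 1 / w = of_real ((cmod w)\<^sup>2 - 1) / w" using w(1) by (simp add: field_simps)
        then have "cmod (cnj w - 1 / w) = \<bar>(cmod w)\<^sup>2 - 1\<bar> / cmod w" by (simp only: norm_divide norm_of_real)
        also have "\<bar>(cmod w)\<^sup>2 - 1\<bar> = 1 - (cmod w)\<^sup>2" using w(3) by (simp add: abs_if power_less_one_iff)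
        also have "(1 - (cmod w)\<^sup>2) / cmod w = 1 / cmod w - cmod w" using w(1) by (simp add: power2_eq_square field_simps)
        also have "\<dots> \<le> 1 / t - t" using w t by (intro diff_mono) (auto simp: frac_le)
        finally show ?thesis .
      qed
      have 3: "cmod (cnj (\<nu> * R.r y x (\<sigma> s))) \<le> B"
      proof -
        have "cmod (R.r y x (\<sigma> s)) \<le> B"
          using norm_cinner_le[of "resolvent A (\<sigma> s) y" x] B(2)[OF sC, of y] x y by (simp add: R.r_def)
        then have "cmod \<nu> * cmod (R.r y x (\<sigma> s)) \<le> 1 * B" using \<nu>1 by (intro mult_mono) auto
        then show ?thesis by (simp add: norm_mult)
      qed
      have "cmod (e s) \<le> cmod ((1 / w) * (of_real (2 * pi) * ?m)) + cmod (cnj (\<nu> * R.r y x (\<sigma> s)) * (cnj w - 1 / w))"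
        unfolding ew by (rule norm_triangle_ineq)
      also have "\<dots> \<le> (1 / t) * (2 * pi * ?q s) + B * (1 / t - t)"
        unfolding norm_mult[of "cnj (\<nu> * R.r y x (\<sigma> s))"] using B(1) by (intro add_mono 1 mult_mono 2 3) auto
      finally show ?thesis using False by simp
    qed
    have "norm (integral {0..L} (\<lambda>s. if s \<in> bad then 0 else e s)) \<le> integral {0..L} ?Q"
      by (rule Henstock_Kurzweil_Integration.integral_norm_bound_integral[OF has_integral_integrable[OF e'] has_integral_integrable[OF Q_int] bound])
    then show ?thesis
      unfolding integral_unique[OF e'] integral_unique[OF Q_int] norm_divide by simp
  qed

  have "2 * pi * cmod (cinner (poly_op ?F A x) y) = cmod ?X" unfolding X by (simp add: norm_mult)
  have lower: "2 * pi * cmod (cinner (poly_op ?F A x) y) \<le> 2 * pi / (1 - \<epsilon>) ^ n * (2 + 2 * ?I) + B * (1 / (1 - \<epsilon>) ^ n - (1 - \<epsilon>) ^ n) * L"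
    if \<epsilon>: "0 < \<epsilon>" "\<epsilon> < 1" for \<epsilon>
  proof -
    have "\<forall>\<^sub>F k in sequentially. cmod (contour_integral ?c (H1 k)) \<le> 2 * pi / (1 - \<epsilon>) ^ n * (2 + 2 * ?I) + B * (1 / (1 - \<epsilon>) ^ n - (1 - \<epsilon>) ^ n) * L"
      using PC[OF \<epsilon>(1)]
    proof eventually_elim
      case (elim k)
      show ?case
      proof (rule key)
        show "(1 - \<epsilon>) ^ n \<le> cmod (P k z ^ n)" if "z \<in> C" for z
          unfolding norm_power using elim that \<epsilon> by (intro power_mono) (auto simp: less_imp_le)
      qed (use \<epsilon> in \<open>auto simp: power_le_one\<close>)
    qed
    then show ?thesis
      unfolding \<open>2 * pi * cmod (cinner (poly_op ?F A x) y) = cmod ?X\<close>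
      by (rule tendsto_upperbound[OF tendsto_norm[OF H1_lim]]) simp
  qed
  have "((\<lambda>\<epsilon>. 2 * pi / (1 - \<epsilon>) ^ n * (2 + 2 * ?I) + B * (1 / (1 - \<epsilon>) ^ n - (1 - \<epsilon>) ^ n) * L) \<longlongrightarrow>
      2 * pi / (1 - 0) ^ n * (2 + 2 * ?I) + B * (1 / (1 - 0) ^ n - (1 - 0) ^ n) * L) (at_right (0::real))"
    by (intro tendsto_intros) auto
  moreover have "\<forall>\<^sub>F \<epsilon> in at_right (0::real). 2 * pi * cmod (cinner (poly_op ?F A x) y) \<le> 2 * pi / (1 - \<epsilon>) ^ n * (2 + 2 * ?I) + B * (1 / (1 - \<epsilon>) ^ n - (1 - \<epsilon>) ^ n) * L"
    unfolding eventually_at_right_field using lower by (intro exI[of _ 1]) auto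
  ultimately have "2 * pi * cmod (cinner (poly_op ?F A x) y) \<le> 2 * pi / (1 - 0) ^ n * (2 + 2 * ?I) + B * (1 / (1 - 0) ^ n - (1 - 0) ^ n) * L"
    by (rule tendsto_lowerbound) simp
  then have "2 * pi * cmod (cinner (poly_op ?F A x) y) \<le> 2 * pi * (2 + 2 * ?I)" by simp
  then show ?thesis by (rule mult_left_le_imp_le) simp
qed

end

section \<open>From the form bound to the operator norm\<close>

lemma poly_op_scaleR:
  fixes A :: "'a::complex_inner \<Rightarrow> 'a"
  assumes A: "bounded_clinear A"
  shows "poly_op p A (c *\<^sub>R x) = c *\<^sub>R poly_op p A x"
proof -
  have "(A ^^ k) (c *\<^sub>R x) = c *\<^sub>R (A ^^ k) x" for k
    by (induction k) (simp_all add: linear_cmul[OF bounded_linear.linear[OF bounded_clinear_linear[OF A]]])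
  then show ?thesis by (simp add: poly_op_def scaleR_right.sum scaleC_scaleR)
qed

theorem lemma4:
  fixes E :: "complex set" and A :: "'a::complex_hilbert \<Rightarrow> 'a"
    and L :: real and \<sigma> :: "real \<Rightarrow> complex" and n :: nat
  assumes "compact E"
    and "rectifiable_Jordan_curve (frontier E)"
    and "E = frontier E \<union> inside (frontier E)"
    and "bounded_clinear A"
    and "cspectrum A \<subseteq> interior E"
    and "ccw_arc_length_param (frontier E) L \<sigma>"
    and "n \<ge> 1"
  shows "onorm (poly_op (faber_poly E n) A)
           \<le> 2 * (1 + (LINT s:{0..L}|lebesgue. alpha_minus L \<sigma> A s))"
proof (cases "\<exists>x::'a. x \<noteq> 0")
  case False
  \<comment> \<open>On the zero space the spectrum is empty and \<open>min_spectrum\<close> is an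
    unspecified value. The \<open>max 0\<close> in \<open>alpha_minus\<close> still makes the
    integral nonnegative, which is enough.\<close>
  then have "poly_op (faber_poly E n) A = (\<lambda>x. 0)" by (metis (full_types) ext)
  moreover have "0 \<le> (LINT s:{0..L}|lebesgue. alpha_minus L \<sigma> A s)"
    unfolding set_lebesgue_integral_def by (rule Bochner_Integration.integral_nonneg) (simp add: alpha_minus_def)
  ultimately show ?thesis by (simp add: onorm_zero)
next
  case True
  obtain g where g: "simple_path g" "pathfinish g = pathstart g" "path_image g = frontier E"
    using assms(2) unfolding rectifiable_Jordan_curve_def by blast
  note \<sigma> = assms(6)[unfolded ccw_arc_length_param_def]
  have "interior E \<inter> frontier E = {}" by (auto simp: frontier_def)
  then have "interior E \<subseteq> inside (frontier E)" using assms(3) interior_subset[of E] by blast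
  then interpret operator_in_jordan_region g "frontier E" "inside (frontier E)" E L \<sigma> A
    using g assms(3-5) \<sigma> by unfold_locales (auto intro: dist_le_of_arc_length)
  let ?I = "LINT s:{0..L}|lebesgue. alpha_minus L \<sigma> A s" and ?T = "poly_op (faber_poly E n) A"
  have I: "?I = integral {0..L} (alpha_minus L \<sigma> A)"
    by (rule set_lebesgue_integral_eq_integral(2)[OF alpha_minus_absolutely_integrable[OF True]])
  have I0: "0 \<le> ?I"
    unfolding set_lebesgue_integral_def by (rule Bochner_Integration.integral_nonneg) (simp add: alpha_minus_def)
  have unit: "norm (?T x) \<le> 2 * (1 + ?I)" if x: "norm x = 1" for x
  proof (cases "?T x = 0")
    case True
    then show ?thesis using I0 by simp
  next
    case False
    \<comment> \<open>At this y the form of the operator at (x, y) equals the norm of its value at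
      x.\<close>
    define y where "y = ?T x /\<^sub>R norm (?T x)"
    have y: "norm y = 1" using False by (simp add: y_def)
    have "?T x = norm (?T x) *\<^sub>R y" using False by (simp add: y_def)
    then have "cinner (?T x) y = of_real (norm (?T x)) * cinner y y" by (metis cinner_scaleR_left)
    then have "cmod (cinner (?T x) y) = norm (?T x)" by (simp add: cinner_self y)
    then show ?thesis using faber_form_bound[OF True assms(7) x y] by (simp add: I)
  qed
  show ?thesis
  proof (rule onorm_bound)
    show "0 \<le> 2 * (1 + ?I)" using I0 by simp
    fix x
    show "norm (?T x) \<le> 2 * (1 + ?I) * norm x"
    proof (cases "x = 0")
      case True
      then show ?thesis using poly_op_scaleR[OF assms(4), of "faber_poly E n" 0 x] by simp
    next
      case False
      have "norm (?T (x /\<^sub>R norm x)) \<le> 2 * (1 + ?I)" by (rule unit) (use False in simp)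
      then show ?thesis using False by (simp add: poly_op_scaleR[OF assms(4)] field_simps)
    qed
  qed
qed

end
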